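(* Consider two families of densities $\{g_\theta:\theta\in\Theta\}$ and $\{h_\gamma:\gamma\in\Gamma\}$ satisfying conditions A1, A2, A3 (listed in the context). Let $\phi$ on $\Theta$ and $\varphi$ on $\Gamma$ be prior densities that are positive and Lipschitz continuous, and let $$BF=\frac{\int_{\Gamma}\varphi(\gamma)\prod_{i=1}^n h_\gamma(X_i)\,d\gamma}{\int_{\Theta}\phi(\theta)\prod_{i=1}^n g_\theta(X_i)\,d\theta}$$ be the Bayes factor. Select the $h$-family if $BF>1$ and the $g$-family otherwise. Then the asymptotic decay rates of the probability of selecting the wrong model are identical under the two families: as $n\to\infty$, $$\log\int_{\Theta}P_{g_\theta}(BF>1)\phi(\theta)\,d\theta\ \sim\ \sup_{\theta\in\Theta}\log P_{g_\theta}(BF>1)\ \sim\ \log\int_{\Gamma}P_{h_\gamma}(BF\le1)\varphi(\gamma)\,d\gamma\ \sim\ \sup_{\gamma\in\Gamma}\log P_{h_\gamma}(BF\le 1)\ \sim\ -n\times\min_{\theta\in\Theta,\gamma\in\Gamma}\rho_{\theta\gamma},$$ where $\rho_{\theta\gamma}$ is the Chernoff index between $g_\theta$ and $h_\gamma$.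
   Context: Setting: $\{g_\theta:\theta\in\Theta\}$ and $\{h_\gamma:\gamma\in\Gamma\}$ are two parametric families of probability densities on $\mathbb{R}$ with respect to a common baseline measure $\mu$; all distributions in the two families are mutually absolutely continuous. $P_f$ and $E_f$ denote probability and expectation when $X,X_1,X_2,\dots$ are i.i.d. with density $f$. Notation: $a_n\sim b_n$ means $a_n/b_n\to1$ as $n\to\infty$. Chernoff index: for densities $g,h$ let $l=\log h(X)-\log g(X)$, $M_g(z)=E_g(e^{zl})=\int (h/g)^z g\,d\mu$, $m_g(t)=\max_z[zt-\log M_g(z)]$. Switching the roles of $g$ and $h$, let $M_h(z)=E_h[e^{z(\log g(X)-\log h(X))}]$ and $m_h(t)=\max_z[zt-\log M_h(z)]$. The Chernoff index between $g$ and $h$ is $\rho=\max_{E_g(l)<t<E_h(l)}\min\{m_g(t),m_h(-t)\}$; it is attained at $t=0$ and equals $\max_z[-\log M_g(z)]$. $\rho_{\theta\gamma}$ is this quantity for $g=g_\theta$, $h=h_\gamma$. Conditions: A1 (complete separation): $\min_{\theta\in\Theta,\gamma\in\Gamma}E_{g_\theta}\{\log g_\theta(X)-\log h_\gamma(X)\}>0$. A2: $\Theta\subset\mathbb{R}^{d_g}$ and $\Gamma\subset\mathbb{R}^{d_h}$ are compact with continuously differentiable boundaries $\partial\Theta$, $\partial\Gamma$. A3: with $l_{\theta\gamma}=\log h_\gamma(X)-\log g_\theta(X)$ (differentiable in $\theta$ and $\gamma$), $S_1=\sup_{\theta,\gamma}|\nabla_\theta l_{\theta\gamma}|$ and $S_2=\sup_{\theta,\gamma}|\nabla_\gamma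 l_{\theta\gamma}|$, there exist $\eta,x_0>0$, independent of $\theta$ and $\gamma$, such that for all $x>x_0$ and $i=1,2$, $\sup_{\theta\in\Theta,\gamma\in\Gamma}\max\{P_{g_\theta}(S_i>x),P_{h_\gamma}(S_i>x)\}\le e^{-(\log x)^{1+\eta}}$. *)

theory Defs
  imports "HOL-Probability.Probability"
begin

subsection \<open>Distributions and log-likelihood ratios\<close>

abbreviation law :: "real measure \<Rightarrow> (real \<Rightarrow> real) \<Rightarrow> real measure" where
  "law \<mu> f \<equiv> density \<mu> (\<lambda>x. ennreal (f x))"

definition sample_law :: "nat \<Rightarrow> real measure \<Rightarrow> (real \<Rightarrow> real) \<Rightarrow> (nat \<Rightarrow> real) measure" where
  "sample_law n \<mu> f = (\<Pi>\<^sub>M i\<in>{..<n}. law \<mu> f)"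

text \<open>Joint measurability in parameter and observation is what makes the Bayes factor a random
  variable.\<close>

definition density_family ::
    "real measure \<Rightarrow> 'a::euclidean_space set \<Rightarrow> ('a \<Rightarrow> real \<Rightarrow> real) \<Rightarrow> bool" where
  "density_family \<mu> \<Theta> g \<longleftrightarrow>
     (\<lambda>(\<theta>, x). g \<theta> x) \<in> borel_measurable (restrict_space borel \<Theta> \<Otimes>\<^sub>M borel) \<and>
     (\<forall>\<theta>\<in>\<Theta>. (\<forall>x. 0 \<le> g \<theta> x) \<and> prob_space (law \<mu> (g \<theta>)))"

definition mutually_abs_cont :: "real measure set \<Rightarrow> bool" where
  "mutually_abs_cont \<P> \<longleftrightarrow> (\<forall>P\<in>\<P>. \<forall>Q\<in>\<P>. absolutely_continuous P Q)"

definition log_lr :: "(real \<Rightarrow> real) \<Rightarrow> (real \<Rightarrow> real) \<Rightarrow> real \<Rightarrow> real" where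
  "log_lr g h x = ln (h x) - ln (g x)"

text \<open>Expectation with values in the extended reals. Used below only where at least one of the two
  parts is finite: the positive part of \<open>log_lr g h\<close> is integrable under \<open>g\<close>, since
  the mean of \<open>h / g\<close> is at most \<open>1\<close>, but its negative part need not be.\<close>

definition ext_mean :: "real measure \<Rightarrow> (real \<Rightarrow> real) \<Rightarrow> ereal" where
  "ext_mean P f = enn2ereal (\<integral>\<^sup>+x. ennreal (f x) \<partial>P) - enn2ereal (\<integral>\<^sup>+x. ennreal (- f x) \<partial>P)"


subsection \<open>Chernoff index\<close>

definition ext_ln :: "ennreal \<Rightarrow> ereal" where
  "ext_ln u = (if u = 0 then -\<infinity> else if u = \<infinity> then \<infinity> else ereal (ln (enn2real u)))"

definition lr_mgf :: "real measure \<Rightarrow> (real \<Rightarrow> real) \<Rightarrow> (real \<Rightarrow> real) \<Rightarrow> real \<Rightarrow> ennreal" where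
  "lr_mgf \<mu> g h z = (\<integral>\<^sup>+x. ennreal (exp (z * log_lr g h x)) \<partial>law \<mu> g)"

text \<open>Values of \<open>z\<close> with infinite \<open>lr_mgf\<close> contribute \<open>-\<infinity>\<close> to the supremum.\<close>

definition lr_rate :: "real measure \<Rightarrow> (real \<Rightarrow> real) \<Rightarrow> (real \<Rightarrow> real) \<Rightarrow> real \<Rightarrow> ereal" where
  "lr_rate \<mu> g h t = (SUP z::real. ereal (z * t) - ext_ln (lr_mgf \<mu> g h z))"

definition chernoff_index :: "real measure \<Rightarrow> (real \<Rightarrow> real) \<Rightarrow> (real \<Rightarrow> real) \<Rightarrow> ereal" where
  "chernoff_index \<mu> g h =
     (SUP t\<in>{t::real. ext_mean (law \<mu> g) (log_lr g h) < ereal t \<and>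
                      ereal t < ext_mean (law \<mu> h) (log_lr g h)}.
        min (lr_rate \<mu> g h t) (lr_rate \<mu> h g (- t)))"


subsection \<open>Regularity conditions\<close>

definition complete_separation :: "real measure \<Rightarrow> 'a set \<Rightarrow> 'b set \<Rightarrow>
    ('a \<Rightarrow> real \<Rightarrow> real) \<Rightarrow> ('b \<Rightarrow> real \<Rightarrow> real) \<Rightarrow> bool" where
  "complete_separation \<mu> \<Theta> \<Gamma> g h \<longleftrightarrow>
     0 < (INF (\<theta>, \<gamma>)\<in>\<Theta> \<times> \<Gamma>. ext_mean (law \<mu> (g \<theta>)) (\<lambda>x. ln (g \<theta> x) - ln (h \<gamma> x)))"

text \<open>Near each of its boundary points the set lies on one side of a \<open>C\<^sup>1\<close> hypersurface.\<close>

definition C1_boundary :: "'a::euclidean_space set \<Rightarrow> bool" where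
  "C1_boundary S \<longleftrightarrow>
     (\<forall>p\<in>frontier S. \<exists>U \<psi> D. open U \<and> p \<in> U \<and> continuous_on U D \<and>
        (\<forall>y\<in>U. (GDERIV \<psi> y :> D y) \<and> D y \<noteq> 0) \<and> S \<inter> U = {y\<in>U. \<psi> y \<le> 0})"

definition grad :: "('a::euclidean_space \<Rightarrow> real) \<Rightarrow> 'a filter \<Rightarrow> 'a" where
  "grad f F = (\<Sum>b\<in>Basis. frechet_derivative f F b *\<^sub>R b)"

text \<open>Derivatives are taken within the parameter set, hence one-sided at its boundary; they are
  unique there if the boundary is \<open>C\<^sup>1\<close>.\<close>

definition score_sup1 :: "'a::euclidean_space set \<Rightarrow> 'b set \<Rightarrow>
    ('a \<Rightarrow> real \<Rightarrow> real) \<Rightarrow> ('b \<Rightarrow> real \<Rightarrow> real) \<Rightarrow> real \<Rightarrow> ereal" where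
  "score_sup1 \<Theta> \<Gamma> g h x =
     (SUP (\<theta>, \<gamma>)\<in>\<Theta> \<times> \<Gamma>. ereal (norm (grad (\<lambda>t. log_lr (g t) (h \<gamma>) x) (at \<theta> within \<Theta>))))"

definition score_sup2 :: "'a set \<Rightarrow> 'b::euclidean_space set \<Rightarrow>
    ('a \<Rightarrow> real \<Rightarrow> real) \<Rightarrow> ('b \<Rightarrow> real \<Rightarrow> real) \<Rightarrow> real \<Rightarrow> ereal" where
  "score_sup2 \<Theta> \<Gamma> g h x =
     (SUP (\<theta>, \<gamma>)\<in>\<Theta> \<times> \<Gamma>. ereal (norm (grad (\<lambda>c. log_lr (g \<theta>) (h c) x) (at \<gamma> within \<Gamma>))))"

text \<open>Positivity is the requirement that the log-likelihood ratios be finite; like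
  differentiability it is only required almost surely.\<close>

definition llr_differentiable :: "real measure \<Rightarrow> 'a::euclidean_space set \<Rightarrow>
    'b::euclidean_space set \<Rightarrow> ('a \<Rightarrow> real \<Rightarrow> real) \<Rightarrow> ('b \<Rightarrow> real \<Rightarrow> real) \<Rightarrow> bool" where
  "llr_differentiable \<mu> \<Theta> \<Gamma> g h \<longleftrightarrow>
     (\<forall>\<theta>\<^sub>0\<in>\<Theta>. AE x in law \<mu> (g \<theta>\<^sub>0). \<forall>\<theta>\<in>\<Theta>. \<forall>\<gamma>\<in>\<Gamma>.
        0 < g \<theta> x \<and> 0 < h \<gamma> x \<and>
        (\<lambda>t. log_lr (g t) (h \<gamma>) x) differentiable (at \<theta> within \<Theta>) \<and>
        (\<lambda>c. log_lr (g \<theta>) (h c) x) differentiable (at \<gamma> within \<Gamma>))"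

text \<open>A supremum over an uncountable parameter set need not be Borel measurable, and
  \<open>emeasure\<close> vanishes on non-measurable sets, so the tails are measured by the outer measure,
  which agrees with \<open>emeasure\<close> on measurable sets.\<close>

definition score_tails :: "real measure \<Rightarrow> 'a::euclidean_space set \<Rightarrow>
    'b::euclidean_space set \<Rightarrow> ('a \<Rightarrow> real \<Rightarrow> real) \<Rightarrow> ('b \<Rightarrow> real \<Rightarrow> real) \<Rightarrow> bool" where
  "score_tails \<mu> \<Theta> \<Gamma> g h \<longleftrightarrow>
     (\<exists>\<eta>>0. \<exists>x\<^sub>0>0. \<forall>x>x\<^sub>0. \<forall>S\<in>{score_sup1 \<Theta> \<Gamma> g h, score_sup2 \<Theta> \<Gamma> g h}.
        (SUP (\<theta>, \<gamma>)\<in>\<Theta> \<times> \<Gamma>.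
           max (outer_measure_of (law \<mu> (g \<theta>)) {y. ereal x < S y})
               (outer_measure_of (law \<mu> (h \<gamma>)) {y. ereal x < S y}))
        \<le> ennreal (exp (- (ln x powr (1 + \<eta>)))))"


subsection \<open>Bayes factor\<close>

definition prior_density :: "'a::euclidean_space set \<Rightarrow> ('a \<Rightarrow> real) \<Rightarrow> bool" where
  "prior_density \<Theta> \<phi> \<longleftrightarrow>
     (\<forall>\<theta>\<in>\<Theta>. 0 < \<phi> \<theta>) \<and> (\<exists>L. L-lipschitz_on \<Theta> \<phi>) \<and> (LINT \<theta>:\<Theta>|lborel. \<phi> \<theta>) = 1"

definition marginal_lik :: "'a::euclidean_space set \<Rightarrow> ('a \<Rightarrow> real) \<Rightarrow>
    ('a \<Rightarrow> real \<Rightarrow> real) \<Rightarrow> nat \<Rightarrow> (nat \<Rightarrow> real) \<Rightarrow> real" where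
  "marginal_lik \<Theta> \<phi> g n X = (LINT \<theta>:\<Theta>|lborel. \<phi> \<theta> * (\<Prod>i<n. g \<theta> (X i)))"

definition bayes_factor :: "'a::euclidean_space set \<Rightarrow> 'b::euclidean_space set \<Rightarrow>
    ('a \<Rightarrow> real) \<Rightarrow> ('b \<Rightarrow> real) \<Rightarrow> ('a \<Rightarrow> real \<Rightarrow> real) \<Rightarrow> ('b \<Rightarrow> real \<Rightarrow> real) \<Rightarrow>
    nat \<Rightarrow> (nat \<Rightarrow> real) \<Rightarrow> real" where
  "bayes_factor \<Theta> \<Gamma> \<phi>\<^sub>g \<phi>\<^sub>h g h n X = marginal_lik \<Gamma> \<phi>\<^sub>h h n X / marginal_lik \<Theta> \<phi>\<^sub>g g n X"

definition prob_select_h :: "real measure \<Rightarrow> (real \<Rightarrow> real) \<Rightarrow> nat \<Rightarrow>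
    ((nat \<Rightarrow> real) \<Rightarrow> real) \<Rightarrow> real" where
  "prob_select_h \<mu> f n BF =
     measure (sample_law n \<mu> f) {X \<in> space (sample_law n \<mu> f). BF X > 1}"

definition prob_select_g :: "real measure \<Rightarrow> (real \<Rightarrow> real) \<Rightarrow> nat \<Rightarrow>
    ((nat \<Rightarrow> real) \<Rightarrow> real) \<Rightarrow> real" where
  "prob_select_g \<mu> f n BF =
     measure (sample_law n \<mu> f) {X \<in> space (sample_law n \<mu> f). BF X \<le> 1}"

end

theory Submission
  imports Defs
begin

text \<open>Write \<open>\<alpha>\<close> for the largest value, over all pairs, of the affinity
  \<open>\<integral> g powr (1 - z) * h powr z\<close> minimised over \<open>z \<in> {0..1}\<close>; the smallest Chernoff index is
  \<open>- ln \<alpha>\<close>, and by Fatou's lemma and compactness it is attained.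
  Outside an event of superexponentially small probability the scores are at most
  \<open>exp (n powr \<beta>)\<close> for some \<open>\<beta> < 1\<close>, so each marginal likelihood agrees with the maximum
  of the likelihood over a net up to a subexponential factor. Chernoff's bound on the pairs of net points
  then gives both upper bounds \<open>\<alpha> ^ n\<close>.

  For the lower bound, the Bayes risk of the two simple hypotheses of an extremal pair only controls
  the sum of the two error probabilities. Weighting the \<open>g\<close>-likelihood by \<open>exp (n * \<delta>)\<close> raises
  this risk exponentially above \<open>\<alpha> ^ n\<close>, hence above the error under \<open>h\<close>, so the error under
  \<open>g\<close> is at least \<open>\<alpha> ^ n * exp (- n * \<delta>)\<close> for every \<open>\<delta> > 0\<close>; the same holds with the
  two families exchanged.\<close>


subsection \<open>Sets with a C1 boundary\<close>

text \<open>Three obstacles shape the argument. The parameter sets need not be convex, so bounded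
  scores do not at once bound likelihood ratios; a uniform interior cone, extracted from the C1
  boundary, yields both a local Lipschitz estimate and a lower bound for the prior mass of small
  balls. The score tails are only \<open>exp (- (ln x powr (1 + \<eta>)))\<close>: truncation at
  \<open>exp (n powr \<beta>)\<close> leaves tails
  \<open>exp (- (n powr (\<beta> * (1 + \<eta>))))\<close>, so \<beta> must lie strictly between
  \<open>1 / (1 + \<eta>)\<close> and 1. Finally, the weight must raise the risk strictly. It
  multiplies the affinity at \<open>z\<close> by \<open>exp (\<delta> * (1 - z))\<close>. For
  \<open>\<delta> < - ln \<alpha>\<close> the new minimum is below 1, hence not taken at an
  endpoint, where the values are \<open>exp \<delta>\<close> and 1; so the factor exceeds 1 at the
  minimiser and the minimum exceeds \<alpha>. That the risk really has this rate is shown by second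
  differences of the affinity in place of a law of large numbers under a tilted law.\<close>

text \<open>A local interior cone condition. One axis \<open>v\<close> serves all points of
  \<open>S\<close> near \<open>p\<close>, so two nearby points can be displaced in parallel;
  allowing \<open>norm v < 1\<close> lets \<open>v = 0\<close> handle interior points.\<close>

definition cone_at :: "'a::euclidean_space set \<Rightarrow> real \<Rightarrow> 'a \<Rightarrow> bool" where
  "cone_at S e p \<longleftrightarrow> (\<exists>v. norm v \<le> 1 \<and>
     (\<forall>y\<in>S \<inter> ball p e. \<forall>t\<in>{0..e}. \<forall>w. norm w \<le> t / 4 \<longrightarrow> y + t *\<^sub>R v + w \<in> S))"

lemma cone_at_mono:
  assumes "cone_at S e p" "ball q d \<subseteq> ball p e" "d \<le> e"
  shows "cone_at S d q"
proof -
  obtain v where v: "norm v \<le> 1"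
    "\<And>y t w. \<lbrakk>y \<in> S \<inter> ball p e; t \<in> {0..e}; norm w \<le> t / 4\<rbrakk> \<Longrightarrow> y + t *\<^sub>R v + w \<in> S"
    using assms(1) unfolding cone_at_def by blast
  show ?thesis unfolding cone_at_def
  proof (intro exI conjI ballI allI impI)
    fix y t and w :: 'a assume "y \<in> S \<inter> ball q d" "t \<in> {0..d}" "norm w \<le> t / 4"
    then show "y + t *\<^sub>R v + w \<in> S" using v(2)[of y t w] assms(2,3) by (auto simp: subset_iff)
  qed (rule v(1))
qed

text \<open>At a boundary point the axis is the inward normal \<open>- D p / norm (D p)\<close>.
  Moving by \<open>t *\<^sub>R v + w\<close> changes \<open>\<psi>\<close> by at most
  \<open>a * t * (- 1 + 1/4 + 5/16)\<close>: the normal direction, the contribution of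
  \<open>w\<close>, and the variation of the gradient.\<close>

lemma C1_boundary_cone_at:
  assumes "closed S" "C1_boundary S" "p \<in> S"
  shows "\<exists>e>0. cone_at S e p"
proof (cases "p \<in> interior S")
  case True
  then obtain e where e: "e > 0" "ball p e \<subseteq> S"
    by (meson mem_interior)
  have "cone_at S (e/2) p" unfolding cone_at_def
  proof (intro exI[of _ 0] conjI ballI allI impI)
    fix y t and w :: 'a assume "y \<in> S \<inter> ball p (e/2)" "t \<in> {0..e/2}" "norm w \<le> t / 4"
    moreover have "dist p (y + t *\<^sub>R 0 + w) \<le> dist p y + norm w"
      by (metis dist_triangle dist_norm add_diff_cancel_left' norm_minus_commute scaleR_zero_right add.right_neutral)
    ultimately have "y + t *\<^sub>R 0 + w \<in> ball p e" using e by auto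
    then show "y + t *\<^sub>R 0 + w \<in> S" using e by blast
  qed auto
  then show ?thesis using e by (intro exI[of _ "e/2"]) auto
next
  case False
  then have "p \<in> frontier S" using assms by (simp add: frontier_def)
  then obtain U \<psi> D where U: "open U" "p \<in> U" "continuous_on U D"
    and D: "\<And>y. y \<in> U \<Longrightarrow> (GDERIV \<psi> y :> D y)" "\<And>y. y \<in> U \<Longrightarrow> D y \<noteq> 0"
    and SU: "S \<inter> U = {y\<in>U. \<psi> y \<le> 0}"
  proof -
    have "\<exists>U \<psi> D. open U \<and> p \<in> U \<and> continuous_on U D \<and>
        (\<forall>y\<in>U. (GDERIV \<psi> y :> D y) \<and> D y \<noteq> 0) \<and> S \<inter> U = {y\<in>U. \<psi> y \<le> 0}"
      using assms(2) \<open>p \<in> frontier S\<close> unfolding C1_boundary_def by (rule bspec)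
    then show thesis using that by (elim exE conjE) blast
  qed
  define a where "a = norm (D p)"
  have a: "a > 0" using D(2)[OF U(2)] by (simp add: a_def)
  have "isCont D p" using U by (simp add: continuous_on_eq_continuous_at)
  then obtain d1 where d1: "d1 > 0" "\<And>y. dist y p < d1 \<Longrightarrow> dist (D y) (D p) < a / 4"
    using a unfolding continuous_at_eps_delta by (metis zero_less_divide_iff zero_less_numeral)
  obtain d2 where d2: "d2 > 0" "ball p d2 \<subseteq> U" using U(1,2) open_contains_ball by blast
  define d where "d = min d1 d2"
  have d: "d > 0" using d1 d2 by (simp add: d_def)
  define v where "v = - (1 / a) *\<^sub>R D p"
  have nv: "norm v = 1" using a by (simp add: v_def a_def)
  \<comment> \<open>The displacement has norm at most \<open>5/4 * t\<close> with
    \<open>t \<le> d / 3\<close>, so from \<open>ball p (d/3)\<close> it ends inside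
    \<open>ball p d\<close>, as 1/3 + 5/12 < 1.\<close>
  have "cone_at S (d/3) p" unfolding cone_at_def
  proof (intro exI[of _ v] conjI ballI allI impI)
    fix y t and w :: 'a assume y: "y \<in> S \<inter> ball p (d/3)" and t: "t \<in> {0..d/3}" and w: "norm w \<le> t / 4"
    define u where "u = t *\<^sub>R v + w"
    have nu: "norm u \<le> 5/4 * t"
      using norm_triangle_ineq[of "t *\<^sub>R v" w] w t nv by (simp add: u_def)
    have yB: "y \<in> ball p d" using y d by auto
    have "dist p (y + u) \<le> dist p y + norm u"
      by (metis dist_triangle dist_norm add_diff_cancel_left' norm_minus_commute)
    then have qB: "y + u \<in> ball p d" using nu y t d by auto
    \<comment> \<open>Mean value inequality for \<open>\<psi>\<close> minus its linear part at
      \<open>p\<close>, whose derivative has norm at most \<open>a / 4\<close> on this ball.\<close>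
    have "norm ((\<lambda>z. \<psi> z - z \<bullet> D p) (y + u) - (\<lambda>z. \<psi> z - z \<bullet> D p) y) \<le> a / 4 * norm (y + u - y)"
    proof (rule differentiable_bound[OF convex_ball _ _ qB yB])
      fix z assume z: "z \<in> ball p d"
      then have zU: "z \<in> U" using d2 by (auto simp: d_def)
      show "((\<lambda>z. \<psi> z - z \<bullet> D p) has_derivative (\<lambda>h. h \<bullet> D z - h \<bullet> D p)) (at z within ball p d)"
        using D(1)[OF zU] unfolding gderiv_def
        by (intro has_derivative_diff has_derivative_at_withinI[OF has_derivative_inner_left] has_derivative_ident) (auto intro: has_derivative_at_withinI)
      show "onorm (\<lambda>h. h \<bullet> D z - h \<bullet> D p) \<le> a / 4"
      proof (rule onorm_le)
        fix h
        have "norm (h \<bullet> D z - h \<bullet> D p) = \<bar>h \<bullet> (D z - D p)\<bar>" by (simp add: inner_diff_right)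
        also have "\<dots> \<le> norm h * norm (D z - D p)" by (rule Cauchy_Schwarz_ineq2)
        also have "\<dots> \<le> norm h * (a / 4)"
          using d1(2)[of z] z by (intro mult_left_mono) (auto simp: d_def dist_norm dist_commute norm_minus_commute)
        finally show "norm (h \<bullet> D z - h \<bullet> D p) \<le> a / 4 * norm h" by (simp add: mult.commute)
      qed
    qed
    then have "\<bar>(\<psi> (y + u) - (y + u) \<bullet> D p) - (\<psi> y - y \<bullet> D p)\<bar> \<le> a / 4 * norm u"
      by simp
    then have 1: "\<psi> (y + u) \<le> \<psi> y + u \<bullet> D p + a / 4 * norm u"
      unfolding inner_add_left by linarith
    have "v \<bullet> D p = - a" using a by (simp add: v_def a_def dot_square_norm power2_eq_square)
    then have "u \<bullet> D p = - a * t + w \<bullet> D p" by (simp add: u_def inner_add_left)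
    moreover have "w \<bullet> D p \<le> t / 4 * a"
      using norm_cauchy_schwarz[of w "D p"] w a by (smt (verit) a_def mult_right_mono)
    ultimately have "\<psi> (y + u) \<le> \<psi> y + (- a * t + t / 4 * a + a / 4 * (5 / 4 * t))"
      using 1 nu a by (smt (verit) mult_left_mono zero_le_divide_iff)
    also have "\<dots> = \<psi> y - (7 / 16) * (a * t)" by (simp add: algebra_simps)
    also have "\<dots> \<le> \<psi> y" using a t by simp
    also have "y \<in> U" using yB d2(2) by (auto simp: d_def)
    then have "\<psi> y \<le> 0" using y SU by blast
    finally have "y + u \<in> S \<inter> U" using qB d2 SU by (auto simp: d_def)
    then show "y + t *\<^sub>R v + w \<in> S" by (simp add: u_def add.assoc)
  qed (simp add: nv)
  then show ?thesis using d by (intro exI[of _ "d/3"]) auto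
qed

text \<open>Balls of half the local radius cover \<open>S\<close>, so a point \<open>q\<close> of
  such a ball still has \<open>ball q d\<close> inside the full ball. The element 1 keeps the
  minimum defined for an empty subcover.\<close>

lemma C1_boundary_uniform_cone:
  assumes "compact S" "C1_boundary S"
  obtains e where "e > 0" "\<And>p. p \<in> S \<Longrightarrow> cone_at S e p"
proof -
  have "\<forall>p\<in>S. \<exists>e>0. cone_at S e p"
    using assms C1_boundary_cone_at compact_imp_closed by blast
  then obtain e where e: "\<And>p. p \<in> S \<Longrightarrow> e p > 0" "\<And>p. p \<in> S \<Longrightarrow> cone_at S (e p) p" by metis
  have "S \<subseteq> (\<Union>p\<in>S. ball p (e p / 2))" using e(1) by force
  then obtain F where F: "F \<subseteq> S" "finite F" "S \<subseteq> (\<Union>p\<in>F. ball p (e p / 2))"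
    using compactE_image[OF assms(1), of S "\<lambda>p. ball p (e p / 2)"] by auto
  define d where "d = Min (insert 1 ((\<lambda>p. e p / 2) ` F))"
  have d: "d > 0" unfolding d_def using F e(1) by (subst Min_gr_iff) auto
  have dle: "d \<le> e p / 2" if "p \<in> F" for p unfolding d_def using that F by (intro Min_le) auto
  show thesis
  proof (rule that[OF d])
    fix q assume "q \<in> S"
    then obtain p where p: "p \<in> F" "dist p q < e p / 2" using F by auto
    show "cone_at S d q"
    proof (rule cone_at_mono[OF e(2)])
      show "p \<in> S" using p F by blast
      show "d \<le> e p" using dle[OF p(1)] e(1)[of p] p F by auto
      show "ball q d \<subseteq> ball p (e p)"
      proof
        fix z assume "z \<in> ball q d"
        then show "z \<in> ball p (e p)" using p dle[OF p(1)] dist_triangle[of p z q] by auto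
      qed
    qed
  qed
qed

text \<open>Linearity makes the derivative the inner product with \<open>grad\<close>, so
  Cauchy-Schwarz applies. The filter is general in order to cover derivatives within a parameter
  set.\<close>

lemma grad_bound:
  fixes f :: "'a::euclidean_space \<Rightarrow> real"
  assumes "f differentiable F"
  shows "norm (frechet_derivative f F v) \<le> norm (grad f F) * norm v"
proof -
  let ?D = "frechet_derivative f F"
  have lin: "linear ?D" using assms by (simp add: linear_frechet_derivative)
  have "?D v = ?D (\<Sum>b\<in>Basis. (v \<bullet> b) *\<^sub>R b)" by (simp add: euclidean_representation)
  also have "\<dots> = (\<Sum>b\<in>Basis. (v \<bullet> b) * ?D b)"
    by (simp add: linear_sum[OF lin] linear_scale[OF lin])
  also have "\<dots> = grad f F \<bullet> v"
    unfolding grad_def by (simp add: inner_sum_left inner_commute[of v] mult.commute)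
  finally show ?thesis using Cauchy_Schwarz_ineq2[of "grad f F" v] by simp
qed

lemma segment_grad_bound:
  fixes f :: "'a::euclidean_space \<Rightarrow> real"
  assumes "\<And>p. p \<in> S \<Longrightarrow> f differentiable (at p within S)"
    and "\<And>p. p \<in> S \<Longrightarrow> norm (grad f (at p within S)) \<le> B"
    and "closed_segment a b \<subseteq> S"
  shows "\<bar>f a - f b\<bar> \<le> B * norm (a - b)"
proof -
  have "norm (f a - f b) \<le> B * norm (a - b)"
  proof (rule differentiable_bound[of "closed_segment a b"])
    fix x assume "x \<in> closed_segment a b"
    then have x: "x \<in> S" using assms by auto
    let ?D = "frechet_derivative f (at x within S)"
    show "(f has_derivative ?D) (at x within closed_segment a b)"
      using assms(1)[OF x] assms(3) has_derivative_subset frechet_derivative_works by metis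
    show "onorm ?D \<le> B"
    proof (rule onorm_le)
      fix v
      show "norm (?D v) \<le> B * norm v"
        using grad_bound[OF assms(1)[OF x], of v] assms(2)[OF x]
        by (meson mult_right_mono norm_ge_zero order_trans)
    qed
  qed auto
  then show ?thesis by simp
qed

text \<open>A short detour through the common cone of two nearby points connects them inside \<open>S\<close>.\<close>

lemma cone_at_lipschitz:
  fixes f :: "'a::euclidean_space \<Rightarrow> real"
  assumes "cone_at S e p" "p \<in> S" "q \<in> S" "4 * norm (p - q) < e"
    and diff: "\<And>p. p \<in> S \<Longrightarrow> f differentiable (at p within S)"
    and B: "\<And>p. p \<in> S \<Longrightarrow> norm (grad f (at p within S)) \<le> B"
  shows "\<bar>f p - f q\<bar> \<le> 9 * B * norm (p - q)"
proof -
  define d where "d = norm (p - q)"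
  have e: "e > 0" using assms(4) norm_ge_zero[of "p - q"] by linarith
  have B0: "B \<ge> 0" using B[OF assms(2)] norm_ge_zero order_trans by blast
  obtain v where v: "norm v \<le> 1"
    "\<And>y t w. \<lbrakk>y \<in> S \<inter> ball p e; t \<in> {0..e}; norm w \<le> t / 4\<rbrakk> \<Longrightarrow> y + t *\<^sub>R v + w \<in> S"
    using assms(1) unfolding cone_at_def by blast
  have "0 \<le> d" by (simp add: d_def)
  then have d: "0 \<le> d" "4 * d \<le> e" "d < e" using assms(4) by (auto simp flip: d_def)
  have side: "\<bar>f y - f (y + (4 * d) *\<^sub>R v)\<bar> \<le> B * (4 * d)" if y: "y \<in> S \<inter> ball p e" for y
  proof -
    have "closed_segment y (y + (4 * d) *\<^sub>R v) \<subseteq> S"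
    proof
      fix x assume "x \<in> closed_segment y (y + (4 * d) *\<^sub>R v)"
      then obtain u where u: "0 \<le> u" "u \<le> 1" "x = (1 - u) *\<^sub>R y + u *\<^sub>R (y + (4 * d) *\<^sub>R v)"
        unfolding closed_segment_def by auto
      have "x = y + (u * (4 * d)) *\<^sub>R v + 0" using u(3) by (simp add: algebra_simps)
      moreover have "u * (4 * d) \<in> {0..e}" using u d mult_left_le_one_le[of "4 * d" u] by (auto simp del: mult_le_cancel_left)
      ultimately show "x \<in> S" using v(2)[OF y, of "u * (4 * d)" 0] u d by auto
    qed
    then have "\<bar>f y - f (y + (4 * d) *\<^sub>R v)\<bar> \<le> B * norm (y - (y + (4 * d) *\<^sub>R v))"
      by (intro segment_grad_bound[where S = S] diff B)
    also have "norm (y - (y + (4 * d) *\<^sub>R v)) \<le> 4 * d" using d v(1) by (simp add: mult_left_le)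
    finally show ?thesis using B0 by (smt (verit) mult_left_mono)
  qed
  \<comment> \<open>At height \<open>4 * d\<close> the cone has cross-section radius
    \<open>d\<close>, the distance of the two points, so the segment between the displaced points
    lies in the cone with apex \<open>p\<close>. The detour has length at most
    \<open>4 * d + d + 4 * d\<close>, whence the factor 9.\<close>
  have "closed_segment (p + (4 * d) *\<^sub>R v) (q + (4 * d) *\<^sub>R v) \<subseteq> S"
  proof
    fix x assume "x \<in> closed_segment (p + (4 * d) *\<^sub>R v) (q + (4 * d) *\<^sub>R v)"
    then obtain u where u: "0 \<le> u" "u \<le> 1"
      "x = (1 - u) *\<^sub>R (p + (4 * d) *\<^sub>R v) + u *\<^sub>R (q + (4 * d) *\<^sub>R v)"
      unfolding closed_segment_def by auto
    have "x = p + (4 * d) *\<^sub>R v + u *\<^sub>R (q - p)" using u(3) by (simp add: algebra_simps)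
    moreover have "norm (u *\<^sub>R (q - p)) \<le> (4 * d) / 4"
      using u mult_left_le_one_le[of "norm (q - p)" u] by (simp add: d_def norm_minus_commute)
    ultimately show "x \<in> S" using v(2)[of p "4 * d" "u *\<^sub>R (q - p)"] d e assms(2) by auto
  qed
  then have "\<bar>f (p + (4 * d) *\<^sub>R v) - f (q + (4 * d) *\<^sub>R v)\<bar> \<le>
      B * norm (p + (4 * d) *\<^sub>R v - (q + (4 * d) *\<^sub>R v))"
    by (intro segment_grad_bound[where S = S] diff B)
  moreover have "\<dots> = B * d" by (simp add: d_def)
  moreover have "p \<in> S \<inter> ball p e" "q \<in> S \<inter> ball p e"
    using assms(2,3) e d(3) by (auto simp: d_def[unfolded dist_norm[symmetric]])
  ultimately have "\<bar>f p - f q\<bar> \<le> B * (4 * d) + B * d + B * (4 * d)"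
    using side[of p] side[of q] by linarith
  then show ?thesis by (simp add: d_def algebra_simps)
qed

text \<open>At height \<open>r / 2\<close> the cone contains a ball of radius \<open>r / 8\<close>,
  which stays inside \<open>ball p r\<close> because 1/2 + 1/8 < 1.\<close>

lemma cone_at_volume:
  fixes p :: "'a::euclidean_space"
  assumes "cone_at S e p" "p \<in> S" "S \<in> lmeasurable" "0 < r" "r \<le> e"
  shows "unit_ball_vol DIM('a) * (r / 8) ^ DIM('a) \<le> measure lebesgue (S \<inter> ball p r)"
proof -
  obtain v where v: "norm v \<le> 1"
    "\<And>y t w. \<lbrakk>y \<in> S \<inter> ball p e; t \<in> {0..e}; norm w \<le> t / 4\<rbrakk> \<Longrightarrow> y + t *\<^sub>R v + w \<in> S"
    using assms(1) unfolding cone_at_def by blast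
  define z where "z = p + (r / 2) *\<^sub>R v"
  have "ball z (r / 8) \<subseteq> S \<inter> ball p r"
  proof
    fix x assume x: "x \<in> ball z (r / 8)"
    then have "z + (x - z) \<in> S"
      unfolding z_def using assms by (intro v(2)) (auto simp: z_def dist_norm norm_minus_commute)
    moreover have "dist p z \<le> r / 2" using v(1) assms(4) by (simp add: z_def dist_norm mult_left_le)
    then have "dist p x < r" using x dist_triangle[of p x z] assms(4) by auto
    ultimately show "x \<in> S \<inter> ball p r" by simp
  qed
  then have "measure lebesgue (ball z (r / 8)) \<le> measure lebesgue (S \<inter> ball p r)"
    using assms(3) by (intro measure_mono_fmeasurable) (auto intro: fmeasurable_Int_fmeasurable)
  then show ?thesis using content_ball[of "r / 8" z] assms(4) by simp
qed

section \<open>Elementary inequalities for geometric mixtures and tilted products\<close>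

lemma sinh_scale_le:
  fixes x s :: real
  assumes "0 \<le> x" "0 \<le> s" "s \<le> 1"
  shows "sinh (s * x) \<le> s * sinh x"
proof -
  have "convex_on {0..} (sinh :: real \<Rightarrow> real)"
    by (intro f''_ge0_imp_convex[where f' = cosh and f'' = sinh])
       (auto intro!: derivative_eq_intros)
  from convex_onD[OF this, of s 0 x] show ?thesis using assms by simp
qed

lemma exp_second_difference: "exp x + exp (- x) - 2 = 4 * (sinh (x / 2))\<^sup>2" for x :: real
proof -
  have "(exp (x/2))\<^sup>2 = exp x" "(exp (-(x/2)))\<^sup>2 = exp (- x)" "exp (x/2) * exp (-(x/2)) = 1"
    by (simp_all add: power2_eq_square flip: exp_add)
  then show ?thesis by (simp add: sinh_def power_divide power2_diff)
qed

text \<open>In terms of \<open>sinh\<close> the claim is its convexity on the nonnegative axis. The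
  factor \<open>(s / s0)\<^sup>2\<close> does not involve \<open>l\<close>, so the bound survives
  integration over the log-likelihood ratio.\<close>

lemma exp_second_difference_scale:
  fixes l s s0 :: real
  assumes "0 \<le> s" "s \<le> s0" "0 < s0"
  shows "exp (s * l) + exp (- (s * l)) - 2 \<le> (s / s0)\<^sup>2 * (exp (s0 * l) + exp (- (s0 * l)) - 2)"
proof -
  have sym: "(sinh (t * l / 2))\<^sup>2 = (sinh (t * \<bar>l\<bar> / 2))\<^sup>2" for t
    by (cases "l \<ge> 0") (auto simp: power2_eq_square)
  have "sinh (s / s0 * (s0 * \<bar>l\<bar> / 2)) \<le> s / s0 * sinh (s0 * \<bar>l\<bar> / 2)"
    using assms by (intro sinh_scale_le) auto
  then have "sinh (s * \<bar>l\<bar> / 2) \<le> s / s0 * sinh (s0 * \<bar>l\<bar> / 2)" using assms by simp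
  then have "(sinh (s * \<bar>l\<bar> / 2))\<^sup>2 \<le> (s / s0)\<^sup>2 * (sinh (s0 * \<bar>l\<bar> / 2))\<^sup>2"
    using power_mono[of "sinh (s * \<bar>l\<bar> / 2)" "s / s0 * sinh (s0 * \<bar>l\<bar> / 2)" 2] assms
    by (simp add: power_mult_distrib power_divide)
  then show ?thesis unfolding exp_second_difference by (simp add: sym)
qed

text \<open>Weighted arithmetic-geometric mean inequality. The zero case is separate because
  \<open>0 powr 0 = 0\<close>: a vanishing density kills the product even at \<open>s = 0\<close> or
  \<open>s = 1\<close>.\<close>

lemma powr_mix_le:
  fixes a b s :: real
  assumes "0 \<le> a" "0 \<le> b" "0 \<le> s" "s \<le> 1"
  shows "a powr (1 - s) * b powr s \<le> (1 - s) * a + s * b"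
proof (cases "a = 0 \<or> b = 0")
  case False
  then show ?thesis using Youngs_inequality_0[of "1 - s" s a b] assms by simp
qed (use assms in auto)

lemma powr_mix_le_add:
  fixes a b s :: real
  assumes "0 \<le> a" "0 \<le> b" "0 \<le> s" "s \<le> 1"
  shows "a powr (1 - s) * b powr s \<le> a + b"
proof -
  have "(1 - s) * a \<le> a" "s * b \<le> b" using assms by (auto intro: mult_left_le_one_le)
  then show ?thesis using powr_mix_le[OF assms] by linarith
qed

lemma powr_mix_shift:
  fixes a b z t :: real
  assumes "0 < a" "0 < b"
  shows "a powr (1 - (z + t)) * b powr (z + t) = a powr (1 - z) * b powr z * exp (t * (ln b - ln a))"
  using assms by (simp add: powr_def exp_add[symmetric] algebra_simps)

lemma powr_mix_second_difference:
  fixes a b z s s0 :: real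
  assumes "0 \<le> a" "0 \<le> b" "0 \<le> s" "s \<le> s0" "0 < s0"
  defines "k \<equiv> \<lambda>t. a powr (1 - t) * b powr t"
  shows "k (z + s) + k (z - s) - 2 * k z \<le> (s / s0)\<^sup>2 * (k (z + s0) + k (z - s0) - 2 * k z)"
proof (cases "a = 0 \<or> b = 0")
  case False
  then have ab: "0 < a" "0 < b" using assms by auto
  define l where "l = ln b - ln a"
  have sh: "k (z + t) = k z * exp (t * l)" "k (z - t) = k z * exp (- (t * l))" for t
    using powr_mix_shift[OF ab, of z t] powr_mix_shift[OF ab, of z "- t"] by (simp_all add: k_def l_def)
  have "k z * (exp (s * l) + exp (- (s * l)) - 2) \<le>
      k z * ((s / s0)\<^sup>2 * (exp (s0 * l) + exp (- (s0 * l)) - 2))"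
    using assms by (intro mult_left_mono exp_second_difference_scale) (auto simp: k_def)
  then show ?thesis unfolding sh by (simp add: algebra_simps)
qed (auto simp: k_def)

text \<open>When the log-likelihood ratio of the products exceeds \<open>n * e\<close> in absolute value, one of
  the two subtracted terms already exceeds the first one.\<close>

lemma min_prod_ge_tilted:
  fixes p q :: "nat \<Rightarrow> real" and z s e :: real
  assumes "\<And>i. i < n \<Longrightarrow> 0 \<le> p i" "\<And>i. i < n \<Longrightarrow> 0 \<le> q i" "0 \<le> z" "z \<le> 1" "0 \<le> s" "0 \<le> e"
  defines "K \<equiv> \<lambda>t. \<Prod>i<n. p i powr (1 - t) * q i powr t"
  shows "exp (- (n * e)) * (K z - exp (- (n * s * e)) * (K (z + s) + K (z - s)))
     \<le> min (\<Prod>i<n. p i) (\<Prod>i<n. q i)"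
proof (cases "\<exists>i<n. p i = 0 \<or> q i = 0")
  case True
  \<comment> \<open>A zero density annihilates \<open>K\<close> at every exponent, since
    \<open>0 powr t = 0\<close> even for \<open>t = 0\<close>.\<close>
  then have "K t = 0" for t unfolding K_def by (intro prod_zero) auto
  moreover have "0 \<le> (\<Prod>i<n. p i)" "0 \<le> (\<Prod>i<n. q i)" using assms by (auto intro: prod_nonneg)
  ultimately show ?thesis by simp
next
  case False
  then have pos: "0 < p i" "0 < q i" if "i < n" for i
    using assms(1,2)[OF that] that by (auto simp: less_le)
  define S where "S = (\<Sum>i<n. ln (q i) - ln (p i))"
  \<comment> \<open>\<open>S\<close> is the log-likelihood ratio of the whole sample. Both product
    likelihoods are tilts of \<open>K z\<close>, by \<open>- z\<close> and \<open>1 - z\<close>, so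
    the comparison takes place on the exponential scale of \<open>S\<close>.\<close>
  have sh: "K (z + t) = K z * exp (t * S)" for t
    unfolding K_def S_def sum_distrib_left exp_sum[OF finite_lessThan] prod.distrib[symmetric]
    by (intro prod.cong refl powr_mix_shift) (auto simp: pos)
  have Kz: "0 \<le> K z" unfolding K_def using assms by (intro prod_nonneg) auto
  have p: "(\<Prod>i<n. p i) = K z * exp (- z * S)"
  proof -
    have "(\<Prod>i<n. p i) = K 0" unfolding K_def
    proof (intro prod.cong refl)
      fix i assume "i \<in> {..<n}"
      then show "p i = p i powr (1 - 0) * q i powr 0" using pos[of i] by simp
    qed
    then show ?thesis using sh[of "- z"] by simp
  qed
  have q: "(\<Prod>i<n. q i) = K z * exp ((1 - z) * S)"
  proof -
    have "(\<Prod>i<n. q i) = K 1" unfolding K_def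
    proof (intro prod.cong refl)
      fix i assume "i \<in> {..<n}"
      then show "q i = p i powr (1 - 1) * q i powr 1" using pos[of i] by simp
    qed
    then show ?thesis using sh[of "1 - z"] by simp
  qed
  show ?thesis
  proof (cases "\<bar>S\<bar> \<le> n * e")
    case True
    have 1: "K z - exp (- (n * s * e)) * (K (z + s) + K (z - s)) \<le> K z"
      using sh[of s] sh[of "- s"] Kz by simp
    have "exp (- (n * e)) \<le> exp (- z * S)" "exp (- (n * e)) \<le> exp ((1 - z) * S)"
    proof -
      have "z * S \<le> z * \<bar>S\<bar>" "(1 - z) * (- S) \<le> (1 - z) * \<bar>S\<bar>"
        using assms(3,4) by (intro mult_left_mono; simp)+
      moreover have "z * \<bar>S\<bar> \<le> \<bar>S\<bar>" "(1 - z) * \<bar>S\<bar> \<le> \<bar>S\<bar>"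
        using assms(3,4) by (intro mult_left_le_one_le; simp)+
      ultimately have "z * S \<le> \<bar>S\<bar>" "- ((1 - z) * S) \<le> \<bar>S\<bar>" by linarith+
      then show "exp (- (n * e)) \<le> exp (- z * S)" "exp (- (n * e)) \<le> exp ((1 - z) * S)"
        using True by auto
    qed
    then have 2: "exp (- (n * e)) * K z \<le> min (\<Prod>i<n. p i) (\<Prod>i<n. q i)"
      unfolding p q min_def using Kz by (auto intro: mult_left_mono simp: mult.commute[of _ "K z"])
    have "exp (- (n * e)) * (K z - exp (- (n * s * e)) * (K (z + s) + K (z - s))) \<le> exp (- (n * e)) * K z"
      using 1 by (rule mult_left_mono) simp
    then show ?thesis using 2 by (rule order_trans)
  next
    case False
    have *: "1 \<le> exp (- (n * s * e)) * (exp (s * S) + exp (- s * S))"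
    proof -
      have "n * s * e \<le> s * \<bar>S\<bar>"
        using mult_left_mono[of "n * e" "\<bar>S\<bar>" s] False assms(5) by (simp add: mult.left_commute mult.assoc)
      then have "n * s * e \<le> s * S \<or> n * s * e \<le> - s * S" by (cases "S \<ge> 0") auto
      then have "exp (n * s * e) \<le> exp (s * S) + exp (- s * S)"
        by (elim disjE) (auto intro: add_increasing add_increasing2)
      then have "exp (- (n * s * e)) * exp (n * s * e) \<le> exp (- (n * s * e)) * (exp (s * S) + exp (- s * S))"
        by (intro mult_left_mono) auto
      then show ?thesis by (simp flip: exp_add)
    qed
    have "K z - exp (- (n * s * e)) * (K (z + s) + K (z - s)) =
        K z * (1 - exp (- (n * s * e)) * (exp (s * S) + exp (- s * S)))"
      using sh[of s] sh[of "- s"] by (simp add: algebra_simps)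
    also have "\<dots> \<le> 0" using * Kz by (simp add: mult_nonneg_nonpos)
    finally have "exp (- (n * e)) * (K z - exp (- (n * s * e)) * (K (z + s) + K (z - s))) \<le> 0"
      by (simp add: mult_nonneg_nonpos)
    also have "0 \<le> min (\<Prod>i<n. p i) (\<Prod>i<n. q i)" using assms by (auto intro: prod_nonneg)
    finally show ?thesis .
  qed
qed

text \<open>Chernoff's argument, pointwise: split the left product into its powers
  \<open>1 - z\<close> and \<open>z\<close>, and apply the hypothesis to the second;
  \<open>c powr z \<le> c\<close> because \<open>c \<ge> 1\<close>.\<close>

lemma prod_le_powr_mix:
  fixes p q :: "nat \<Rightarrow> real"
  assumes "\<And>i. i < n \<Longrightarrow> 0 \<le> p i" "\<And>i. i < n \<Longrightarrow> 0 \<le> q i" "0 \<le> z" "z \<le> 1" "1 \<le> c"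
    and le: "(\<Prod>i<n. p i) \<le> c * (\<Prod>i<n. q i)"
  shows "(\<Prod>i<n. p i) \<le> c * (\<Prod>i<n. p i powr (1 - z) * q i powr z)"
proof (cases "(\<Prod>i<n. p i) = 0")
  case True
  have "0 \<le> (\<Prod>i<n. p i powr (1 - z) * q i powr z)" using assms by (intro prod_nonneg) auto
  then have "0 \<le> c * (\<Prod>i<n. p i powr (1 - z) * q i powr z)" using assms(5) by simp
  then show ?thesis unfolding True .
next
  case False
  define a b where "a = (\<Prod>i<n. p i)" and "b = (\<Prod>i<n. q i)"
  have a: "a > 0" using False assms(1) unfolding a_def by (metis less_le lessThan_iff prod_nonneg)
  have b: "b \<ge> 0" using assms(2) unfolding b_def by (auto intro: prod_nonneg)
  have "a = a powr (1 - z) * a powr z" using a by (simp flip: powr_add)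
  also have "\<dots> \<le> a powr (1 - z) * (c * b) powr z"
    using le a assms(3) by (intro mult_left_mono powr_mono2) (auto simp: a_def b_def)
  also have "\<dots> = c powr z * (a powr (1 - z) * b powr z)" using assms(5) b by (simp add: powr_mult)
  also have "\<dots> \<le> c * (a powr (1 - z) * b powr z)"
    using powr_mono[of z 1 c] assms(3-5) by (intro mult_right_mono) auto
  also have "a powr (1 - z) * b powr z = (\<Prod>i<n. p i powr (1 - z) * q i powr z)"
    unfolding a_def b_def using assms(1,2) by (simp add: prod_powr_distrib prod.distrib)
  finally show ?thesis by (simp add: a_def)
qed


subsection \<open>Hellinger affinities\<close>

text \<open>For a.e. positive densities this is the moment generating function of the log-likelihood
  ratio under \<open>p\<close>; in this form an exchange of \<open>p\<close> and \<open>q\<close>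
  just reflects \<open>z\<close> in 1/2.\<close>

definition affinity :: "'x measure \<Rightarrow> ('x \<Rightarrow> real) \<Rightarrow> ('x \<Rightarrow> real) \<Rightarrow> real \<Rightarrow> real" where
  "affinity M p q z = (LINT x|M. p x powr (1 - z) * q x powr z)"

text \<open>Total masses are left free because the risk bound is applied to the weighted density
  \<open>exp \<delta> * g \<theta>\<close>, whose mass is not 1.\<close>

locale nonneg_integrable_pair = sigma_finite_measure M for M :: "'x measure" +
  fixes p q :: "'x \<Rightarrow> real"
  assumes integrable_p: "integrable M p" and integrable_q: "integrable M q"
    and nonneg_p: "\<And>x. 0 \<le> p x" and nonneg_q: "\<And>x. 0 \<le> q x"
begin

lemma measurable_pq [measurable]: "p \<in> borel_measurable M" "q \<in> borel_measurable M"
  using integrable_p integrable_q by auto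

lemma integrable_mix: "0 \<le> z \<Longrightarrow> z \<le> 1 \<Longrightarrow> integrable M (\<lambda>x. p x powr (1 - z) * q x powr z)"
  by (rule Bochner_Integration.integrable_bound[OF Bochner_Integration.integrable_add[OF integrable_p integrable_q]])
     (auto simp: nonneg_p nonneg_q abs_of_nonneg powr_mix_le_add)

lemma affinity_nonneg: "0 \<le> affinity M p q z"
  unfolding affinity_def by (intro integral_nonneg_AE) auto

lemma affinity_pos:
  assumes "0 \<le> z" "z \<le> 1" "AE x in M. 0 < p x \<and> 0 < q x" "emeasure M (space M) \<noteq> 0"
  shows "0 < affinity M p q z"
proof -
  have "affinity M p q z \<noteq> 0"
  proof
    assume "affinity M p q z = 0"
    then have "AE x in M. p x powr (1 - z) * q x powr z = 0"
      using integral_nonneg_eq_0_iff_AE[OF integrable_mix[OF assms(1,2)]] by (auto simp: affinity_def)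
    with assms(3) have "AE x in M. False" by eventually_elim auto
    then show False using assms(4) by (simp add: AE_iff_null_sets null_setsD1 )
  qed
  then show ?thesis using affinity_nonneg[of z] by linarith
qed

text \<open>Dominated convergence, with majorant \<open>p + q\<close> for all exponents in
  \<open>{0..1}\<close>.\<close>

lemma continuous_on_affinity: "continuous_on {0..1} (affinity M p q)"
  unfolding continuous_on_sequentially
proof (intro allI impI ballI)
  fix x :: "nat \<Rightarrow> real" and z assume "z \<in> {0..1}" and *: "(\<forall>n. x n \<in> {0..1}) \<and> x \<longlonglongrightarrow> z"
  have lim: "(\<lambda>n. a powr (1 - x n) * b powr x n) \<longlonglongrightarrow> a powr (1 - z) * b powr z"
    if "a \<ge> 0" "b \<ge> 0" for a b :: real
  proof (cases "a = 0 \<or> b = 0")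
    case False
    then show ?thesis using * by (intro tendsto_intros) auto
  qed auto
  show "(affinity M p q \<circ> x) \<longlonglongrightarrow> affinity M p q z"
    unfolding affinity_def comp_def
  proof (rule integral_dominated_convergence[where w = "\<lambda>x. p x + q x"])
    show "AE t in M. (\<lambda>n. p t powr (1 - x n) * q t powr x n) \<longlonglongrightarrow> p t powr (1 - z) * q t powr z"
      using lim nonneg_p nonneg_q by auto
    show "AE t in M. norm (p t powr (1 - x n) * q t powr x n) \<le> p t + q t" for n
      using * by (auto simp: nonneg_p nonneg_q powr_mix_le_add)
  qed (use integrable_p integrable_q in auto)
qed

text \<open>At a minimiser the second difference dominates both one-sided increments, which replaces
  differentiating the affinity under the integral sign.\<close>

lemma affinity_near_min:
  assumes z: "0 < z" "z < 1" and min: "\<And>s. s \<in> {0..1} \<Longrightarrow> affinity M p q z \<le> affinity M p q s"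
  obtains C s0 where "0 < s0" "0 \<le> C" "s0 \<le> z" "s0 \<le> 1 - z"
    "\<And>s. 0 \<le> s \<Longrightarrow> s \<le> s0 \<Longrightarrow> affinity M p q (z + s) \<le> affinity M p q z + C * s\<^sup>2"
    "\<And>s. 0 \<le> s \<Longrightarrow> s \<le> s0 \<Longrightarrow> affinity M p q (z - s) \<le> affinity M p q z + C * s\<^sup>2"
proof -
  let ?J = "affinity M p q"
  define s0 where "s0 = min z (1 - z)"
  have s0: "0 < s0" "s0 \<le> z" "s0 \<le> 1 - z" using z by (auto simp: s0_def)
  define D where "D = ?J (z + s0) + ?J (z - s0) - 2 * ?J z"
  have D: "0 \<le> D" using min[of "z + s0"] min[of "z - s0"] s0 by (simp add: D_def)
  \<comment> \<open>The pointwise scaling of second differences is integrated; the choice of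
    \<open>s0\<close> keeps all exponents in \<open>{0..1}\<close>, where the integrals are
    finite.\<close>
  have key: "?J (z + s) + ?J (z - s) - 2 * ?J z \<le> D / s0\<^sup>2 * s\<^sup>2" if s: "0 \<le> s" "s \<le> s0" for s
  proof -
    note [simp] = integrable_mix
    have "?J (z + s) + ?J (z - s) - 2 * ?J z =
        (LINT x|M. p x powr (1 - (z + s)) * q x powr (z + s) + p x powr (1 - (z - s)) * q x powr (z - s)
          - 2 * (p x powr (1 - z) * q x powr z))"
      using s s0 z unfolding affinity_def by (simp del: diff_diff_eq2 diff_add_eq_diff_diff_swap)
    also have "\<dots> \<le> (LINT x|M. (s / s0)\<^sup>2 * (p x powr (1 - (z + s0)) * q x powr (z + s0)
        + p x powr (1 - (z - s0)) * q x powr (z - s0) - 2 * (p x powr (1 - z) * q x powr z)))"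
      using s s0 z
      by (intro integral_mono Bochner_Integration.integrable_diff Bochner_Integration.integrable_add
          integrable_mult_right integrable_mix powr_mix_second_difference nonneg_p nonneg_q) auto
    also have "\<dots> = (s / s0)\<^sup>2 * D"
      using s s0 z unfolding affinity_def D_def by (simp del: diff_diff_eq2 diff_add_eq_diff_diff_swap)
    finally show ?thesis by (simp add: power_divide mult.commute)
  qed
  show thesis
  proof (rule that[OF s0(1) _ s0(2,3)])
    show "0 \<le> D / s0\<^sup>2" using D by simp
    fix s assume s: "0 \<le> s" "s \<le> s0"
    show "?J (z + s) \<le> ?J z + D / s0\<^sup>2 * s\<^sup>2" using key[OF s] min[of "z - s"] s s0 z by simp
    show "?J (z - s) \<le> ?J z + D / s0\<^sup>2 * s\<^sup>2" using key[OF s] min[of "z + s"] s s0 z by simp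
  qed
qed

lemma integral_prod_mix:
  assumes "0 \<le> z" "z \<le> 1"
  shows "(LINT X|(\<Pi>\<^sub>M i\<in>{..<n}. M). (\<Prod>i<n. p (X i) powr (1 - z) * q (X i) powr z)) = affinity M p q z ^ n"
    and "integrable (\<Pi>\<^sub>M i\<in>{..<n}. M) (\<lambda>X. \<Prod>i<n. p (X i) powr (1 - z) * q (X i) powr z)"
proof -
  interpret product_sigma_finite "\<lambda>_::nat. M" by unfold_locales
  show "(LINT X|(\<Pi>\<^sub>M i\<in>{..<n}. M). (\<Prod>i<n. p (X i) powr (1 - z) * q (X i) powr z)) = affinity M p q z ^ n"
    unfolding affinity_def using product_integral_prod[of "{..<n}" "\<lambda>_ x. p x powr (1 - z) * q x powr z"]
    by (simp add: integrable_mix assms)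
  show "integrable (\<Pi>\<^sub>M i\<in>{..<n}. M) (\<lambda>X. \<Prod>i<n. p (X i) powr (1 - z) * q (X i) powr z)"
    by (rule product_integrable_prod) (auto simp: integrable_mix assms)
qed

text \<open>Integrate the tilted lower bound for the minimum. Leaving the minimiser by
  \<open>s\<close> multiplies the n-th power of the affinity by at most
  \<open>exp (n * s * e / 2)\<close>, since the increase is quadratic in \<open>s\<close>, while the
  subtracted terms carry the factor \<open>exp (- (n * s * e))\<close>; so they vanish relative to
  the main term.\<close>

lemma eventually_integral_min_ge:
  fixes e :: real
  assumes z: "0 < z" "z < 1" and min: "\<And>s. s \<in> {0..1} \<Longrightarrow> affinity M p q z \<le> affinity M p q s"
    and J: "0 < affinity M p q z" and e: "0 < e"
  shows "\<forall>\<^sub>F n in sequentially. affinity M p q z ^ n * exp (- (n * e)) / 2 \<le>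
     (LINT X|(\<Pi>\<^sub>M i\<in>{..<n}. M). min (\<Prod>i<n. p (X i)) (\<Prod>i<n. q (X i)))"
proof -
  let ?J = "affinity M p q"
  from affinity_near_min[OF z min] obtain C s0 where C: "0 < s0" "0 \<le> C" "s0 \<le> z" "s0 \<le> 1 - z"
    "\<And>s. 0 \<le> s \<Longrightarrow> s \<le> s0 \<Longrightarrow> ?J (z + s) \<le> ?J z + C * s\<^sup>2"
    "\<And>s. 0 \<le> s \<Longrightarrow> s \<le> s0 \<Longrightarrow> ?J (z - s) \<le> ?J z + C * s\<^sup>2"
    by metis
  define c where "c = C / ?J z"
  have c: "0 \<le> c" using C J by (simp add: c_def)
  \<comment> \<open>The quadratic increase \<open>c * s\<^sup>2\<close> has to be at most half the
    linear gain \<open>s * e\<close>; adding 1 to \<open>c\<close> avoids a division by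
    zero.\<close>
  define s where "s = Min {s0, e / (2 * (c + 1))}"
  have s: "0 < s" "s \<le> s0" "s \<le> e / (2 * (c + 1))" using C(1) c e by (auto simp: s_def)
  have "c * s \<le> e / 2"
  proof -
    have "s * (2 * (c + 1)) \<le> e" using s(3) c by (simp add: pos_le_divide_eq)
    then show ?thesis using s(1) by (simp add: algebra_simps)
  qed
  then have cs: "c * s\<^sup>2 \<le> s * e / 2" using s(1) by (simp add: power2_eq_square mult.commute mult_left_mono algebra_simps)
  have ub: "y ^ n \<le> ?J z ^ n * exp (n * s * e / 2)" if "y \<le> ?J z + C * s\<^sup>2" "0 \<le> y" for y n
  proof -
    have "?J z + C * s\<^sup>2 = ?J z * (1 + c * s\<^sup>2)" using J by (simp add: c_def field_simps)
    also have "\<dots> \<le> ?J z * exp (s * e / 2)"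
      using exp_ge_add_one_self[of "s * e / 2"] cs J by (intro mult_left_mono) linarith+
    finally have "y ^ n \<le> (?J z * exp (s * e / 2)) ^ n" using that by (intro power_mono) auto
    also have "\<dots> = ?J z ^ n * exp (n * s * e / 2)"
      by (simp add: power_mult_distrib exp_of_nat_mult[symmetric] algebra_simps)
    finally show ?thesis .
  qed
  have main: "?J z ^ n * exp (- (n * e)) * (1 - 2 * exp (- (s * e / 2) * n)) \<le>
     (LINT X|(\<Pi>\<^sub>M i\<in>{..<n}. M). min (\<Prod>i<n. p (X i)) (\<Prod>i<n. q (X i)))" for n
  proof -
    let ?P = "\<Pi>\<^sub>M i\<in>{..<n}. M"
    interpret product_sigma_finite "\<lambda>_::nat. M" by unfold_locales
    define K where "K = (\<lambda>t X. \<Prod>i<n. p (X i) powr (1 - t) * q (X i) powr t)"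
    have ip: "integrable ?P (\<lambda>X. \<Prod>i<n. p (X i))" "integrable ?P (\<lambda>X. \<Prod>i<n. q (X i))"
      by (intro product_integrable_prod; simp add: integrable_p integrable_q)+
    have zs: "0 \<le> z" "z \<le> 1" "0 \<le> z + s" "z + s \<le> 1" "0 \<le> z - s" "z - s \<le> 1" using s C z by auto
    note iK = integral_prod_mix(2)[OF zs(1,2), of n, folded K_def]
      integral_prod_mix(2)[OF zs(3,4), of n, folded K_def] integral_prod_mix(2)[OF zs(5,6), of n, folded K_def]
    note eK = integral_prod_mix(1)[OF zs(1,2), of n, folded K_def]
      integral_prod_mix(1)[OF zs(3,4), of n, folded K_def] integral_prod_mix(1)[OF zs(5,6), of n, folded K_def]
    have K: "integrable ?P (K t)" "integral\<^sup>L ?P (K t) = ?J t ^ n" if "t \<in> {z, z + s, z - s}" for t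
      using that iK eK by (auto simp: K_def)
    have "?J (z + s) ^ n \<le> ?J z ^ n * exp (n * s * e / 2)" "?J (z - s) ^ n \<le> ?J z ^ n * exp (n * s * e / 2)"
      using C(5,6)[of s] s affinity_nonneg by (auto intro!: ub)
    then have "exp (- (n * s * e)) * (?J (z + s) ^ n + ?J (z - s) ^ n) \<le>
        exp (- (n * s * e)) * (2 * (?J z ^ n * exp (n * s * e / 2)))"
      by (intro mult_left_mono) auto
    also have "\<dots> = 2 * ?J z ^ n * (exp (- (n * s * e)) * exp (n * s * e / 2))" by simp
    also have "exp (- (n * s * e)) * exp (n * s * e / 2) = exp (- (s * e / 2) * n)"
      by (simp flip: exp_add)
    finally have "?J z ^ n * (1 - 2 * exp (- (s * e / 2) * n)) \<le>
        ?J z ^ n - exp (- (n * s * e)) * (?J (z + s) ^ n + ?J (z - s) ^ n)"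
      by (simp add: algebra_simps)
    then have "?J z ^ n * exp (- (n * e)) * (1 - 2 * exp (- (s * e / 2) * n)) \<le>
        exp (- (n * e)) * (?J z ^ n - exp (- (n * s * e)) * (?J (z + s) ^ n + ?J (z - s) ^ n))"
      using mult_left_mono[of _ _ "exp (- (n * e))"] by (simp add: mult.assoc mult.left_commute)
    also have "\<dots> = (LINT X|?P. exp (- (n * e)) * (K z X - exp (- (n * s * e)) * (K (z + s) X + K (z - s) X)))"
      by (simp add: K)
    also have "\<dots> \<le> (LINT X|?P. min (\<Prod>i<n. p (X i)) (\<Prod>i<n. q (X i)))"
    proof (rule integral_mono)
      show "integrable ?P (\<lambda>X. exp (- (n * e)) * (K z X - exp (- (n * s * e)) * (K (z + s) X + K (z - s) X)))"
        by (intro integrable_mult_right Bochner_Integration.integrable_diff Bochner_Integration.integrable_add K) auto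
      show "integrable ?P (\<lambda>X. min (\<Prod>i<n. p (X i)) (\<Prod>i<n. q (X i)))" using ip by simp
      show "exp (- (n * e)) * (K z X - exp (- (n * s * e)) * (K (z + s) X + K (z - s) X))
          \<le> min (\<Prod>i<n. p (X i)) (\<Prod>i<n. q (X i))" for X
        unfolding K_def using z s e by (intro min_prod_ge_tilted) (auto simp: nonneg_p nonneg_q)
    qed
    finally show ?thesis .
  qed
  have "(\<lambda>n. 2 * exp (- (s * e / 2) * real n)) \<longlonglongrightarrow> 2 * 0"
  proof (intro tendsto_mult tendsto_const filterlim_compose[OF exp_at_bot])
    show "LIM n sequentially. - (s * e / 2) * real n :> at_bot"
      using s e by (intro filterlim_tendsto_neg_mult_at_bot[OF tendsto_const] filterlim_real_sequentially) auto
  qed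
  then have "\<forall>\<^sub>F n in sequentially. 2 * exp (- (s * e / 2) * real n) < 1 / 2"
    by (rule order_tendstoD) simp
  then show ?thesis
  proof eventually_elim
    case (elim n)
    have "?J z ^ n * exp (- (n * e)) * (1 / 2) \<le> ?J z ^ n * exp (- (n * e)) * (1 - 2 * exp (- (s * e / 2) * n))"
      using elim affinity_nonneg by (intro mult_left_mono) auto
    then show ?case using main[of n] by simp
  qed
qed

end


subsection \<open>Chernoff index and minimal affinity\<close>

definition min_affinity :: "'x measure \<Rightarrow> ('x \<Rightarrow> real) \<Rightarrow> ('x \<Rightarrow> real) \<Rightarrow> real" where
  "min_affinity M p q = (INF z\<in>{0..1}. affinity M p q z)"

lemma affinity_commute: "affinity M q p z = affinity M p q (1 - z)"
  unfolding affinity_def by (simp add: mult.commute)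

lemma min_affinity_commute: "min_affinity M q p = min_affinity M p q"
proof -
  have "(\<lambda>z::real. 1 - z) ` {0..1} = {0..1}" by (auto simp: image_iff intro!: bexI[of _ "1 - _"])
  then have "affinity M q p ` {0..1} = affinity M p q ` {0..1}"
    by (metis (no_types, lifting) affinity_commute image_image image_cong)
  then show ?thesis by (simp add: min_affinity_def)
qed

context nonneg_integrable_pair
begin

lemma swap_pair: "nonneg_integrable_pair M q p"
  by unfold_locales (simp_all add: integrable_p integrable_q nonneg_p nonneg_q)

lemma min_affinity_attained:
  obtains z where "0 \<le> z" "z \<le> 1" "affinity M p q z = min_affinity M p q"
    "\<And>s. s \<in> {0..1} \<Longrightarrow> affinity M p q z \<le> affinity M p q s"
proof -
  obtain z where z: "z \<in> {0..1}" "\<forall>s\<in>{0..1}. affinity M p q z \<le> affinity M p q s"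
    using continuous_attains_inf[OF compact_Icc _ continuous_on_affinity] by auto
  have "min_affinity M p q = affinity M p q z"
    unfolding min_affinity_def using z
    by (intro antisym cINF_lower cINF_greatest bdd_belowI2[where m = 0]) (auto simp: affinity_nonneg)
  then show thesis using z by (intro that) auto
qed

lemma min_affinity_le: "0 \<le> z \<Longrightarrow> z \<le> 1 \<Longrightarrow> min_affinity M p q \<le> affinity M p q z"
  using min_affinity_attained by (metis atLeastAtMost_iff)

end

text \<open>Positivity refers to \<open>M\<close> itself, so \<open>M\<close> has no mass off the
  common support: \<open>log_lr\<close> is a.e. a genuine logarithm of the ratio, and the affinity
  is 1 at both endpoints.\<close>

locale density_pair = nonneg_integrable_pair M p q for M :: "real measure" and p q +
  assumes integral_p: "(LINT x|M. p x) = 1" and integral_q: "(LINT x|M. q x) = 1"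
    and AE_pos: "AE x in M. 0 < p x \<and> 0 < q x"

lemma density_pairI:
  assumes "sigma_finite_measure M" "prob_space (law M p)" "prob_space (law M q)"
    and "p \<in> borel_measurable M" "q \<in> borel_measurable M" "\<And>x. 0 \<le> p x" "\<And>x. 0 \<le> q x"
    and "AE x in M. 0 < p x \<and> 0 < q x"
  shows "density_pair M p q"
proof -
  interpret sigma_finite_measure M by fact
  have "integrable M f \<and> integral\<^sup>L M f = 1"
    if "prob_space (law M f)" "f \<in> borel_measurable M" "\<And>x. 0 \<le> f x" for f
  proof -
    interpret F: prob_space "law M f" by fact
    have "(\<integral>\<^sup>+x. ennreal (f x) \<partial>M) = 1"
      using F.emeasure_space_1 that(2) by (simp add: emeasure_density cong: nn_integral_cong)
    then show ?thesis using that by (auto intro!: integrableI_nonneg simp: integral_eq_nn_integral)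
  qed
  then show ?thesis using assms by unfold_locales auto
qed

context density_pair
begin

lemma swap_density_pair: "density_pair M q p"
proof -
  interpret s: nonneg_integrable_pair M q p by (rule swap_pair)
  show ?thesis by unfold_locales (use integral_p integral_q AE_pos in auto)
qed

lemma emeasure_space_neq_0: "emeasure M (space M) \<noteq> 0"
proof
  assume "emeasure M (space M) = 0"
  then have "space M \<in> null_sets M" by (simp add: null_setsI)
  then have "AE x in M. p x = 0" by (rule AE_I') auto
  then have "(LINT x|M. p x) = 0" by (rule integral_eq_zero_AE)
  then show False using integral_p by simp
qed

lemma affinity_0: "affinity M p q 0 = 1" and affinity_1: "affinity M p q 1 = 1"
proof -
  have "AE x in M. p x powr (1 - 0) * q x powr 0 = p x" "AE x in M. p x powr (1 - 1) * q x powr 1 = q x"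
    using AE_pos by (eventually_elim, simp)+
  then have "affinity M p q 0 = (LINT x|M. p x)" "affinity M p q 1 = (LINT x|M. q x)"
    unfolding affinity_def by (intro integral_cong_AE; simp)+
  then show "affinity M p q 0 = 1" "affinity M p q 1 = 1" by (simp_all add: integral_p integral_q)
qed

lemma min_affinity_pos: "0 < min_affinity M p q"
  using affinity_pos[OF _ _ AE_pos emeasure_space_neq_0] min_affinity_attained by metis

lemma min_affinity_le_1: "min_affinity M p q \<le> 1"
  using min_affinity_le[of 0] affinity_0 by simp

lemma prob_space_law: "prob_space (law M p)"
proof
  show "emeasure (law M p) (space (law M p)) = 1"
    using integral_p integrable_p
    by (simp add: emeasure_density nn_integral_eq_integral nonneg_p cong: nn_integral_cong_simp)
qed

lemma lr_mgf_eq: "lr_mgf M p q z = (\<integral>\<^sup>+x. ennreal (p x powr (1 - z) * q x powr z) \<partial>M)"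
proof -
  have "lr_mgf M p q z = (\<integral>\<^sup>+x. ennreal (p x) * ennreal (exp (z * log_lr p q x)) \<partial>M)"
    unfolding lr_mgf_def log_lr_def by (rule nn_integral_density) auto
  also have "\<dots> = (\<integral>\<^sup>+x. ennreal (p x powr (1 - z) * q x powr z) \<partial>M)"
  proof (rule nn_integral_cong_AE)
    show "AE x in M. ennreal (p x) * ennreal (exp (z * log_lr p q x)) = ennreal (p x powr (1 - z) * q x powr z)"
      using AE_pos
    proof eventually_elim
      case (elim x)
      then have "p x * exp (z * log_lr p q x) = p x powr (1 - z) * q x powr z"
        using powr_mix_shift[of "p x" "q x" 0 z] by (simp add: log_lr_def)
      then show ?case using nonneg_p by (simp flip: ennreal_mult')
    qed
  qed
  finally show ?thesis .
qed

lemma lr_mgf_affinity: "0 \<le> z \<Longrightarrow> z \<le> 1 \<Longrightarrow> lr_mgf M p q z = ennreal (affinity M p q z)"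
  unfolding lr_mgf_eq affinity_def by (intro nn_integral_eq_integral integrable_mix) auto

lemma lr_mgf_finite:
  assumes "lr_mgf M p q z \<noteq> \<infinity>"
  shows "integrable (law M p) (\<lambda>x. exp (z * log_lr p q x))"
    "lr_mgf M p q z = ennreal (LINT x|law M p. exp (z * log_lr p q x))"
proof -
  show *: "integrable (law M p) (\<lambda>x. exp (z * log_lr p q x))"
    using assms unfolding lr_mgf_def log_lr_def by (intro integrableI_nonneg) (auto simp: less_top)
  show "lr_mgf M p q z = ennreal (LINT x|law M p. exp (z * log_lr p q x))"
    using * unfolding lr_mgf_def by (intro nn_integral_eq_integral) auto
qed

lemma measurable_log_lr [measurable]: "log_lr p q \<in> borel_measurable M"
  unfolding log_lr_def[abs_def] by measurable

lemma nn_integral_log_lr_finite: "(\<integral>\<^sup>+x. ennreal (log_lr p q x) \<partial>law M p) \<noteq> \<infinity>"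
proof -
  have "(\<integral>\<^sup>+x. ennreal (log_lr p q x) \<partial>law M p) \<le> lr_mgf M p q 1"
    unfolding lr_mgf_def by (intro nn_integral_mono ennreal_leI) (use exp_ge_add_one_self in \<open>auto intro: order_trans[OF _ exp_ge_add_one_self]\<close>)
  also have "\<dots> = 1" using lr_mgf_affinity[of 1] affinity_1 by simp
  finally show ?thesis by (auto simp: top_unique)
qed

lemma ext_mean_log_lr:
  assumes "(\<integral>\<^sup>+x. ennreal (- log_lr p q x) \<partial>law M p) \<noteq> \<infinity>"
  shows "integrable (law M p) (log_lr p q)" "ext_mean (law M p) (log_lr p q) = ereal (LINT x|law M p. log_lr p q x)"
proof -
  show *: "integrable (law M p) (log_lr p q)"
    unfolding real_integrable_def using assms nn_integral_log_lr_finite by auto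
  obtain r r' where r: "(\<integral>\<^sup>+x. ennreal (log_lr p q x) \<partial>law M p) = ennreal r" "0 \<le> r"
     "(\<integral>\<^sup>+x. ennreal (- log_lr p q x) \<partial>law M p) = ennreal r'" "0 \<le> r'"
    using assms nn_integral_log_lr_finite by (metis ennreal_cases infinity_ennreal_def)
  show "ext_mean (law M p) (log_lr p q) = ereal (LINT x|law M p. log_lr p q x)"
    unfolding ext_mean_def real_lebesgue_integral_def[OF *] r using r by simp
qed

text \<open>The positive part has finite mean, so no difference of infinities arises and negation
  passes through even when the mean is \<open>-\<infinity>\<close>.\<close>

lemma ext_mean_neg_log_lr: "ext_mean (law M p) (\<lambda>x. - log_lr p q x) = - ext_mean (law M p) (log_lr p q)"
proof -
  obtain r where r: "(\<integral>\<^sup>+x. ennreal (log_lr p q x) \<partial>law M p) = ennreal r" "0 \<le> r"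
    using nn_integral_log_lr_finite by (metis ennreal_cases infinity_ennreal_def)
  show ?thesis unfolding ext_mean_def minus_minus r
    by (cases "enn2ereal (\<integral>\<^sup>+x. ennreal (- log_lr p q x) \<partial>law M p)") (use r in auto)
qed

text \<open>The tangent of \<open>exp\<close> at \<open>z * t\<close> bounds the transform below by
  \<open>exp (z * t)\<close> times one plus \<open>z\<close> times the difference of the mean and
  \<open>t\<close>; that product is positive, as \<open>z\<close> and the difference are both
  negative.\<close>

lemma rate_term_le_0_left:
  assumes "z < 0" "ext_mean (law M p) (log_lr p q) < ereal t"
  shows "ereal (z * t) - ext_ln (lr_mgf M p q z) \<le> 0"
proof (cases "lr_mgf M p q z = \<infinity>")
  case False
  interpret P: prob_space "law M p" by (rule prob_space_law)
  let ?l = "log_lr p q"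
  note int = lr_mgf_finite[OF False]
  \<comment> \<open>A finite transform at a negative \<open>z\<close> dominates the negative part of
    the log-ratio, so the mean is finite and may enter the tangent bound.\<close>
  have "(\<integral>\<^sup>+x. ennreal (- ?l x) \<partial>law M p) \<le> (\<integral>\<^sup>+x. ennreal (1 / (- z)) * ennreal (exp (z * ?l x)) \<partial>law M p)"
  proof (intro nn_integral_mono)
    fix x
    have "z * ?l x \<le> exp (z * ?l x)" using exp_ge_add_one_self[of "z * ?l x"] by linarith
    then have "- ?l x \<le> 1 / (- z) * exp (z * ?l x)" using assms(1) by (simp add: field_simps)
    then show "ennreal (- ?l x) \<le> ennreal (1 / (- z)) * ennreal (exp (z * ?l x))"
      using assms(1) by (simp add: ennreal_mult'[symmetric] ennreal_leI)
  qed
  also have "\<dots> = ennreal (1 / (- z)) * lr_mgf M p q z" unfolding lr_mgf_def by (rule nn_integral_cmult) simp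
  also have "\<dots> < \<infinity>" using False by (simp add: ennreal_mult_less_top less_top)
  finally have l: "integrable (law M p) ?l" "ext_mean (law M p) ?l = ereal (LINT x|law M p. ?l x)"
    using ext_mean_log_lr by auto
  have lt: "(LINT x|law M p. ?l x) < t" using assms(2) l(2) by simp
  have "exp (z * t) \<le> exp (z * t) * (1 + z * ((LINT x|law M p. ?l x) - t))"
    using lt assms(1) by (simp add: mult_nonpos_nonpos)
  also have "\<dots> = (LINT x|law M p. exp (z * t) * (1 + z * (?l x - t)))"
    using l(1) P.prob_space by (simp add: algebra_simps)
  also have "\<dots> \<le> (LINT x|law M p. exp (z * ?l x))"
  proof (rule integral_mono)
    show "integrable (law M p) (\<lambda>x. exp (z * t) * (1 + z * (?l x - t)))" using l(1) by simp
    fix x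
    have "exp (z * t) * (1 + z * (?l x - t)) \<le> exp (z * t) * exp (z * (?l x - t))"
      using exp_ge_add_one_self by (intro mult_left_mono) auto
    then show "exp (z * t) * (1 + z * (?l x - t)) \<le> exp (z * ?l x)" by (simp add: algebra_simps flip: exp_add)
  qed (rule int)
  finally have "exp (z * t) \<le> (LINT x|law M p. exp (z * ?l x))" .
  moreover from this have "0 < (LINT x|law M p. exp (z * ?l x))" by (rule less_le_trans[OF exp_gt_zero])
  ultimately have "0 < (LINT x|law M p. exp (z * ?l x))" "z * t \<le> ln (LINT x|law M p. exp (z * ?l x))"
    by (simp_all add: ln_ge_iff)
  then show ?thesis unfolding int(2) ext_ln_def by simp
qed (simp add: ext_ln_def)

text \<open>Jensen's inequality: the transform is 1 at 1, hence at least 1 at \<open>z > 1\<close>,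
  while \<open>z * t \<le> 0\<close>. The power \<open>1 / z\<close> is treated by the
  arithmetic-geometric mean inequality.\<close>

lemma rate_term_le_0_right:
  assumes "1 < z" "t \<le> 0"
  shows "ereal (z * t) - ext_ln (lr_mgf M p q z) \<le> 0"
proof (cases "lr_mgf M p q z = \<infinity>")
  case False
  interpret P: prob_space "law M p" by (rule prob_space_law)
  let ?l = "log_lr p q"
  note int = lr_mgf_finite[OF False]
  have 1: "lr_mgf M p q 1 = 1" using lr_mgf_affinity[of 1] affinity_1 by simp
  then have int1: "integrable (law M p) (\<lambda>x. exp (?l x))" "(LINT x|law M p. exp (?l x)) = 1"
    using lr_mgf_finite[of 1] by auto
  have "(LINT x|law M p. exp (?l x)) \<le> (LINT x|law M p. (1 - 1 / z) + 1 / z * exp (z * ?l x))"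
  proof (rule integral_mono)
    show "integrable (law M p) (\<lambda>x. (1 - 1 / z) + 1 / z * exp (z * ?l x))"
      by (intro Bochner_Integration.integrable_add integrable_mult_right int(1)) simp
    show "exp (?l x) \<le> (1 - 1 / z) + 1 / z * exp (z * ?l x)" for x
      using powr_mix_le[of 1 "exp (z * ?l x)" "1 / z"] assms(1) by (simp add: powr_def)
  qed (rule int1)
  also have "\<dots> = (1 - 1 / z) + 1 / z * (LINT x|law M p. exp (z * ?l x))"
    using int(1) P.prob_space by simp
  finally have "1 \<le> (LINT x|law M p. exp (z * ?l x))" using assms(1) unfolding int1(2) by (simp add: field_simps)
  moreover have "z * t \<le> 0" using assms by (simp add: mult_nonneg_nonpos)
  ultimately show ?thesis unfolding int(2) ext_ln_def by (auto simp: add_increasing2 intro: order_trans)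
qed (simp add: ext_ln_def)

lemma rate_term_mid:
  assumes "0 \<le> z" "z \<le> 1"
  shows "ereal (z * t) - ext_ln (lr_mgf M p q z) = ereal (z * t - ln (affinity M p q z))"
  using affinity_pos[OF assms AE_pos emeasure_space_neq_0] unfolding lr_mgf_affinity[OF assms] ext_ln_def
  by simp

text \<open>Only exponents in \<open>{0..1}\<close> can give a positive term; there
  \<open>z * t \<le> 0\<close> and the affinity is at least its minimum.\<close>

lemma lr_rate_le:
  assumes "ext_mean (law M p) (log_lr p q) < ereal t" "t \<le> 0"
  shows "lr_rate M p q t \<le> ereal (- ln (min_affinity M p q))"
  unfolding lr_rate_def
proof (rule SUP_least)
  fix z :: real
  have C0: "0 \<le> - ln (min_affinity M p q)" using min_affinity_le_1 min_affinity_pos by simp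
  then have *: "ereal (z * t) - ext_ln (lr_mgf M p q z) \<le> ereal (- ln (min_affinity M p q))" if "z < 0 \<or> 1 < z"
    using that rate_term_le_0_left[OF _ assms(1), of z] rate_term_le_0_right[OF _ assms(2), of z]
    by (metis ereal_less_eq(3) order_trans zero_ereal_def)
  show "ereal (z * t) - ext_ln (lr_mgf M p q z) \<le> ereal (- ln (min_affinity M p q))"
  proof (cases "z < 0 \<or> 1 < z")
    case False
    then have z: "0 \<le> z" "z \<le> 1" by auto
    have "z * t \<le> 0" using z assms(2) by (simp add: mult_nonneg_nonpos)
    moreover have "ln (min_affinity M p q) \<le> ln (affinity M p q z)"
      using min_affinity_le[OF z] min_affinity_pos by simp
    ultimately show ?thesis unfolding rate_term_mid[OF z] by simp
  qed (rule *)
qed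

lemma le_lr_rate_0: "ereal (- ln (min_affinity M p q)) \<le> lr_rate M p q 0"
proof -
  obtain z where z: "0 \<le> z" "z \<le> 1" "affinity M p q z = min_affinity M p q"
    using min_affinity_attained by metis
  have "ereal (- ln (min_affinity M p q)) = ereal (z * 0) - ext_ln (lr_mgf M p q z)"
    using rate_term_mid[OF z(1,2), of 0] z(3) by simp
  also have "\<dots> \<le> lr_rate M p q 0" unfolding lr_rate_def by (rule SUP_upper) simp
  finally show ?thesis .
qed

text \<open>Twice the deficit is the squared Hellinger distance; if it vanished, the densities would
  agree a.e. and the mean would be 0. The exponent 1/2 is fixed under exchange of the densities, so
  separation assumed under one of them is carried over to the other.\<close>

lemma affinity_half_less_1:
  assumes "ext_mean (law M p) (log_lr p q) \<noteq> 0"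
  shows "affinity M p q (1 / 2) < 1"
proof (rule ccontr)
  assume "\<not> ?thesis"
  then have ge: "1 \<le> affinity M p q (1 / 2)" by simp
  have eq: "(sqrt (p x) - sqrt (q x))\<^sup>2 = p x + q x - 2 * (p x powr (1 - 1 / 2) * q x powr (1 / 2))" for x
    using nonneg_p[of x] nonneg_q[of x] by (simp add: power2_diff powr_half_sqrt)
  have i: "integrable M (\<lambda>x. p x powr (1 - 1 / 2) * q x powr (1 / 2))" by (rule integrable_mix) auto
  have int: "integrable M (\<lambda>x. (sqrt (p x) - sqrt (q x))\<^sup>2)"
    unfolding eq using integrable_p integrable_q i by (intro Bochner_Integration.integrable_diff Bochner_Integration.integrable_add integrable_mult_right)
  have "(LINT x|M. (sqrt (p x) - sqrt (q x))\<^sup>2) = 2 - 2 * affinity M p q (1 / 2)"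
    unfolding eq affinity_def using integrable_p integrable_q i integral_p integral_q
    by (subst Bochner_Integration.integral_diff) auto
  then have "(LINT x|M. (sqrt (p x) - sqrt (q x))\<^sup>2) = 0"
    using ge integral_nonneg_AE[of "\<lambda>x. (sqrt (p x) - sqrt (q x))\<^sup>2" M] by simp
  then have "AE x in M. (sqrt (p x) - sqrt (q x))\<^sup>2 = 0"
    using integral_nonneg_eq_0_iff_AE[OF int] by simp
  then have pq: "AE x in M. p x = q x" by eventually_elim (use nonneg_p nonneg_q in auto)
  then have "AE x in law M p. log_lr p q x = 0"
    by (subst AE_density) (auto simp: log_lr_def elim: eventually_mono)
  then have "ext_mean (law M p) (log_lr p q) = ext_mean (law M p) (\<lambda>_. 0)"
    unfolding ext_mean_def by (intro arg_cong2[where f = minus] arg_cong[where f = enn2ereal] nn_integral_cong_AE) auto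
  also have "\<dots> = 0" by (simp add: ext_mean_def)
  finally show False using assms by simp
qed

text \<open>Integrate \<open>1 + x \<le> exp x\<close> at half the log-ratio; if the negative part
  has infinite integral, the mean is \<open>-\<infinity>\<close> anyway.\<close>

lemma ext_mean_neg_of_affinity:
  assumes "affinity M p q (1 / 2) < 1"
  shows "ext_mean (law M p) (log_lr p q) < 0"
proof (cases "(\<integral>\<^sup>+x. ennreal (- log_lr p q x) \<partial>law M p) = \<infinity>")
  case True
  obtain r where r: "(\<integral>\<^sup>+x. ennreal (log_lr p q x) \<partial>law M p) = ennreal r" "0 \<le> r"
    using nn_integral_log_lr_finite by (metis ennreal_cases infinity_ennreal_def)
  show ?thesis unfolding ext_mean_def True r using r by simp
next
  case False
  interpret P: prob_space "law M p" by (rule prob_space_law)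
  let ?l = "log_lr p q"
  note l = ext_mean_log_lr[OF False]
  have h: "lr_mgf M p q (1 / 2) = ennreal (affinity M p q (1 / 2))" by (rule lr_mgf_affinity) auto
  then have m: "integrable (law M p) (\<lambda>x. exp (1 / 2 * ?l x))" 
    "(LINT x|law M p. exp (1 / 2 * ?l x)) = affinity M p q (1 / 2)"
    using lr_mgf_finite[of "1 / 2"] affinity_nonneg by auto
  have "1 + 1 / 2 * (LINT x|law M p. ?l x) = (LINT x|law M p. 1 + 1 / 2 * ?l x)"
    using l(1) P.prob_space by simp
  also have "\<dots> \<le> (LINT x|law M p. exp (1 / 2 * ?l x))"
    using l(1) exp_ge_add_one_self by (intro integral_mono m) auto
  also have "\<dots> < 1" using m assms by simp
  finally show ?thesis unfolding l(2) by simp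
qed

text \<open>For \<open>t \<le> 0\<close> the rate under \<open>p\<close> obeys the bound, for
  \<open>t > 0\<close> the rate under \<open>q\<close> at \<open>- t\<close> does, and at 0 both
  rates reach it. The point 0 is admissible because the means under \<open>p\<close> and
  \<open>q\<close> have opposite signs.\<close>

lemma chernoff_index_eq:
  assumes neg: "ext_mean (law M p) (log_lr p q) < 0"
  shows "chernoff_index M p q = ereal (- ln (min_affinity M p q))" "min_affinity M p q < 1"
proof -
  interpret s: density_pair M q p by (rule swap_density_pair)
  have half: "affinity M p q (1 / 2) < 1" using affinity_half_less_1 neg by auto
  then show "min_affinity M p q < 1" using min_affinity_le[of "1 / 2"] by auto
  have "ext_mean (law M q) (log_lr q p) < 0"
    using half affinity_commute[of M q p "1 / 2"] by (intro s.ext_mean_neg_of_affinity) simp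
  have flip: "log_lr p q = (\<lambda>x. - log_lr q p x)" by (auto simp: log_lr_def)
  have neg': "ext_mean (law M q) (log_lr p q) = - ext_mean (law M q) (log_lr q p)"
    unfolding flip by (rule s.ext_mean_neg_log_lr)
  let ?C = "ereal (- ln (min_affinity M p q))"
  show "chernoff_index M p q = ?C"
    unfolding chernoff_index_def
  proof (intro antisym SUP_least SUP_upper2[of 0])
    fix t assume t: "t \<in> {t. ext_mean (law M p) (log_lr p q) < ereal t \<and> ereal t < ext_mean (law M q) (log_lr p q)}"
    show "min (lr_rate M p q t) (lr_rate M q p (- t)) \<le> ?C"
    proof (cases "t \<le> 0")
      case True
      then show ?thesis using t lr_rate_le[of t] by (auto simp: min.coboundedI1)
    next
      case False
      have "ext_mean (law M q) (log_lr q p) < ereal (- t)"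
        using t unfolding neg' by (metis (mono_tags, lifting) ereal_less_uminus_reorder mem_Collect_eq uminus_ereal.simps(1))
      then show ?thesis using False s.lr_rate_le[of "- t"] by (auto simp: min.coboundedI2 min_affinity_commute[of M q p])
    qed
  next
    show "0 \<in> {t. ext_mean (law M p) (log_lr p q) < ereal t \<and> ereal t < ext_mean (law M q) (log_lr p q)}"
      using neg \<open>ext_mean (law M q) (log_lr q p) < 0\<close> neg' by (simp add: zero_ereal_def[symmetric] ereal_less_uminus_reorder)
    show "?C \<le> min (lr_rate M p q 0) (lr_rate M q p (- 0))"
      using le_lr_rate_0 s.le_lr_rate_0 by (simp add: min_affinity_commute[of M q p])
  qed
qed

end


subsection \<open>Mixture likelihoods\<close>

lemma sample_law_density:
  assumes "sigma_finite_measure M" and [measurable]: "f \<in> borel_measurable M"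
    and f: "\<And>x. 0 \<le> f x" "prob_space (law M f)"
  shows "sample_law n M f = density (\<Pi>\<^sub>M i\<in>{..<n}. M) (\<lambda>X. ennreal (\<Prod>i<n. f (X i)))"
proof -
  interpret M: sigma_finite_measure M by fact
  interpret L: prob_space "law M f" by fact
  interpret PM: product_sigma_finite "\<lambda>_::nat. M" by unfold_locales
  interpret PL: product_sigma_finite "\<lambda>_::nat. law M f" by unfold_locales
  show ?thesis unfolding sample_law_def
  proof (rule PL.PiM_eqI[symmetric])
    show "sets (density (\<Pi>\<^sub>M i\<in>{..<n}. M) (\<lambda>X. ennreal (\<Prod>i<n. f (X i)))) = sets (\<Pi>\<^sub>M i\<in>{..<n}. law M f)"
      by (simp cong: sets_PiM_cong)
    fix A assume "\<And>i. i \<in> {..<n} \<Longrightarrow> A i \<in> sets (law M f)"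
    then have A: "A i \<in> sets M" if "i < n" for i using that by simp
    have [measurable]: "Pi\<^sub>E {..<n} A \<in> sets (\<Pi>\<^sub>M i\<in>{..<n}. M)" using A by (intro sets_PiM_I_finite) auto
    have "emeasure (density (\<Pi>\<^sub>M i\<in>{..<n}. M) (\<lambda>X. ennreal (\<Prod>i<n. f (X i)))) (Pi\<^sub>E {..<n} A) =
       (\<integral>\<^sup>+X. ennreal (\<Prod>i<n. f (X i)) * indicator (Pi\<^sub>E {..<n} A) X \<partial>(\<Pi>\<^sub>M i\<in>{..<n}. M))"
      by (rule emeasure_density) simp_all
    also have "\<dots> = (\<integral>\<^sup>+X. (\<Prod>i<n. ennreal (f (X i)) * indicator (A i) (X i)) \<partial>(\<Pi>\<^sub>M i\<in>{..<n}. M))"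
    proof (rule nn_integral_cong)
      fix X assume "X \<in> space (\<Pi>\<^sub>M i\<in>{..<n}. M)"
      then have ext: "X \<in> extensional {..<n}" by (auto simp: space_PiM PiE_def)
      have "(indicator (Pi\<^sub>E {..<n} A) X :: ennreal) = (\<Prod>i<n. indicator (A i) (X i))"
      proof (cases "X \<in> Pi\<^sub>E {..<n} A")
        case False
        then obtain i where "i < n" "X i \<notin> A i" using ext by (auto simp: PiE_def)
        then have "(\<Prod>i<n. indicator (A i) (X i) :: ennreal) = 0"
          by (intro prod_zero bexI[of _ i]) (auto simp: indicator_def)
        then show ?thesis using False by simp
      qed (auto simp: PiE_def Pi_def)
      then show "ennreal (\<Prod>i<n. f (X i)) * indicator (Pi\<^sub>E {..<n} A) X =
          (\<Prod>i<n. ennreal (f (X i)) * indicator (A i) (X i))"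
        by (simp add: prod.distrib prod_ennreal f)
    qed
    also have "\<dots> = (\<Prod>i<n. \<integral>\<^sup>+x. ennreal (f x) * indicator (A i) x \<partial>M)"
      by (rule PM.product_nn_integral_prod) (use A in auto)
    also have "\<dots> = (\<Prod>i<n. emeasure (law M f) (A i))"
      using A by (intro prod.cong refl emeasure_density[symmetric]) auto
    finally show "emeasure (density (\<Pi>\<^sub>M i\<in>{..<n}. M) (\<lambda>X. ennreal (\<Prod>i<n. f (X i)))) (Pi\<^sub>E {..<n} A) =
      (\<Prod>i<n. emeasure (law M f) (A i))" .
  qed simp
qed

text \<open>The factors are only sigma-finite, but the exceptional cylinder is still null: its
  measure is a product with a zero factor, whatever the other factors are.\<close>

lemma AE_PiM_all:
  assumes "sigma_finite_measure M" "AE x in M. P x"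
  shows "AE X in (\<Pi>\<^sub>M i\<in>{..<n::nat}. M). \<forall>i<n. P (X i)"
proof -
  interpret M: sigma_finite_measure M by fact
  interpret PM: product_sigma_finite "\<lambda>_::nat. M" by unfold_locales
  obtain N where N: "{x \<in> space M. \<not> P x} \<subseteq> N" "emeasure M N = 0" "N \<in> sets M"
    using assms(2) by (rule AE_E)
  have "AE X in (\<Pi>\<^sub>M i\<in>{..<n}. M). \<forall>i\<in>{..<n}. P (X i)"
  proof (rule AE_finite_allI)
    fix j assume j: "j \<in> {..<n}"
    let ?A = "Pi\<^sub>E {..<n} (\<lambda>i. if i = j then N else space M)"
    have "emeasure (\<Pi>\<^sub>M i\<in>{..<n}. M) ?A = (\<Prod>i<n. emeasure M (if i = j then N else space M))"
      using N(3) by (intro PM.emeasure_PiM) auto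
    also have "\<dots> = 0" using j N(2) by (intro prod_zero) auto
    finally have "?A \<in> null_sets (\<Pi>\<^sub>M i\<in>{..<n}. M)" using N(3) by (intro null_setsI sets_PiM_I_finite) auto
    then show "AE X in (\<Pi>\<^sub>M i\<in>{..<n}. M). P (X j)"
      by (rule AE_I') (use N(1) j in \<open>auto simp: space_PiM PiE_def Pi_def extensional_def split: if_splits\<close>)
  qed simp
  then show ?thesis by (rule AE_mp) auto
qed

lemma emeasure_sample_law_some:
  assumes "prob_space (law M f)" "B \<in> sets M" "emeasure (law M f) B \<le> t"
  shows "emeasure (sample_law n M f) {X \<in> space (sample_law n M f). \<exists>i<n. X i \<in> B} \<le> of_nat n * t"
proof -
  interpret L: prob_space "law M f" by fact
  interpret P: product_prob_space "\<lambda>_::nat. law M f" "{..<n}" by unfold_locales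
  let ?S = "sample_law n M f"
  let ?A = "\<lambda>i. {X \<in> space ?S. X i \<in> B}"
  have meas: "(\<lambda>X. X i) \<in> measurable ?S (law M f)" if "i < n" for i
    unfolding sample_law_def using that by (intro measurable_component_singleton) simp
  have A: "?A i \<in> sets ?S" if "i < n" for i
    using measurable_sets[OF meas[OF that], of B] assms(2) by (simp add: vimage_def Int_def conj_commute)
  have e: "emeasure ?S (?A i) = emeasure (law M f) B" if "i < n" for i
  proof -
    have "emeasure (law M f) B = emeasure (distr ?S (law M f) (\<lambda>X. X i)) B"
      using P.PiM_component[of i] that by (simp add: sample_law_def)
    also have "\<dots> = emeasure ?S ((\<lambda>X. X i) -` B \<inter> space ?S)"
      using meas[OF that] assms(2) by (intro emeasure_distr) auto
    finally show ?thesis by (simp add: vimage_def Int_def conj_commute)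
  qed
  have "{X \<in> space ?S. \<exists>i<n. X i \<in> B} = (\<Union>i\<in>{..<n}. ?A i)" by auto
  then have "emeasure ?S {X \<in> space ?S. \<exists>i<n. X i \<in> B} \<le> (\<Sum>i<n. emeasure ?S (?A i))"
    using A by (auto intro: emeasure_subadditive_finite)
  also have "\<dots> \<le> (\<Sum>i<n. t)" using e assms(3) by (intro sum_mono) auto
  finally show ?thesis by simp
qed

text \<open>Values in \<open>ennreal\<close> allow Tonelli's theorem without integrability; for a
  prior measure and a sample where it is finite, it agrees with \<open>marginal_lik\<close>.\<close>

definition mixture_lik :: "'c measure \<Rightarrow> ('c \<Rightarrow> real \<Rightarrow> real) \<Rightarrow> nat \<Rightarrow> (nat \<Rightarrow> real) \<Rightarrow> ennreal" where
  "mixture_lik \<pi> g n X = (\<integral>\<^sup>+\<theta>. ennreal (\<Prod>i<n. g \<theta> (X i)) \<partial>\<pi>)"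

text \<open>\<open>W n\<close> is the set of observations at which the likelihood is regular enough for the mixture
  likelihood to agree, up to the subexponential factor \<open>\<kappa> n\<close>, with its maximum over the net
  \<open>T n\<close>; a single observation falls outside it with probability at most \<open>\<tau> n\<close>.\<close>

locale likelihood_family = sigma_finite_measure M + \<pi>: prob_space \<pi>
  for M :: "real measure" and \<pi> :: "'c measure" +
  fixes g :: "'c \<Rightarrow> real \<Rightarrow> real" and W :: "nat \<Rightarrow> real set" and T :: "nat \<Rightarrow> 'c set"
    and \<kappa> \<tau> :: "nat \<Rightarrow> real"
  assumes joint_measurable: "(\<lambda>(\<theta>, x). g \<theta> x) \<in> borel_measurable (\<pi> \<Otimes>\<^sub>M M)"
    and nonneg: "\<And>\<theta> x. \<theta> \<in> space \<pi> \<Longrightarrow> 0 \<le> g \<theta> x"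
    and prob: "\<And>\<theta>. \<theta> \<in> space \<pi> \<Longrightarrow> prob_space (law M (g \<theta>))"
    and AE_pos: "\<And>\<theta>. \<theta> \<in> space \<pi> \<Longrightarrow> AE x in M. 0 < g \<theta> x"
    and \<kappa>_ge_1: "\<And>n. 1 \<le> \<kappa> n"
    and \<kappa>_subexp: "\<And>c::real. 0 < c \<Longrightarrow> \<forall>\<^sub>F n in sequentially. \<kappa> n \<le> exp (c * n)"
    and \<tau>_nonneg: "\<And>n. 0 \<le> \<tau> n"
    and \<tau>_superexp: "\<And>c::real. \<forall>\<^sub>F n in sequentially. n * \<tau> n \<le> exp (- c * n)"
    and net: "\<forall>\<^sub>F n in sequentially. T n \<subseteq> space \<pi> \<and> finite (T n) \<and> card (T n) \<le> \<kappa> n"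
    and sandwich: "\<forall>\<^sub>F n in sequentially. \<forall>X\<in>space (\<Pi>\<^sub>M i\<in>{..<n}. M). (\<forall>i<n. X i \<in> W n) \<longrightarrow>
      (\<forall>\<theta>\<in>space \<pi>. ennreal (\<Prod>i<n. g \<theta> (X i)) \<le> \<kappa> n * mixture_lik \<pi> g n X) \<and>
      (\<exists>\<theta>\<in>T n. mixture_lik \<pi> g n X \<le> \<kappa> n * ennreal (\<Prod>i<n. g \<theta> (X i)))"
    and exceptional: "\<forall>\<^sub>F n in sequentially. \<forall>\<theta>\<in>space \<pi>. \<exists>B\<in>sets M. space M - W n \<subseteq> B \<and>
      emeasure (law M (g \<theta>)) B \<le> ennreal (\<tau> n)"
begin

lemma measurable_section: "\<theta> \<in> space \<pi> \<Longrightarrow> g \<theta> \<in> borel_measurable M"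
  using measurable_Pair2[OF joint_measurable] by simp

lemma measurable_lik [measurable]:
  "(\<lambda>(\<theta>, X). ennreal (\<Prod>i<n. g \<theta> (X i))) \<in> borel_measurable (\<pi> \<Otimes>\<^sub>M (\<Pi>\<^sub>M i\<in>{..<n}. M))"
proof -
  have "(\<lambda>p. g (fst p) (snd p i)) \<in> borel_measurable (\<pi> \<Otimes>\<^sub>M (\<Pi>\<^sub>M i\<in>{..<n}. M))" if "i < n" for i
  proof -
    have "(\<lambda>p. (fst p, snd p i)) \<in> measurable (\<pi> \<Otimes>\<^sub>M (\<Pi>\<^sub>M i\<in>{..<n}. M)) (\<pi> \<Otimes>\<^sub>M M)"
      using that by (intro measurable_Pair measurable_fst measurable_compose[OF measurable_snd] measurable_component_singleton) auto
    from measurable_compose[OF this joint_measurable] show ?thesis by simp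
  qed
  then show ?thesis unfolding split_beta' by (intro measurable_compose[OF borel_measurable_prod] measurable_ennreal) auto
qed

lemma measurable_lik_section: "\<theta> \<in> space \<pi> \<Longrightarrow>
    (\<lambda>X. ennreal (\<Prod>i<n. g \<theta> (X i))) \<in> borel_measurable (\<Pi>\<^sub>M i\<in>{..<n}. M)"
  using measurable_Pair2[OF measurable_lik] by simp

lemma sample_law_eq: "\<theta> \<in> space \<pi> \<Longrightarrow>
    sample_law n M (g \<theta>) = density (\<Pi>\<^sub>M i\<in>{..<n}. M) (\<lambda>X. ennreal (\<Prod>i<n. g \<theta> (X i)))"
  by (intro sample_law_density sigma_finite_measure_axioms measurable_section prob) (auto simp: nonneg)

lemma prob_space_sample_law: "\<theta> \<in> space \<pi> \<Longrightarrow> prob_space (sample_law n M (g \<theta>))"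
  unfolding sample_law_def using prob by (intro prob_space_PiM) auto

lemma emeasure_sample_law: "\<theta> \<in> space \<pi> \<Longrightarrow> A \<in> sets (\<Pi>\<^sub>M i\<in>{..<n}. M) \<Longrightarrow>
    emeasure (sample_law n M (g \<theta>)) A =
      (\<integral>\<^sup>+X. ennreal (\<Prod>i<n. g \<theta> (X i)) * indicator A X \<partial>(\<Pi>\<^sub>M i\<in>{..<n}. M))"
  unfolding sample_law_eq by (intro emeasure_density measurable_lik_section)

lemma measurable_mixture_lik [measurable]:
  "mixture_lik \<pi> g n \<in> borel_measurable (\<Pi>\<^sub>M i\<in>{..<n}. M)"
proof -
  have "(\<lambda>(X, \<theta>). ennreal (\<Prod>i<n. g \<theta> (X i))) \<in> borel_measurable ((\<Pi>\<^sub>M i\<in>{..<n}. M) \<Otimes>\<^sub>M \<pi>)"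
    using measurable_pair_swap[OF measurable_lik] by simp
  then show ?thesis unfolding mixture_lik_def[abs_def] by (rule \<pi>.borel_measurable_nn_integral)
qed

text \<open>Tonelli's theorem turns an error averaged over the prior into the integral of the
  mixture likelihood over the event, which links average errors to a Bayes risk.\<close>

lemma measurable_emeasure_sample_law:
  assumes [measurable]: "A \<in> sets (\<Pi>\<^sub>M i\<in>{..<n}. M)"
  shows "(\<lambda>\<theta>. emeasure (sample_law n M (g \<theta>)) A) \<in> borel_measurable \<pi>"
    and "(\<integral>\<^sup>+\<theta>. emeasure (sample_law n M (g \<theta>)) A \<partial>\<pi>) =
      (\<integral>\<^sup>+X. mixture_lik \<pi> g n X * indicator A X \<partial>(\<Pi>\<^sub>M i\<in>{..<n}. M))"
proof -
  let ?P = "\<Pi>\<^sub>M i\<in>{..<n}. M"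
  interpret PM: product_sigma_finite "\<lambda>_::nat. M" by unfold_locales
  interpret S: sigma_finite_measure ?P by (rule PM.sigma_finite) simp
  interpret pair_sigma_finite \<pi> ?P by unfold_locales
  let ?f = "\<lambda>\<theta> X. ennreal (\<Prod>i<n. g \<theta> (X i)) * indicator A X"
  have m: "(\<lambda>(\<theta>, X). ?f \<theta> X) \<in> borel_measurable (\<pi> \<Otimes>\<^sub>M ?P)"
    using measurable_lik[of n] unfolding split_beta' by measurable
  have "(\<lambda>\<theta>. \<integral>\<^sup>+X. ?f \<theta> X \<partial>?P) \<in> borel_measurable \<pi>"
    using S.borel_measurable_nn_integral[of ?f \<pi>] m by simp
  then show "(\<lambda>\<theta>. emeasure (sample_law n M (g \<theta>)) A) \<in> borel_measurable \<pi>"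
    by (rule measurable_cong[THEN iffD1, rotated]) (simp add: emeasure_sample_law assms)
  have "(\<integral>\<^sup>+\<theta>. emeasure (sample_law n M (g \<theta>)) A \<partial>\<pi>) = (\<integral>\<^sup>+\<theta>. \<integral>\<^sup>+X. ?f \<theta> X \<partial>?P \<partial>\<pi>)"
    by (intro nn_integral_cong emeasure_sample_law assms)
  also have "\<dots> = (\<integral>\<^sup>+X. \<integral>\<^sup>+\<theta>. ?f \<theta> X \<partial>\<pi> \<partial>?P)"
    using Fubini'[OF m] by simp
  also have "\<dots> = (\<integral>\<^sup>+X. mixture_lik \<pi> g n X * indicator A X \<partial>?P)"
    unfolding mixture_lik_def
  proof (rule nn_integral_cong)
    fix X assume "X \<in> space ?P"
    then have "(\<lambda>\<theta>. ennreal (\<Prod>i<n. g \<theta> (X i))) \<in> borel_measurable \<pi>"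
      using measurable_Pair1[OF measurable_lik] by simp
    then show "(\<integral>\<^sup>+\<theta>. ?f \<theta> X \<partial>\<pi>) = (\<integral>\<^sup>+\<theta>. ennreal (\<Prod>i<n. g \<theta> (X i)) \<partial>\<pi>) * indicator A X"
      by (rule nn_integral_multc)
  qed
  finally show "(\<integral>\<^sup>+\<theta>. emeasure (sample_law n M (g \<theta>)) A \<partial>\<pi>) =
      (\<integral>\<^sup>+X. mixture_lik \<pi> g n X * indicator A X \<partial>?P)" .
qed

text \<open>Positivity a.e. gives every sample law the null sets of the product base measure, so one
  vanishing error would force all of them to vanish.\<close>

lemma sample_law_null_iff:
  assumes "\<theta> \<in> space \<pi>" "A \<in> sets (\<Pi>\<^sub>M i\<in>{..<n}. M)"
  shows "emeasure (sample_law n M (g \<theta>)) A = 0 \<longleftrightarrow> emeasure (\<Pi>\<^sub>M i\<in>{..<n}. M) A = 0"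
proof -
  let ?P = "\<Pi>\<^sub>M i\<in>{..<n}. M"
  have pos: "AE X in ?P. \<forall>i<n. 0 < g \<theta> (X i)"
    using AE_PiM_all[OF sigma_finite_measure_axioms AE_pos[OF assms(1)]] .
  have "emeasure (sample_law n M (g \<theta>)) A = 0 \<longleftrightarrow>
      (AE X in ?P. ennreal (\<Prod>i<n. g \<theta> (X i)) * indicator A X = 0)"
    unfolding emeasure_sample_law[OF assms]
    by (intro nn_integral_0_iff_AE borel_measurable_times_ennreal measurable_lik_section assms borel_measurable_indicator)
  also have "\<dots> \<longleftrightarrow> (AE X in ?P. X \<notin> A)"
  proof (intro iffI)
    assume "AE X in ?P. ennreal (\<Prod>i<n. g \<theta> (X i)) * indicator A X = 0"
    with pos show "AE X in ?P. X \<notin> A"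
    proof eventually_elim
      case (elim X)
      have "0 < (\<Prod>i<n. g \<theta> (X i))" using elim(1) by (intro prod_pos) auto
      then show ?case using elim(2) by (auto simp: indicator_def ennreal_eq_0_iff)
    qed
  next
    assume "AE X in ?P. X \<notin> A"
    then show "AE X in ?P. ennreal (\<Prod>i<n. g \<theta> (X i)) * indicator A X = 0" by eventually_elim simp
  qed
  also have "\<dots> \<longleftrightarrow> A \<in> null_sets ?P" using AE_iff_null_sets[OF assms(2)] by simp
  finally show ?thesis using assms(2) by auto
qed

end


subsection \<open>Error probabilities of a Bayes test\<close>

lemma sets_PiM_some:
  assumes "B \<in> sets M"
  shows "{X \<in> space (\<Pi>\<^sub>M i\<in>{..<n::nat}. M). \<exists>i<n. X i \<in> B} \<in> sets (\<Pi>\<^sub>M i\<in>{..<n}. M)"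
proof -
  have "{X \<in> space (\<Pi>\<^sub>M i\<in>{..<n}. M). \<exists>i<n. X i \<in> B} =
      (\<Union>i\<in>{..<n}. (\<lambda>X. X i) -` B \<inter> space (\<Pi>\<^sub>M i\<in>{..<n}. M))" by auto
  also have "\<dots> \<in> sets (\<Pi>\<^sub>M i\<in>{..<n}. M)"
    using assms by (intro sets.finite_UN measurable_sets[OF measurable_component_singleton]) auto
  finally show ?thesis .
qed

text \<open>\<open>E n\<close> stands for the region where the \<open>h\<close>-family is selected.
  Both comparisons are weak, so ties may fall on either side and the complement is a test of the
  same kind with the families exchanged. Samples leaving \<open>W n\<close> are unconstrained: no
  default value of the Bayes factor has to be analysed there.\<close>

locale bayes_test = G: likelihood_family M \<pi> g W T \<kappa> \<tau> + H: likelihood_family M \<nu> h W U \<kappa> \<tau>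
  for M :: "real measure" and \<pi> :: "'c measure" and \<nu> :: "'d measure" and g h W T U \<kappa> \<tau> +
  fixes E :: "nat \<Rightarrow> (nat \<Rightarrow> real) set" and \<alpha> :: real
  assumes E_sets: "\<And>n. E n \<in> sets (\<Pi>\<^sub>M i\<in>{..<n}. M)"
    and E_compare: "\<forall>\<^sub>F n in sequentially. \<forall>X\<in>space (\<Pi>\<^sub>M i\<in>{..<n}. M). (\<forall>i<n. X i \<in> W n) \<longrightarrow>
      (X \<in> E n \<longrightarrow> mixture_lik \<pi> g n X \<le> mixture_lik \<nu> h n X) \<and>
      (X \<notin> E n \<longrightarrow> mixture_lik \<nu> h n X \<le> mixture_lik \<pi> g n X)"
    and \<alpha>_upper: "\<And>\<theta> \<gamma>. \<theta> \<in> space \<pi> \<Longrightarrow> \<gamma> \<in> space \<nu> \<Longrightarrow> min_affinity M (g \<theta>) (h \<gamma>) \<le> \<alpha>"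
    and \<alpha>_attained: "\<exists>\<theta>\<in>space \<pi>. \<exists>\<gamma>\<in>space \<nu>. min_affinity M (g \<theta>) (h \<gamma>) = \<alpha>"
    and \<alpha>_less_1: "\<alpha> < 1"
begin

lemma swap_bayes_test: "bayes_test M \<nu> \<pi> h g W U T \<kappa> \<tau> (\<lambda>n. space (\<Pi>\<^sub>M i\<in>{..<n}. M) - E n) \<alpha>"
proof unfold_locales
  show "\<exists>\<gamma>\<in>space \<nu>. \<exists>\<theta>\<in>space \<pi>. min_affinity M (h \<gamma>) (g \<theta>) = \<alpha>"
    using \<alpha>_attained min_affinity_commute by metis
  show "\<forall>\<^sub>F n in sequentially. \<forall>X\<in>space (\<Pi>\<^sub>M i\<in>{..<n}. M). (\<forall>i<n. X i \<in> W n) \<longrightarrow>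
      (X \<in> space (\<Pi>\<^sub>M i\<in>{..<n}. M) - E n \<longrightarrow> mixture_lik \<nu> h n X \<le> mixture_lik \<pi> g n X) \<and>
      (X \<notin> space (\<Pi>\<^sub>M i\<in>{..<n}. M) - E n \<longrightarrow> mixture_lik \<pi> g n X \<le> mixture_lik \<nu> h n X)"
    using E_compare by eventually_elim blast
qed (use E_sets \<alpha>_upper \<alpha>_less_1 min_affinity_commute in \<open>auto intro!: sets.compl_sets simp: min_affinity_commute\<close>)

lemma density_pair:
  assumes "\<theta> \<in> space \<pi>" "\<gamma> \<in> space \<nu>"
  shows "density_pair M (g \<theta>) (h \<gamma>)"
  using assms G.AE_pos H.AE_pos
  by (intro density_pairI G.sigma_finite_measure_axioms G.prob H.prob G.measurable_section H.measurable_section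
      G.nonneg H.nonneg AE_conjI) auto

lemma \<alpha>_pos: "0 < \<alpha>"
  using \<alpha>_attained density_pair density_pair.min_affinity_pos by metis

text \<open>Off the exceptional set, an error bounds the likelihood of \<open>\<theta>\<close> by
  \<open>\<kappa> n ^ 2\<close> times that of some net point: one factor leads from the likelihood
  to its mixture, one from the other mixture to its net. The third factor counts the net
  points.\<close>

lemma error_le:
  "\<forall>\<^sub>F n in sequentially. \<forall>\<theta>\<in>space \<pi>.
    emeasure (sample_law n M (g \<theta>)) (E n) \<le> ennreal (n * \<tau> n + \<kappa> n ^ 3 * \<alpha> ^ n)"
  using H.net G.sandwich H.sandwich G.exceptional E_compare
proof eventually_elim
  case (elim n)
  let ?P = "\<Pi>\<^sub>M i\<in>{..<n}. M"
  show ?case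
  proof
    fix \<theta> assume \<theta>: "\<theta> \<in> space \<pi>"
    \<comment> \<open>\<open>W n\<close> need not be measurable, so its complement is replaced by a
      measurable cover.\<close>
    obtain B where B: "B \<in> sets M" "space M - W n \<subseteq> B" "emeasure (law M (g \<theta>)) B \<le> ennreal (\<tau> n)"
      using elim(4) \<theta> by blast
    have "\<forall>\<gamma>\<in>space \<nu>. \<exists>z. 0 \<le> z \<and> z \<le> 1 \<and> affinity M (g \<theta>) (h \<gamma>) z = min_affinity M (g \<theta>) (h \<gamma>)"
      using density_pair[OF \<theta>] nonneg_integrable_pair.min_affinity_attained density_pair.axioms(1) by metis
    then obtain z where z: "\<And>\<gamma>. \<gamma> \<in> space \<nu> \<Longrightarrow> 0 \<le> z \<gamma>" "\<And>\<gamma>. \<gamma> \<in> space \<nu> \<Longrightarrow> z \<gamma> \<le> 1"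
      "\<And>\<gamma>. \<gamma> \<in> space \<nu> \<Longrightarrow> affinity M (g \<theta>) (h \<gamma>) (z \<gamma>) = min_affinity M (g \<theta>) (h \<gamma>)" by metis
    define A where "A = {X \<in> space ?P. \<exists>i<n. X i \<in> B}"
    have A: "A \<in> sets ?P" unfolding A_def by (rule sets_PiM_some[OF B(1)])
    have sp: "space (sample_law n M (g \<theta>)) = space ?P" "sets (sample_law n M (g \<theta>)) = sets ?P"
      unfolding G.sample_law_eq[OF \<theta>] by simp_all
    have "emeasure (sample_law n M (g \<theta>)) (E n) \<le> emeasure (sample_law n M (g \<theta>)) (A \<union> (E n - A))"
      using A E_sets sp by (intro emeasure_mono) auto
    also have "\<dots> \<le> emeasure (sample_law n M (g \<theta>)) A + emeasure (sample_law n M (g \<theta>)) (E n - A)"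
      using A E_sets sp by (intro emeasure_subadditive) auto
    also have "emeasure (sample_law n M (g \<theta>)) A \<le> ennreal (n * \<tau> n)"
      using emeasure_sample_law_some[OF G.prob[OF \<theta>] B(1,3), of n] unfolding sp A_def
      by (simp add: ennreal_mult' ennreal_of_nat_eq_real_of_nat)
    also have "emeasure (sample_law n M (g \<theta>)) (E n - A) =
        (\<integral>\<^sup>+X. ennreal (\<Prod>i<n. g \<theta> (X i)) * indicator (E n - A) X \<partial>?P)"
      using A E_sets by (intro G.emeasure_sample_law[OF \<theta>]) auto
    \<comment> \<open>The net point witnessing an error depends on the sample, so all candidates are
      summed, each with its own optimal exponent \<open>z \<gamma>\<close>.\<close>
    also have "\<dots> \<le> (\<integral>\<^sup>+X. (\<Sum>\<gamma>\<in>U n. ennreal (\<kappa> n ^ 2 * (\<Prod>i<n. g \<theta> (X i) powr (1 - z \<gamma>) * h \<gamma> (X i) powr z \<gamma>))) \<partial>?P)"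
    proof (rule nn_integral_mono)
      fix X assume X: "X \<in> space ?P"
      let ?m = "\<lambda>\<gamma>. \<kappa> n ^ 2 * (\<Prod>i<n. g \<theta> (X i) powr (1 - z \<gamma>) * h \<gamma> (X i) powr z \<gamma>)"
      show "ennreal (\<Prod>i<n. g \<theta> (X i)) * indicator (E n - A) X \<le> (\<Sum>\<gamma>\<in>U n. ennreal (?m \<gamma>))"
      proof (cases "X \<in> E n - A")
        case True
        then have good: "\<forall>i<n. X i \<in> W n" using X B(2) by (auto simp: A_def space_PiM PiE_def Pi_def)
        obtain \<gamma> where \<gamma>: "\<gamma> \<in> U n" "mixture_lik \<nu> h n X \<le> ennreal (\<kappa> n) * ennreal (\<Prod>i<n. h \<gamma> (X i))"
          using elim(3) X good by blast
        have \<gamma>': "\<gamma> \<in> space \<nu>" using \<gamma> elim(1) by blast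
        have hn: "0 \<le> (\<Prod>i<n. h \<gamma> (X i))" using H.nonneg[OF \<gamma>'] by (intro prod_nonneg) auto
        have "ennreal (\<Prod>i<n. g \<theta> (X i)) \<le> ennreal (\<kappa> n) * mixture_lik \<pi> g n X"
          using elim(2) X good \<theta> by blast
        also have "\<dots> \<le> ennreal (\<kappa> n) * mixture_lik \<nu> h n X"
          using elim(5) X good True by (intro mult_left_mono) auto
        also have "\<dots> \<le> ennreal (\<kappa> n) * (ennreal (\<kappa> n) * ennreal (\<Prod>i<n. h \<gamma> (X i)))"
          using \<gamma>(2) by (intro mult_left_mono) auto
        also have "\<dots> = ennreal (\<kappa> n ^ 2 * (\<Prod>i<n. h \<gamma> (X i)))"
          using G.\<kappa>_ge_1[of n] hn by (simp add: power2_eq_square ennreal_mult'[symmetric] mult.assoc)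
        finally have le: "(\<Prod>i<n. g \<theta> (X i)) \<le> \<kappa> n ^ 2 * (\<Prod>i<n. h \<gamma> (X i))"
          using hn by (subst (asm) ennreal_le_iff) auto
        have "(\<Prod>i<n. g \<theta> (X i)) \<le> ?m \<gamma>"
          using z[OF \<gamma>'] G.\<kappa>_ge_1[of n] le by (intro prod_le_powr_mix) (auto simp: G.nonneg[OF \<theta>] H.nonneg[OF \<gamma>'])
        then have "ennreal (\<Prod>i<n. g \<theta> (X i)) \<le> ennreal (?m \<gamma>)" by (rule ennreal_leI)
        also have "\<dots> \<le> (\<Sum>\<gamma>\<in>U n. ennreal (?m \<gamma>))"
          using \<gamma>(1) elim(1) by (intro member_le_sum) auto
        finally show ?thesis using True by simp
      qed simp
    qed
    also have "\<dots> = (\<Sum>\<gamma>\<in>U n. \<integral>\<^sup>+X. ennreal (\<kappa> n ^ 2 * (\<Prod>i<n. g \<theta> (X i) powr (1 - z \<gamma>) * h \<gamma> (X i) powr z \<gamma>)) \<partial>?P)"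
    proof (rule nn_integral_sum)
      fix \<gamma> assume "\<gamma> \<in> U n"
      then have \<gamma>: "\<gamma> \<in> space \<nu>" using elim(1) by blast
      interpret p: density_pair M "g \<theta>" "h \<gamma>" by (rule density_pair[OF \<theta> \<gamma>])
      show "(\<lambda>X. ennreal (\<kappa> n ^ 2 * (\<Prod>i<n. g \<theta> (X i) powr (1 - z \<gamma>) * h \<gamma> (X i) powr z \<gamma>))) \<in> borel_measurable ?P"
        by measurable
    qed
    also have "\<dots> \<le> (\<Sum>\<gamma>\<in>U n. ennreal (\<kappa> n ^ 2 * \<alpha> ^ n))"
    proof (rule sum_mono)
      fix \<gamma> assume "\<gamma> \<in> U n"
      then have \<gamma>: "\<gamma> \<in> space \<nu>" using elim(1) by blast
      interpret p: density_pair M "g \<theta>" "h \<gamma>" by (rule density_pair[OF \<theta> \<gamma>])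
      note i = p.integral_prod_mix[OF z(1,2)[OF \<gamma>], of n]
      have "(\<integral>\<^sup>+X. ennreal (\<kappa> n ^ 2 * (\<Prod>i<n. g \<theta> (X i) powr (1 - z \<gamma>) * h \<gamma> (X i) powr z \<gamma>)) \<partial>?P) =
          ennreal (LINT X|?P. \<kappa> n ^ 2 * (\<Prod>i<n. g \<theta> (X i) powr (1 - z \<gamma>) * h \<gamma> (X i) powr z \<gamma>))"
        using i(2) by (intro nn_integral_eq_integral integrable_mult_right AE_I2 mult_nonneg_nonneg prod_nonneg) auto
      also have "\<dots> = ennreal (\<kappa> n ^ 2 * affinity M (g \<theta>) (h \<gamma>) (z \<gamma>) ^ n)" using i by simp
      also have "\<dots> \<le> ennreal (\<kappa> n ^ 2 * \<alpha> ^ n)"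
        using \<alpha>_upper[OF \<theta> \<gamma>] p.min_affinity_pos unfolding z(3)[OF \<gamma>]
        by (intro ennreal_leI mult_left_mono power_mono) auto
      finally show "(\<integral>\<^sup>+X. ennreal (\<kappa> n ^ 2 * (\<Prod>i<n. g \<theta> (X i) powr (1 - z \<gamma>) * h \<gamma> (X i) powr z \<gamma>)) \<partial>?P)
          \<le> ennreal (\<kappa> n ^ 2 * \<alpha> ^ n)" .
    qed
    also have "\<dots> = ennreal (card (U n) * (\<kappa> n ^ 2 * \<alpha> ^ n))"
      by (simp add: ennreal_mult' ennreal_of_nat_eq_real_of_nat)
    also have "\<dots> \<le> ennreal (\<kappa> n * (\<kappa> n ^ 2 * \<alpha> ^ n))"
      using elim(1) \<alpha>_pos by (intro ennreal_leI mult_right_mono) auto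
    also have "ennreal (n * \<tau> n) + ennreal (\<kappa> n * (\<kappa> n ^ 2 * \<alpha> ^ n)) = ennreal (n * \<tau> n + \<kappa> n ^ 3 * \<alpha> ^ n)"
      using G.\<tau>_nonneg[of n] G.\<kappa>_ge_1[of n] \<alpha>_pos
      by (subst ennreal_plus[symmetric]) (auto simp: power3_eq_cube power2_eq_square mult.assoc)
    finally show "emeasure (sample_law n M (g \<theta>)) (E n) \<le> ennreal (n * \<tau> n + \<kappa> n ^ 3 * \<alpha> ^ n)"
      by (simp add: add_mono)
  qed
qed

text \<open>Weighting the \<open>g\<close>-likelihood by \<open>exp (n * \<delta>)\<close> makes the Bayes risk exponentially larger than
  \<open>\<alpha> ^ n\<close>, so that it cannot be accounted for by the error under \<open>h\<close> alone.\<close>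

lemma weighted_risk_ge:
  fixes \<delta> :: real
  assumes \<delta>: "0 < \<delta>" "\<delta> < - ln \<alpha>"
  obtains \<beta> where "\<alpha> < \<beta>" "\<forall>\<^sub>F n in sequentially. ennreal (\<beta> ^ n / 2) \<le> ennreal (n * \<tau> n) +
     ennreal (\<kappa> n) * (ennreal (exp (n * \<delta>)) * (\<integral>\<^sup>+\<theta>. emeasure (sample_law n M (g \<theta>)) (E n) \<partial>\<pi>) +
       (\<integral>\<^sup>+\<gamma>. emeasure (sample_law n M (h \<gamma>)) (space (\<Pi>\<^sub>M i\<in>{..<n}. M) - E n) \<partial>\<nu>))"
proof -
  obtain \<theta> \<gamma> where \<theta>: "\<theta> \<in> space \<pi>" and \<gamma>: "\<gamma> \<in> space \<nu>" and opt: "min_affinity M (g \<theta>) (h \<gamma>) = \<alpha>"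
    using \<alpha>_attained by blast
  interpret p: density_pair M "g \<theta>" "h \<gamma>" by (rule density_pair[OF \<theta> \<gamma>])
  let ?p = "\<lambda>x. exp \<delta> * g \<theta> x"
  interpret w: nonneg_integrable_pair M ?p "h \<gamma>"
    by unfold_locales (use p.integrable_p p.integrable_q p.nonneg_p p.nonneg_q in auto)
  have aff: "affinity M ?p (h \<gamma>) s = exp (\<delta> * (1 - s)) * affinity M (g \<theta>) (h \<gamma>) s" for s :: real
    unfolding affinity_def using p.nonneg_p
    by (simp add: powr_mult powr_def[of "exp \<delta>"] mult.assoc mult.commute[of _ \<delta>])
  obtain z where z: "0 \<le> z" "z \<le> 1"
    "\<And>s. s \<in> {0..1} \<Longrightarrow> affinity M ?p (h \<gamma>) z \<le> affinity M ?p (h \<gamma>) s"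
    using w.min_affinity_attained by metis
  obtain y where y: "0 \<le> y" "y \<le> 1" "affinity M (g \<theta>) (h \<gamma>) y = \<alpha>"
    using p.min_affinity_attained opt by metis
  define J where "J = affinity M ?p (h \<gamma>) z"
  have "J \<le> exp (\<delta> * (1 - y)) * \<alpha>" using z(3)[of y] y aff[of y] by (simp add: J_def)
  also have "\<dots> \<le> exp \<delta> * \<alpha>" using \<delta> y \<alpha>_pos by (intro mult_right_mono) auto
  also have "\<dots> < 1"
  proof -
    have "\<alpha> = exp (ln \<alpha>)" using \<alpha>_pos by simp
    then have "exp \<delta> * \<alpha> = exp (\<delta> + ln \<alpha>)" by (simp add: exp_add)
    also have "\<dots> < 1" using \<delta> by simp
    finally show ?thesis .
  qed
  finally have J1: "J < 1" .
  have "z \<noteq> 0"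
  proof
    assume "z = 0"
    then have "J = exp \<delta>" using aff[of 0] p.affinity_0 by (simp add: J_def)
    then show False using J1 \<delta> by simp
  qed
  moreover have "z \<noteq> 1"
  proof
    assume "z = 1"
    then have "J = 1" using aff[of 1] p.affinity_1 by (simp add: J_def)
    then show False using J1 by simp
  qed
  ultimately have z01: "0 < z" "z < 1" using z by auto
  have "\<alpha> \<le> affinity M (g \<theta>) (h \<gamma>) z" using p.min_affinity_le[OF z(1,2)] opt by simp
  moreover have "1 < exp (\<delta> * (1 - z))" using \<delta> z01 by simp
  ultimately have J\<alpha>: "\<alpha> < J" unfolding J_def aff
    using \<alpha>_pos by (metis less_le_trans mult_less_cancel_right1 order.strict_trans2 mult.commute not_less)
  have J: "0 < J" using J\<alpha> \<alpha>_pos by simp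
  \<comment> \<open>Half the logarithmic gap, so that \<open>\<beta>\<close> is the geometric mean
    of \<alpha> and \<open>J\<close>; the loss \<open>exp (- (n * e))\<close> of the risk bound then
    still leaves a rate strictly above \<alpha>.\<close>
  define e where "e = (ln J - ln \<alpha>) / 2"
  have e: "0 < e" using J\<alpha> J \<alpha>_pos by (simp add: e_def)
  define \<beta> where "\<beta> = J * exp (- e)"
  have \<beta>: "\<alpha> < \<beta>"
  proof -
    have "ln \<alpha> < ln J - e" using J\<alpha> J \<alpha>_pos by (simp add: e_def field_simps)
    then have "exp (ln \<alpha>) < exp (ln J - e)" by simp
    then show ?thesis using J \<alpha>_pos by (simp add: \<beta>_def exp_diff exp_minus field_simps)
  qed
  have ev: "\<forall>\<^sub>F n in sequentially. J ^ n * exp (- (n * e)) / 2 \<le>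
     (LINT X|(\<Pi>\<^sub>M i\<in>{..<n}. M). min (\<Prod>i<n. ?p (X i)) (\<Prod>i<n. h \<gamma> (X i)))"
    unfolding J_def using z z01 J e by (intro w.eventually_integral_min_ge) (auto simp: J_def)
  show thesis
  proof (rule that[OF \<beta>])
    show "\<forall>\<^sub>F n in sequentially. ennreal (\<beta> ^ n / 2) \<le> ennreal (n * \<tau> n) +
       ennreal (\<kappa> n) * (ennreal (exp (n * \<delta>)) * (\<integral>\<^sup>+\<theta>. emeasure (sample_law n M (g \<theta>)) (E n) \<partial>\<pi>) +
         (\<integral>\<^sup>+\<gamma>. emeasure (sample_law n M (h \<gamma>)) (space (\<Pi>\<^sub>M i\<in>{..<n}. M) - E n) \<partial>\<nu>))"
      using ev G.sandwich H.sandwich H.exceptional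
    proof eventually_elim
      case (elim n)
      let ?P = "\<Pi>\<^sub>M i\<in>{..<n}. M"
      let ?E' = "space ?P - E n"
      interpret PM: product_sigma_finite "\<lambda>_::nat. M" by unfold_locales
      obtain B where B: "B \<in> sets M" "space M - W n \<subseteq> B" "emeasure (law M (h \<gamma>)) B \<le> ennreal (\<tau> n)"
        using elim(4) \<gamma> by blast
      define A where "A = {X \<in> space ?P. \<exists>i<n. X i \<in> B}"
      have A: "A \<in> sets ?P" unfolding A_def by (rule sets_PiM_some[OF B(1)])
      have [measurable]: "E n \<in> sets ?P" "?E' \<in> sets ?P" "A \<in> sets ?P" using E_sets A by auto
      note [measurable] = H.measurable_lik_section[OF \<gamma>]
      have pr: "(\<Prod>i<n. ?p (X i)) = exp (n * \<delta>) * (\<Prod>i<n. g \<theta> (X i))" for X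
        by (simp add: prod.distrib exp_of_nat_mult)
      have gn: "0 \<le> (\<Prod>i<n. g \<theta> (X i))" "0 \<le> (\<Prod>i<n. h \<gamma> (X i))" for X
        using p.nonneg_p p.nonneg_q by (auto intro: prod_nonneg)
      have "J ^ n * exp (- (n * e)) = \<beta> ^ n"
        by (simp add: \<beta>_def power_mult_distrib exp_of_nat_mult[symmetric])
      then have "ennreal (\<beta> ^ n / 2) \<le> ennreal (LINT X|?P. min (\<Prod>i<n. ?p (X i)) (\<Prod>i<n. h \<gamma> (X i)))"
        using elim(1) by (intro ennreal_leI) simp
      also have "\<dots> = (\<integral>\<^sup>+X. ennreal (min (\<Prod>i<n. ?p (X i)) (\<Prod>i<n. h \<gamma> (X i))) \<partial>?P)"
      proof (intro nn_integral_eq_integral[symmetric] integrable_min)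
        show "integrable ?P (\<lambda>X. \<Prod>i<n. ?p (X i))" by (rule PM.product_integrable_prod) (auto simp: p.integrable_p)
        show "integrable ?P (\<lambda>X. \<Prod>i<n. h \<gamma> (X i))" by (rule PM.product_integrable_prod) (auto simp: p.integrable_q)
        show "AE X in ?P. 0 \<le> min (\<Prod>i<n. ?p (X i)) (\<Prod>i<n. h \<gamma> (X i))" unfolding pr using gn by auto
      qed
      \<comment> \<open>The minimum is bounded by the likelihood belonging to the error actually
        made: the weighted one on \<open>E n\<close>, that of \<open>h\<close> off it. On the
        exceptional set \<open>h\<close> is used throughout, since its mass there is at most
        \<open>n * \<tau> n\<close>.\<close>
      also have "\<dots> \<le> (\<integral>\<^sup>+X. ennreal (\<Prod>i<n. h \<gamma> (X i)) * indicator A X + ennreal (\<kappa> n) *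
          (ennreal (exp (n * \<delta>)) * (mixture_lik \<pi> g n X * indicator (E n) X) + mixture_lik \<nu> h n X * indicator ?E' X) \<partial>?P)"
      proof (rule nn_integral_mono)
        fix X assume X: "X \<in> space ?P"
        let ?r = "ennreal (\<kappa> n) * (ennreal (exp (n * \<delta>)) * (mixture_lik \<pi> g n X * indicator (E n) X) + mixture_lik \<nu> h n X * indicator ?E' X)"
        show "ennreal (min (\<Prod>i<n. ?p (X i)) (\<Prod>i<n. h \<gamma> (X i))) \<le> ennreal (\<Prod>i<n. h \<gamma> (X i)) * indicator A X + ?r"
        proof (cases "X \<in> A")
          case True
          have "ennreal (min (\<Prod>i<n. ?p (X i)) (\<Prod>i<n. h \<gamma> (X i))) \<le> ennreal (\<Prod>i<n. h \<gamma> (X i))"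
            by (intro ennreal_leI) simp
          then show ?thesis using True by (simp add: add_increasing2)
        next
          case False
          then have good: "\<forall>i<n. X i \<in> W n" using X B(2) by (auto simp: A_def space_PiM PiE_def Pi_def)
          have sg: "ennreal (\<Prod>i<n. g \<theta> (X i)) \<le> \<kappa> n * mixture_lik \<pi> g n X" using elim(2) X good \<theta> by blast
          have sh: "ennreal (\<Prod>i<n. h \<gamma> (X i)) \<le> \<kappa> n * mixture_lik \<nu> h n X" using elim(3) X good \<gamma> by blast
          show ?thesis
          proof (cases "X \<in> E n")
            case True
            have "ennreal (min (\<Prod>i<n. ?p (X i)) (\<Prod>i<n. h \<gamma> (X i))) \<le> ennreal (exp (n * \<delta>)) * ennreal (\<Prod>i<n. g \<theta> (X i))"
              unfolding pr using gn by (subst ennreal_mult'[symmetric]) (auto intro: ennreal_leI)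
            also have "\<dots> \<le> ennreal (exp (n * \<delta>)) * (\<kappa> n * mixture_lik \<pi> g n X)" using sg by (rule mult_left_mono) simp
            finally show ?thesis using True False by (simp add: mult.left_commute)
          next
            case notE: False
            have "ennreal (min (\<Prod>i<n. ?p (X i)) (\<Prod>i<n. h \<gamma> (X i))) \<le> ennreal (\<Prod>i<n. h \<gamma> (X i))"
              by (intro ennreal_leI) simp
            then show ?thesis using notE False X sh by simp
          qed
        qed
      qed
      also have "\<dots> = (\<integral>\<^sup>+X. ennreal (\<Prod>i<n. h \<gamma> (X i)) * indicator A X \<partial>?P) + ennreal (\<kappa> n) *
          (ennreal (exp (n * \<delta>)) * (\<integral>\<^sup>+X. mixture_lik \<pi> g n X * indicator (E n) X \<partial>?P) +
            (\<integral>\<^sup>+X. mixture_lik \<nu> h n X * indicator ?E' X \<partial>?P))"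
        by (simp add: nn_integral_add nn_integral_cmult)
      also have "(\<integral>\<^sup>+X. ennreal (\<Prod>i<n. h \<gamma> (X i)) * indicator A X \<partial>?P) = emeasure (sample_law n M (h \<gamma>)) A"
        using A by (intro H.emeasure_sample_law[OF \<gamma>, symmetric])
      also have "\<dots> \<le> ennreal (n * \<tau> n)"
        using emeasure_sample_law_some[OF H.prob[OF \<gamma>] B(1,3), of n] unfolding A_def H.sample_law_eq[OF \<gamma>]
        by (simp add: ennreal_mult' ennreal_of_nat_eq_real_of_nat)
      also have "(\<integral>\<^sup>+X. mixture_lik \<pi> g n X * indicator (E n) X \<partial>?P) = (\<integral>\<^sup>+\<theta>. emeasure (sample_law n M (g \<theta>)) (E n) \<partial>\<pi>)"
        by (rule G.measurable_emeasure_sample_law(2)[symmetric]) simp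
      also have "(\<integral>\<^sup>+X. mixture_lik \<nu> h n X * indicator ?E' X \<partial>?P) = (\<integral>\<^sup>+\<gamma>. emeasure (sample_law n M (h \<gamma>)) ?E' \<partial>\<nu>)"
        by (rule H.measurable_emeasure_sample_law(2)[symmetric]) simp
      finally show ?case by (simp add: add_mono)
    qed
  qed
qed

end

section \<open>From exponential bounds to decay rates\<close>

lemma asymp_equiv_linear_rate:
  fixes f :: "nat \<Rightarrow> real" and \<rho> :: real
  assumes "0 < \<rho>"
    and lower: "\<And>\<epsilon>::real. 0 < \<epsilon> \<Longrightarrow> \<forall>\<^sub>F n in sequentially. - (n * (\<rho> + \<epsilon>)) \<le> f n"
    and upper: "\<And>\<epsilon>::real. 0 < \<epsilon> \<Longrightarrow> \<forall>\<^sub>F n in sequentially. f n \<le> - (n * (\<rho> - \<epsilon>))"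
  shows "f \<sim>[sequentially] (\<lambda>n. - (real n * \<rho>))"
proof (rule asymp_equivI')
  show "(\<lambda>n. f n / - (real n * \<rho>)) \<longlonglongrightarrow> 1"
  proof (rule LIMSEQ_I)
    fix r :: real assume r: "0 < r"
    define \<epsilon> where "\<epsilon> = r * \<rho> / 2"
    have \<epsilon>: "0 < \<epsilon>" using r assms(1) by (simp add: \<epsilon>_def)
    have "\<forall>\<^sub>F n in sequentially. norm (f n / - (real n * \<rho>) - 1) < r"
      using lower[OF \<epsilon>] upper[OF \<epsilon>] eventually_gt_at_top[of 0]
    proof eventually_elim
      case (elim n)
      have np: "0 < real n * \<rho>" using elim(3) assms(1) by simp
      have "f n / - (real n * \<rho>) - 1 = (- f n - n * \<rho>) / (n * \<rho>)" using assms(1) elim(3) by (simp add: diff_divide_distrib)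
      then have "norm (f n / - (real n * \<rho>) - 1) = \<bar>- f n - n * \<rho>\<bar> / (n * \<rho>)"
        using np by (simp only: real_norm_def abs_divide abs_of_pos)
      also have "\<dots> \<le> n * \<epsilon> / (n * \<rho>)"
        using elim np by (intro divide_right_mono) (auto simp: distrib_left right_diff_distrib abs_le_iff)
      also have "\<dots> < r" using elim(3) assms(1) r by (simp add: \<epsilon>_def)
      finally show ?case .
    qed
    then show "\<exists>no. \<forall>n\<ge>no. norm (f n / - (real n * \<rho>) - 1) < r" by (simp add: eventually_sequentially)
  qed
qed

lemma eventually_exp_linear_ge:
  assumes "0 < (c::real)"
  shows "\<forall>\<^sub>F n in sequentially. C \<le> exp (c * real n)"
proof -
  have "filterlim (\<lambda>n. exp (c * real n)) at_top sequentially"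
    using assms by (intro filterlim_compose[OF exp_at_top] filterlim_tendsto_pos_mult_at_top[OF tendsto_const] filterlim_real_sequentially) auto
  then show ?thesis by (simp add: filterlim_at_top)
qed

text \<open>Here \<open>x = exp (c * n)\<close> bounds \<open>\<kappa> n\<close>. In units of
  \<open>\<alpha> ^ n\<close> the remainders of the risk bound are 1, \<open>x\<close> and
  \<open>x ^ 4\<close>; the eighth power, being the square of \<open>x ^ 4\<close>, absorbs them and
  leaves a spare \<open>x\<close> to cancel the \<open>\<kappa> n\<close> in front of the error
  sought.\<close>

lemma power_8_dominates:
  fixes x :: real
  assumes "4 \<le> x"
  shows "x \<le> x ^ 8 / 2 - 1 - x - x ^ 4"
proof -
  define w where "w = x ^ 4"
  have "4 ^ 4 \<le> w" unfolding w_def using assms by (intro power_mono) auto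
  then have w: "256 \<le> w" by simp
  have "x \<le> w" unfolding w_def using assms by (intro self_le_power) auto
  moreover have "256 * w \<le> w * w" using w by (intro mult_right_mono) auto
  moreover have "x ^ 8 = w * w" by (simp add: w_def flip: power_add)
  ultimately show ?thesis using w unfolding w_def[symmetric] by linarith
qed

context bayes_test
begin

definition err :: "nat \<Rightarrow> 'c \<Rightarrow> real" where
  "err n \<theta> = measure (sample_law n M (g \<theta>)) (E n)"

definition \<rho> :: real where "\<rho> = - ln \<alpha>"

lemma \<rho>_pos: "0 < \<rho>" using \<alpha>_less_1 \<alpha>_pos by (simp add: \<rho>_def)

lemma \<alpha>_power: "\<alpha> ^ n = exp (- (n * \<rho>))"
proof -
  have "\<alpha> ^ n = exp (ln \<alpha>) ^ n" using \<alpha>_pos by simp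
  also have "\<dots> = exp (- (n * \<rho>))" unfolding exp_of_nat_mult[symmetric] by (simp add: \<rho>_def)
  finally show ?thesis .
qed

lemma emeasure_eq_err: "\<theta> \<in> space \<pi> \<Longrightarrow> emeasure (sample_law n M (g \<theta>)) (E n) = ennreal (err n \<theta>)"
proof -
  assume \<theta>: "\<theta> \<in> space \<pi>"
  interpret S: prob_space "sample_law n M (g \<theta>)" by (rule G.prob_space_sample_law[OF \<theta>])
  show ?thesis unfolding err_def by (rule S.emeasure_eq_measure)
qed

lemma err_nonneg: "0 \<le> err n \<theta>" by (simp add: err_def)

lemma err_le_1: "\<theta> \<in> space \<pi> \<Longrightarrow> err n \<theta> \<le> 1"
  unfolding err_def using G.prob_space_sample_law prob_space.prob_le_1 by blast

lemma measurable_err [measurable]: "err n \<in> borel_measurable \<pi>"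
proof -
  have "(\<lambda>\<theta>. enn2real (emeasure (sample_law n M (g \<theta>)) (E n))) \<in> borel_measurable \<pi>"
    using G.measurable_emeasure_sample_law(1)[OF E_sets] by measurable
  then show ?thesis by (simp add: err_def[abs_def] measure_def)
qed

lemma integrable_err: "integrable \<pi> (err n)"
  by (rule G.\<pi>.integrable_const_bound[where B = 1]) (auto simp: err_nonneg err_le_1)

lemma nn_integral_err: "(\<integral>\<^sup>+\<theta>. emeasure (sample_law n M (g \<theta>)) (E n) \<partial>\<pi>) = ennreal (LINT \<theta>|\<pi>. err n \<theta>)"
  using nn_integral_eq_integral[OF integrable_err] by (simp add: emeasure_eq_err err_nonneg cong: nn_integral_cong)

lemma integral_err_le: "(\<And>\<theta>. \<theta> \<in> space \<pi> \<Longrightarrow> err n \<theta> \<le> c) \<Longrightarrow> (LINT \<theta>|\<pi>. err n \<theta>) \<le> c"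
  using integrable_err by (intro G.\<pi>.integral_le_const) auto

lemma err_le: "\<forall>\<^sub>F n in sequentially. \<forall>\<theta>\<in>space \<pi>. err n \<theta> \<le> n * \<tau> n + \<kappa> n ^ 3 * \<alpha> ^ n"
  using error_le
proof eventually_elim
  case (elim n)
  show ?case
  proof
    fix \<theta> assume "\<theta> \<in> space \<pi>"
    then have "ennreal (err n \<theta>) \<le> ennreal (n * \<tau> n + \<kappa> n ^ 3 * \<alpha> ^ n)"
      using elim by (simp add: emeasure_eq_err)
    then show "err n \<theta> \<le> n * \<tau> n + \<kappa> n ^ 3 * \<alpha> ^ n"
      using G.\<tau>_nonneg[of n] G.\<kappa>_ge_1[of n] \<alpha>_pos by (subst (asm) ennreal_le_iff) auto
  qed
qed

lemma err_upper:
  fixes \<epsilon> :: real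
  assumes "0 < \<epsilon>"
  shows "\<forall>\<^sub>F n in sequentially. \<forall>\<theta>\<in>space \<pi>. err n \<theta> \<le> exp (- (n * (\<rho> - \<epsilon>)))"
proof -
  \<comment> \<open>Three quarters of \<epsilon> pay for \<open>\<kappa> n ^ 3\<close>, the last
    quarter for a factor 2 that absorbs the exceptional term \<open>n * \<tau> n\<close>.\<close>
  define c where "c = \<epsilon> / 4"
  have c: "0 < c" using assms by (simp add: c_def)
  show ?thesis
    using err_le G.\<kappa>_subexp[OF c] G.\<tau>_superexp[of \<rho>] eventually_exp_linear_ge[OF c, of 2]
  proof eventually_elim
    case (elim n)
    let ?x = "exp (c * n)"
    have "\<kappa> n ^ 3 \<le> ?x ^ 3" using elim(2) G.\<kappa>_ge_1[of n] by (intro power_mono) auto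
    moreover have "1 \<le> ?x ^ 3" using c by (intro one_le_power) simp
    moreover have "?x ^ 3 * 2 \<le> ?x ^ 3 * ?x" using elim(4) by (intro mult_left_mono) auto
    ultimately have "1 + \<kappa> n ^ 3 \<le> ?x ^ 3 * ?x" by linarith
    also have "\<dots> = exp (n * \<epsilon>)" by (simp add: c_def mult.commute flip: exp_of_nat_mult exp_add)
    finally have "(1 + \<kappa> n ^ 3) * exp (- (n * \<rho>)) \<le> exp (n * \<epsilon>) * exp (- (n * \<rho>))" by (intro mult_right_mono) auto
    moreover have "\<dots> = exp (- (n * (\<rho> - \<epsilon>)))" by (simp add: algebra_simps flip: exp_add)
    moreover have "n * \<tau> n + \<kappa> n ^ 3 * \<alpha> ^ n \<le> (1 + \<kappa> n ^ 3) * exp (- (n * \<rho>))"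
      using elim(3) by (simp add: \<alpha>_power algebra_simps)
    ultimately show ?case using elim(1) by fastforce
  qed
qed

lemma integral_err_lower:
  fixes \<epsilon> :: real
  assumes "0 < \<epsilon>"
  shows "\<forall>\<^sub>F n in sequentially. exp (- (n * (\<rho> + \<epsilon>))) \<le> (LINT \<theta>|\<pi>. err n \<theta>)"
proof -
  interpret S: bayes_test M \<nu> \<pi> h g W U T \<kappa> \<tau> "\<lambda>n. space (\<Pi>\<^sub>M i\<in>{..<n}. M) - E n" \<alpha>
    by (rule swap_bayes_test)
  \<comment> \<open>The cap \<open>\<rho> / 2\<close> keeps \<delta> admissible for the weighted
    risk bound when \<epsilon> is large.\<close>
  define \<delta> where "\<delta> = min \<epsilon> (\<rho> / 2)"
  have \<delta>: "0 < \<delta>" "\<delta> < - ln \<alpha>" "\<delta> \<le> \<epsilon>" using assms \<rho>_pos by (auto simp: \<delta>_def \<rho>_def)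
  obtain \<beta> where \<beta>: "\<alpha> < \<beta>" "\<forall>\<^sub>F n in sequentially. ennreal (\<beta> ^ n / 2) \<le> ennreal (n * \<tau> n) +
     ennreal (\<kappa> n) * (ennreal (exp (n * \<delta>)) * (\<integral>\<^sup>+\<theta>. emeasure (sample_law n M (g \<theta>)) (E n) \<partial>\<pi>) +
       (\<integral>\<^sup>+\<gamma>. emeasure (sample_law n M (h \<gamma>)) (space (\<Pi>\<^sub>M i\<in>{..<n}. M) - E n) \<partial>\<nu>))"
    using weighted_risk_ge[OF \<delta>(1,2)] by blast
  \<comment> \<open>One eighth of the logarithmic gap, so that \<open>\<beta> ^ n\<close> is
    \<open>\<alpha> ^ n\<close> times the eighth power of an eventual bound for
    \<open>\<kappa> n\<close>.\<close>
  define c where "c = (ln \<beta> - ln \<alpha>) / 8"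
  have c: "0 < c" using \<beta>(1) \<alpha>_pos by (simp add: c_def)
  have \<beta>_power: "\<beta> ^ n = \<alpha> ^ n * exp (c * n) ^ 8" for n
  proof -
    have "8 * c = ln \<beta> - ln \<alpha>" by (simp add: c_def)
    then have "ln \<alpha> + 8 * c = ln \<beta>" by linarith
    then have "\<beta> = exp (ln \<alpha> + 8 * c)" using \<beta>(1) \<alpha>_pos by simp
    also have "\<dots> = \<alpha> * exp (8 * c)" using \<alpha>_pos by (simp add: exp_add)
    finally have "\<beta> ^ n = \<alpha> ^ n * exp (8 * c) ^ n" by (simp add: power_mult_distrib)
    also have "exp (8 * c) ^ n = exp (c * n) ^ 8" by (simp add: algebra_simps flip: exp_of_nat_mult)
    finally show ?thesis .
  qed
  show ?thesis
    using \<beta>(2) S.err_le G.\<kappa>_subexp[OF c] G.\<tau>_superexp[of \<rho>] eventually_exp_linear_ge[OF c, of 4]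
  proof eventually_elim
    case (elim n)
    let ?x = "exp (c * n)" and ?a = "LINT \<theta>|\<pi>. err n \<theta>" and ?b = "LINT \<gamma>|\<nu>. S.err n \<gamma>"
    have ab: "0 \<le> ?a" "0 \<le> ?b" by (simp_all add: err_nonneg S.err_nonneg)
    have \<tau>: "0 \<le> n * \<tau> n" "n * \<tau> n \<le> \<alpha> ^ n" using G.\<tau>_nonneg[of n] elim(4) by (simp_all add: \<alpha>_power mult.commute)
    have \<kappa>: "1 \<le> \<kappa> n" "\<kappa> n \<le> ?x" using G.\<kappa>_ge_1[of n] elim(3) by auto
    have "ennreal (\<beta> ^ n / 2) \<le> ennreal (n * \<tau> n + \<kappa> n * (exp (n * \<delta>) * ?a + ?b))"
      using elim(1) ab \<tau>(1) \<kappa>(1) unfolding nn_integral_err S.nn_integral_err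
      by (simp add: ennreal_mult'[symmetric] ennreal_plus[symmetric] del: ennreal_plus)
    then have "\<beta> ^ n / 2 \<le> n * \<tau> n + \<kappa> n * (exp (n * \<delta>) * ?a + ?b)"
      using ab \<tau>(1) \<kappa>(1) by (subst (asm) ennreal_le_iff) auto
    \<comment> \<open>The error under \<open>h\<close> obeys the upper bound of the exchanged test;
      multiplied by \<open>\<kappa> n\<close> it costs at most a fourth power of
      \<open>\<kappa> n\<close>, still short of the eighth power available.\<close>
    moreover have "?b \<le> n * \<tau> n + \<kappa> n ^ 3 * \<alpha> ^ n" using elim(2) by (intro S.integral_err_le) auto
    then have "\<kappa> n * ?b \<le> \<kappa> n * (\<alpha> ^ n + \<kappa> n ^ 3 * \<alpha> ^ n)" using \<kappa>(1) \<tau>(2) by (intro mult_left_mono) auto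
    moreover have "\<dots> = \<alpha> ^ n * (\<kappa> n + \<kappa> n ^ 4)" by (simp add: algebra_simps power4_eq_xxxx power3_eq_cube)
    moreover have "\<dots> \<le> \<alpha> ^ n * (?x + ?x ^ 4)"
      using \<kappa> \<alpha>_pos by (intro mult_left_mono add_mono power_mono) auto
    ultimately have 1: "\<alpha> ^ n * ?x ^ 8 / 2 \<le> \<alpha> ^ n + \<alpha> ^ n * (?x + ?x ^ 4) + \<kappa> n * (exp (n * \<delta>) * ?a)"
      using \<tau>(2) unfolding \<beta>_power by (simp only: distrib_left)
    have 2: "\<kappa> n * (exp (n * \<delta>) * ?a) \<le> ?x * (exp (n * \<delta>) * ?a)"
      using \<kappa> ab by (intro mult_right_mono) auto
    have "\<alpha> ^ n * (?x ^ 8 / 2 - 1 - ?x - ?x ^ 4) = \<alpha> ^ n * ?x ^ 8 / 2 - \<alpha> ^ n - \<alpha> ^ n * (?x + ?x ^ 4)"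
      by (simp add: algebra_simps)
    then have 3: "\<alpha> ^ n * (?x ^ 8 / 2 - 1 - ?x - ?x ^ 4) \<le> ?x * (exp (n * \<delta>) * ?a)"
      using 1 2 by linarith
    have 4: "\<alpha> ^ n * ?x \<le> \<alpha> ^ n * (?x ^ 8 / 2 - 1 - ?x - ?x ^ 4)"
      using \<alpha>_pos power_8_dominates[OF elim(5)] by (intro mult_left_mono) auto
    have "?x * \<alpha> ^ n \<le> ?x * (exp (n * \<delta>) * ?a)"
      using order_trans[OF 4 3] by (simp only: mult.commute[of ?x "\<alpha> ^ n"])
    then have "exp (- (n * \<rho>)) \<le> exp (n * \<delta>) * ?a" by (simp add: \<alpha>_power)
    then have "exp (- (n * \<delta>)) * exp (- (n * \<rho>)) \<le> exp (- (n * \<delta>)) * (exp (n * \<delta>) * ?a)"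
      by (intro mult_left_mono) auto
    also have "\<dots> = ?a" by (simp add: exp_minus)
    finally have "exp (- (n * \<delta>) - n * \<rho>) \<le> ?a" unfolding exp_add[symmetric] by simp
    moreover have "exp (- (n * (\<rho> + \<epsilon>))) \<le> exp (- (n * \<delta>) - n * \<rho>)"
      using mult_left_mono[OF \<delta>(3), of "real n"] by (simp add: distrib_left)
    ultimately show ?case by linarith
  qed
qed

text \<open>Needed because \<open>ln 0 = 0\<close>: a vanishing error probability would spoil the supremum of the
  logarithms.\<close>

lemma err_pos: "\<forall>\<^sub>F n in sequentially. \<forall>\<theta>\<in>space \<pi>. 0 < err n \<theta>"
  using integral_err_lower[of 1, OF zero_less_one]
proof eventually_elim
  case (elim n)
  show ?case
  proof (rule ballI, rule ccontr)
    fix \<theta> assume \<theta>: "\<theta> \<in> space \<pi>" and "\<not> 0 < err n \<theta>"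
    then have "err n \<theta> = 0" using err_nonneg[of n \<theta>] by simp
    \<comment> \<open>A zero error at one parameter makes \<open>E n\<close> null for the base
      measure, hence for every sample law, against the positive average.\<close>
    then have "emeasure (\<Pi>\<^sub>M i\<in>{..<n}. M) (E n) = 0"
      using G.sample_law_null_iff[OF \<theta> E_sets[of n]] emeasure_eq_err[OF \<theta>, of n] by simp
    then have "err n \<theta>' \<le> 0" if "\<theta>' \<in> space \<pi>" for \<theta>'
      using G.sample_law_null_iff[OF that E_sets[of n]] emeasure_eq_err[OF that, of n] err_nonneg[of n \<theta>'] by simp
    then have "(LINT \<theta>|\<pi>. err n \<theta>) \<le> 0" by (rule integral_err_le)
    then show False using elim exp_gt_zero[of "- (n * (\<rho> + 1))"] by linarith
  qed
qed

lemma ln_integral_err_rate: "(\<lambda>n. ln (LINT \<theta>|\<pi>. err n \<theta>)) \<sim>[sequentially] (\<lambda>n. - (real n * \<rho>))"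
proof (rule asymp_equiv_linear_rate[OF \<rho>_pos])
  fix \<epsilon> :: real assume \<epsilon>: "0 < \<epsilon>"
  show "\<forall>\<^sub>F n in sequentially. - (n * (\<rho> + \<epsilon>)) \<le> ln (LINT \<theta>|\<pi>. err n \<theta>)"
    using integral_err_lower[OF \<epsilon>]
    by eventually_elim (metis exp_gt_zero less_le_trans ln_ge_iff)
  show "\<forall>\<^sub>F n in sequentially. ln (LINT \<theta>|\<pi>. err n \<theta>) \<le> - (n * (\<rho> - \<epsilon>))"
    using integral_err_lower[OF \<epsilon>] err_upper[OF \<epsilon>]
  proof eventually_elim
    case (elim n)
    have "0 < (LINT \<theta>|\<pi>. err n \<theta>)" using elim(1) by (rule less_le_trans[OF exp_gt_zero])
    moreover have "(LINT \<theta>|\<pi>. err n \<theta>) \<le> exp (- (n * (\<rho> - \<epsilon>)))" using elim(2) by (intro integral_err_le) auto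
    ultimately show ?case by (metis exp_gt_zero ln_exp ln_le_cancel_iff)
  qed
qed

lemma SUP_ln_err_rate: "(\<lambda>n. SUP \<theta>\<in>space \<pi>. ln (err n \<theta>)) \<sim>[sequentially] (\<lambda>n. - (real n * \<rho>))"
proof (rule asymp_equiv_linear_rate[OF \<rho>_pos])
  fix \<epsilon> :: real assume \<epsilon>: "0 < \<epsilon>"
  show "\<forall>\<^sub>F n in sequentially. (SUP \<theta>\<in>space \<pi>. ln (err n \<theta>)) \<le> - (n * (\<rho> - \<epsilon>))"
    using err_pos err_upper[OF \<epsilon>]
  proof eventually_elim
    case (elim n)
    show ?case
    proof (rule cSUP_least[OF G.\<pi>.not_empty])
      fix \<theta> assume "\<theta> \<in> space \<pi>"
      then show "ln (err n \<theta>) \<le> - (n * (\<rho> - \<epsilon>))"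
        using elim by (metis exp_gt_zero ln_exp ln_le_cancel_iff)
    qed
  qed
  show "\<forall>\<^sub>F n in sequentially. - (n * (\<rho> + \<epsilon>)) \<le> (SUP \<theta>\<in>space \<pi>. ln (err n \<theta>))"
    \<comment> \<open>With half of \<epsilon> the average lies strictly above the target value, so
      some parameter must reach that value.\<close>
    using integral_err_lower[OF half_gt_zero[OF \<epsilon>]] err_pos eventually_gt_at_top[of 0]
  proof eventually_elim
    case (elim n)
    have "\<exists>\<theta>\<in>space \<pi>. exp (- (n * (\<rho> + \<epsilon>))) \<le> err n \<theta>"
    proof (rule ccontr)
      assume "\<not> ?thesis"
      then have "(LINT \<theta>|\<pi>. err n \<theta>) \<le> exp (- (n * (\<rho> + \<epsilon>)))" by (intro integral_err_le) auto
      also have "n * (\<rho> + \<epsilon> / 2) < n * (\<rho> + \<epsilon>)" using \<epsilon> elim(3) by (intro mult_strict_left_mono) auto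
      then have "exp (- (n * (\<rho> + \<epsilon>))) < exp (- (n * (\<rho> + \<epsilon> / 2)))" by simp
      finally show False using elim(1) by simp
    qed
    then obtain \<theta> where \<theta>: "\<theta> \<in> space \<pi>" "exp (- (n * (\<rho> + \<epsilon>))) \<le> err n \<theta>" by blast
    then have "- (n * (\<rho> + \<epsilon>)) \<le> ln (err n \<theta>)"
      by (metis exp_gt_zero less_le_trans ln_ge_iff)
    also have "\<dots> \<le> (SUP \<theta>\<in>space \<pi>. ln (err n \<theta>))"
    proof (rule cSUP_upper[OF \<theta>(1)], rule bdd_aboveI2)
      fix \<theta>' assume "\<theta>' \<in> space \<pi>"
      then show "ln (err n \<theta>') \<le> 0" using elim(2) err_le_1[of \<theta>' n] by simp
    qed
    finally show ?case .
  qed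
qed

end


subsection \<open>Compactness\<close>

text \<open>The arithmetic-geometric mean gap is nonnegative with integral 1 minus the affinity, so
  Fatou's lemma gives upper semicontinuity of the affinity. The sequence \<open>c\<close> carries
  near-maximal values to the limit.\<close>

lemma affinity_upper_semicontinuous:
  assumes pair: "\<And>n. density_pair M (p n) (q n)" "density_pair M p' q'"
    and lim: "AE x in M. (\<lambda>n. p n x) \<longlonglongrightarrow> p' x" "AE x in M. (\<lambda>n. q n x) \<longlonglongrightarrow> q' x"
    and z: "0 \<le> z" "z \<le> 1" and c: "\<And>n. c n \<le> affinity M (p n) (q n) z" "c \<longlonglongrightarrow> s"
  shows "s \<le> affinity M p' q' z"
proof -
  interpret L: density_pair M p' q' by (rule pair)
  define gap where "gap = (\<lambda>a b :: real. (1 - z) * a + z * b - a powr (1 - z) * b powr z)"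
  have int: "(\<integral>\<^sup>+x. ennreal (gap (p x) (q x)) \<partial>M) = ennreal (1 - affinity M p q z)" "affinity M p q z \<le> 1"
    if "density_pair M p q" for p q
  proof -
    interpret P: density_pair M p q by fact
    have i: "integrable M (\<lambda>x. gap (p x) (q x))"
      unfolding gap_def using P.integrable_p P.integrable_q P.integrable_mix[OF z] by auto
    have nn: "0 \<le> gap (p x) (q x)" for x
      using powr_mix_le[OF P.nonneg_p P.nonneg_q z] by (simp add: gap_def)
    have e: "(LINT x|M. gap (p x) (q x)) = 1 - affinity M p q z"
      unfolding gap_def affinity_def using P.integrable_p P.integrable_q P.integrable_mix[OF z]
      by (simp add: P.integral_p P.integral_q)
    show "(\<integral>\<^sup>+x. ennreal (gap (p x) (q x)) \<partial>M) = ennreal (1 - affinity M p q z)"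
      using nn_integral_eq_integral[OF i] nn e by simp
    show "affinity M p q z \<le> 1" using Bochner_Integration.integral_nonneg[of M "\<lambda>x. gap (p x) (q x)"] nn e by simp
  qed
  have gap_lim: "(\<lambda>n. gap (a n) (b n)) \<longlonglongrightarrow> gap a' b'"
    if "a \<longlonglongrightarrow> a'" "b \<longlonglongrightarrow> b'" "0 < a'" "0 < b'" for a b a' b'
    unfolding gap_def using that by (intro tendsto_intros) auto
  have "ennreal (1 - affinity M p' q' z) = (\<integral>\<^sup>+x. ennreal (gap (p' x) (q' x)) \<partial>M)"
    by (simp add: int[OF pair(2)])
  also have "\<dots> = (\<integral>\<^sup>+x. liminf (\<lambda>n. ennreal (gap (p n x) (q n x))) \<partial>M)"
  proof (rule nn_integral_cong_AE)
    show "AE x in M. ennreal (gap (p' x) (q' x)) = liminf (\<lambda>n. ennreal (gap (p n x) (q n x)))"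
      using lim L.AE_pos
    proof eventually_elim
      case (elim x)
      then have "(\<lambda>n. ennreal (gap (p n x) (q n x))) \<longlonglongrightarrow> ennreal (gap (p' x) (q' x))"
        by (intro tendsto_ennrealI gap_lim) auto
      then show ?case by (rule lim_imp_Liminf[OF trivial_limit_sequentially, symmetric])
    qed
  qed
  also have "\<dots> \<le> liminf (\<lambda>n. \<integral>\<^sup>+x. ennreal (gap (p n x) (q n x)) \<partial>M)"
  proof (rule nn_integral_liminf)
    fix n
    interpret P: density_pair M "p n" "q n" by (rule pair)
    show "(\<lambda>x. ennreal (gap (p n x) (q n x))) \<in> borel_measurable M" unfolding gap_def by measurable
  qed
  also have "\<dots> = liminf (\<lambda>n. ennreal (1 - affinity M (p n) (q n) z))" by (simp add: int[OF pair(1)])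
  also have "\<dots> \<le> liminf (\<lambda>n. ennreal (1 - c n))"
    using c(1) by (intro Liminf_mono always_eventually allI ennreal_leI) simp
  also have "\<dots> = ennreal (1 - s)"
    using c(2) by (intro lim_imp_Liminf tendsto_ennrealI tendsto_diff tendsto_const) auto
  finally have "ennreal (1 - affinity M p' q' z) \<le> ennreal (1 - s)" .
  moreover have "s \<le> 1" using c(1) int(2)[OF pair(1)] by (intro LIMSEQ_le_const2[OF c(2)]) (meson order_trans)
  ultimately show ?thesis by (subst (asm) ennreal_le_iff) auto
qed

text \<open>Along a maximising sequence the minimal affinity bounds the affinity at each
  \<open>z\<close> from below, so semicontinuity is applied at every fixed \<open>z\<close>; the
  minimum over \<open>z\<close> is taken only after the limit.\<close>

lemma min_affinity_attains_sup:
  fixes \<Theta> :: "'a::metric_space set" and \<Gamma> :: "'b::metric_space set"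
  assumes "compact \<Theta>" "\<Theta> \<noteq> {}" "compact \<Gamma>" "\<Gamma> \<noteq> {}"
    and pair: "\<And>\<theta> \<gamma>. \<theta> \<in> \<Theta> \<Longrightarrow> \<gamma> \<in> \<Gamma> \<Longrightarrow> density_pair M (g \<theta>) (h \<gamma>)"
    and cont: "AE x in M. continuous_on \<Theta> (\<lambda>\<theta>. g \<theta> x) \<and> continuous_on \<Gamma> (\<lambda>\<gamma>. h \<gamma> x)"
  obtains \<theta> \<gamma> where "\<theta> \<in> \<Theta>" "\<gamma> \<in> \<Gamma>"
    "\<And>\<theta>' \<gamma>'. \<theta>' \<in> \<Theta> \<Longrightarrow> \<gamma>' \<in> \<Gamma> \<Longrightarrow> min_affinity M (g \<theta>') (h \<gamma>') \<le> min_affinity M (g \<theta>) (h \<gamma>)"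
proof -
  define F where "F = (\<lambda>(\<theta>, \<gamma>). min_affinity M (g \<theta>) (h \<gamma>))"
  let ?K = "\<Theta> \<times> \<Gamma>"
  have ne: "?K \<noteq> {}" using assms by auto
  have bdd: "bdd_above (F ` ?K)"
    unfolding F_def using pair density_pair.min_affinity_le_1 by (fastforce intro!: bdd_aboveI2[where M = 1])
  define s where "s = (SUP k\<in>?K. F k)"
  have "\<exists>k\<in>?K. s - 1 / real (Suc n) < F k" for n
    using less_cSUP_iff[OF ne bdd, of "s - 1 / real (Suc n)"] by (simp add: s_def)
  then obtain k where k: "\<And>n. k n \<in> ?K" "\<And>n. s - 1 / real (Suc n) < F (k n)" by metis
  have "compact ?K" using assms by (intro compact_Times)
  then obtain l r where l: "l \<in> ?K" "strict_mono r" "(k \<circ> r) \<longlonglongrightarrow> l"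
    using k(1) unfolding compact_def by metis
  obtain \<theta> \<gamma> where [simp]: "l = (\<theta>, \<gamma>)" by force
  have \<theta>\<gamma>: "\<theta> \<in> \<Theta>" "\<gamma> \<in> \<Gamma>" using l(1) by auto
  define a b where "a = (\<lambda>n. fst (k (r n)))" and "b = (\<lambda>n. snd (k (r n)))"
  have ab: "a n \<in> \<Theta>" "b n \<in> \<Gamma>" for n using k(1)[of "r n"] by (auto simp: a_def b_def mem_Times_iff)
  have a_lim: "a \<longlonglongrightarrow> \<theta>" and b_lim: "b \<longlonglongrightarrow> \<gamma>"
    using tendsto_fst[OF l(3)] tendsto_snd[OF l(3)] by (simp_all add: a_def b_def comp_def)
  interpret L: density_pair M "g \<theta>" "h \<gamma>" using pair \<theta>\<gamma> by blast
  have s_le: "s \<le> affinity M (g \<theta>) (h \<gamma>) z" if z: "0 \<le> z" "z \<le> 1" for z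
  proof (rule affinity_upper_semicontinuous[where p = "\<lambda>n. g (a n)" and q = "\<lambda>n. h (b n)"])
    show "AE x in M. (\<lambda>n. g (a n) x) \<longlonglongrightarrow> g \<theta> x"
      using cont by eventually_elim (use ab \<theta>\<gamma> a_lim in \<open>auto intro: continuous_on_tendsto_compose\<close>)
    show "AE x in M. (\<lambda>n. h (b n) x) \<longlonglongrightarrow> h \<gamma> x"
      using cont by eventually_elim (use ab \<theta>\<gamma> b_lim in \<open>auto intro: continuous_on_tendsto_compose\<close>)
    show "(\<lambda>n. s - 1 / real (Suc (r n))) \<longlonglongrightarrow> s"
    proof -
      have "(\<lambda>n. s - 1 / real (Suc n)) \<longlonglongrightarrow> s - 0"
        by (intro tendsto_diff tendsto_const LIMSEQ_inverse_real_of_nat[unfolded inverse_eq_divide])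
      then show ?thesis using LIMSEQ_subseq_LIMSEQ[OF _ l(2)] by (fastforce simp: comp_def)
    qed
    show "s - 1 / real (Suc (r n)) \<le> affinity M (g (a n)) (h (b n)) z" for n
    proof -
      interpret P: density_pair M "g (a n)" "h (b n)" using pair ab by blast
      have "s - 1 / real (Suc (r n)) \<le> F (k (r n))" using k(2) by (simp add: less_imp_le)
      also have "\<dots> \<le> affinity M (g (a n)) (h (b n)) z"
        using P.min_affinity_le[OF z] by (simp add: F_def a_def b_def split_beta')
      finally show ?thesis .
    qed
  qed (use pair ab \<theta>\<gamma> z in auto)
  have "s \<le> min_affinity M (g \<theta>) (h \<gamma>)" using s_le L.min_affinity_attained by metis
  then show thesis
    using \<theta>\<gamma> cSUP_upper[OF _ bdd] by (intro that) (fastforce simp: F_def s_def)+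
qed


subsection \<open>Prior measures\<close>

text \<open>Restricting Lebesgue measure makes the space of the measure equal to \<Theta>, so that
  quantifiers over that space range over exactly the parameters.\<close>

definition prior_measure :: "'a::euclidean_space set \<Rightarrow> ('a \<Rightarrow> real) \<Rightarrow> 'a measure" where
  "prior_measure \<Theta> \<phi> = density (restrict_space lborel \<Theta>) (\<lambda>\<theta>. ennreal (\<phi> \<theta>))"

locale compact_prior =
  fixes \<Theta> :: "'a::euclidean_space set" and \<phi> :: "'a \<Rightarrow> real"
  assumes compact: "compact \<Theta>" and nonempty: "\<Theta> \<noteq> {}" and prior: "prior_density \<Theta> \<phi>"
begin

abbreviation \<pi> where "\<pi> \<equiv> prior_measure \<Theta> \<phi>"

lemma sets_\<Theta> [measurable, simp]: "\<Theta> \<in> sets borel"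
  using compact by (simp add: borel_compact)

lemma space_prior [simp]: "space \<pi> = \<Theta>"
  by (simp add: prior_measure_def space_restrict_space)

lemma sets_prior: "sets \<pi> = sets (restrict_space borel \<Theta>)"
  by (simp add: prior_measure_def cong: sets_restrict_space_cong)

lemma prior_pos: "\<theta> \<in> \<Theta> \<Longrightarrow> 0 < \<phi> \<theta>"
  using prior by (auto simp: prior_density_def)

lemma continuous_on_prior: "continuous_on \<Theta> \<phi>"
  using prior lipschitz_on_continuous_on by (auto simp: prior_density_def)

lemma measurable_prior [measurable]: "\<phi> \<in> borel_measurable (restrict_space lborel \<Theta>)"
  using borel_measurable_continuous_on_restrict[OF continuous_on_prior]
  by (simp cong: measurable_cong_sets sets_restrict_space_cong)

lemma nn_integral_prior:
  assumes [measurable]: "f \<in> borel_measurable \<pi>"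
  shows "(\<integral>\<^sup>+\<theta>. f \<theta> \<partial>\<pi>) = (\<integral>\<^sup>+\<theta>. ennreal (\<phi> \<theta>) * f \<theta> * indicator \<Theta> \<theta> \<partial>lborel)"
proof -
  have f: "f \<in> borel_measurable (restrict_space lborel \<Theta>)" using assms by (simp add: prior_measure_def)
  show ?thesis unfolding prior_measure_def using f
    by (simp add: nn_integral_density nn_integral_restrict_space)
qed

lemma integral_prior:
  fixes f :: "'a \<Rightarrow> real"
  assumes "f \<in> borel_measurable \<pi>"
  shows "(LINT \<theta>|\<pi>. f \<theta>) = (LINT \<theta>:\<Theta>|lborel. \<phi> \<theta> * f \<theta>)"
proof -
  have f: "f \<in> borel_measurable (restrict_space lborel \<Theta>)" using assms by (simp add: prior_measure_def)
  have "(LINT \<theta>|\<pi>. f \<theta>) = (LINT \<theta>|restrict_space lborel \<Theta>. \<phi> \<theta> *\<^sub>R f \<theta>)"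
    unfolding prior_measure_def using f prior_pos
    by (intro integral_density) (auto simp: AE_restrict_space_iff intro!: AE_I2 less_imp_le)
  then show ?thesis by (simp add: integral_restrict_space set_lebesgue_integral_def)
qed

lemma prob_space_prior: "prob_space \<pi>"
proof
  \<comment> \<open>A non-integrable function has Bochner integral 0, so normalisation to 1 already
    contains integrability.\<close>
  have int: "set_integrable lborel \<Theta> \<phi>"
    using prior not_integrable_integral_eq[of lborel "\<lambda>x. indicat_real \<Theta> x *\<^sub>R \<phi> x"]
    by (auto simp: prior_density_def set_integrable_def set_lebesgue_integral_def)
  have "emeasure \<pi> (space \<pi>) = (\<integral>\<^sup>+\<theta>. 1 \<partial>\<pi>)" by simp
  also have "\<dots> = (\<integral>\<^sup>+\<theta>. ennreal (indicator \<Theta> \<theta> *\<^sub>R \<phi> \<theta>) \<partial>lborel)"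
    by (subst nn_integral_prior) (auto intro!: nn_integral_cong simp: indicator_def)
  also have "\<dots> = ennreal (LINT \<theta>:\<Theta>|lborel. \<phi> \<theta>)"
    using int prior_pos unfolding set_lebesgue_integral_def set_integrable_def
    by (intro nn_integral_eq_integral) (auto simp: indicator_def less_imp_le)
  finally show "emeasure \<pi> (space \<pi>) = 1" using prior by (simp add: prior_density_def)
qed

sublocale prob_space \<pi> by (rule prob_space_prior)

text \<open>A continuous positive prior has a positive minimum on a compact set, and the cone keeps
  a fixed fraction of every small ball inside the set, also for centres on the boundary.\<close>

lemma prior_ball_mass:
  assumes cone: "\<And>p. p \<in> \<Theta> \<Longrightarrow> cone_at \<Theta> e p"
  obtains c where "0 < c" "\<And>\<theta> r. \<theta> \<in> \<Theta> \<Longrightarrow> 0 < r \<Longrightarrow> r \<le> e \<Longrightarrow> c * r ^ DIM('a) \<le> measure \<pi> (\<Theta> \<inter> ball \<theta> r)"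
proof -
  obtain \<theta>0 where \<theta>0: "\<theta>0 \<in> \<Theta>" "\<And>\<theta>. \<theta> \<in> \<Theta> \<Longrightarrow> \<phi> \<theta>0 \<le> \<phi> \<theta>"
    using continuous_attains_inf[OF compact nonempty continuous_on_prior] by auto
  define m where "m = \<phi> \<theta>0"
  have m: "0 < m" using prior_pos \<theta>0 by (simp add: m_def)
  define c where "c = m * (unit_ball_vol (real DIM('a)) / 8 ^ DIM('a))"
  have "0 < c" using m by (simp add: c_def unit_ball_vol_pos)
  then show thesis
  proof (rule that)
    fix \<theta> r assume \<theta>: "\<theta> \<in> \<Theta>" and r: "0 < r" "r \<le> e"
    let ?A = "\<Theta> \<inter> ball \<theta> r"
    have A: "?A \<in> sets borel" by simp
    have A': "?A \<in> sets \<pi>" unfolding sets_prior by (auto simp: sets_restrict_space)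
    have fin: "emeasure lborel ?A < \<infinity>" using compact by (intro emeasure_bounded_finite) (auto intro: bounded_Int compact_imp_bounded)
    have "\<Theta> \<in> lmeasurable" using compact by (rule lmeasurable_compact)
    from cone_at_volume[OF cone[OF \<theta>] \<theta> this r]
    have "unit_ball_vol DIM('a) * (r / 8) ^ DIM('a) \<le> measure lborel ?A"
      by (simp add: measure_completion)
    then have "c * r ^ DIM('a) \<le> m * measure lborel ?A"
      using m mult_left_mono[of _ _ m] by (fastforce simp: c_def power_divide)
    then have "ennreal (c * r ^ DIM('a)) \<le> ennreal (m * measure lborel ?A)" by (rule ennreal_leI)
    also have "\<dots> = ennreal m * emeasure lborel ?A"
      using m fin by (simp add: ennreal_mult emeasure_eq_ennreal_measure less_top)
    also have "\<dots> = (\<integral>\<^sup>+\<theta>. ennreal m * indicator ?A \<theta> \<partial>lborel)"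
      using A by (simp add: nn_integral_cmult_indicator)
    also have "\<dots> \<le> (\<integral>\<^sup>+\<theta>. ennreal (\<phi> \<theta>) * indicator ?A \<theta> * indicator \<Theta> \<theta> \<partial>lborel)"
      using \<theta>0(2) by (intro nn_integral_mono) (auto simp: indicator_def m_def intro!: ennreal_leI)
    also have "\<dots> = (\<integral>\<^sup>+\<theta>. indicator ?A \<theta> \<partial>\<pi>)" using A' by (subst nn_integral_prior) auto
    also have "\<dots> = ennreal (measure \<pi> ?A)" using A' by (simp add: emeasure_eq_measure)
    finally show "c * r ^ DIM('a) \<le> measure \<pi> ?A" by (subst (asm) ennreal_le_iff) auto
  qed
qed

text \<open>A maximal \<open>r\<close>-separated set is a net, and the disjoint balls of radius \<open>r / 2\<close> bound its size.\<close>

lemma finite_net: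
  assumes "0 < r" "0 < m" and mass: "\<And>\<theta>. \<theta> \<in> \<Theta> \<Longrightarrow> m \<le> measure \<pi> (\<Theta> \<inter> ball \<theta> (r / 2))"
  obtains T where "finite T" "T \<subseteq> \<Theta>" "card T \<le> 1 / m" "\<And>\<theta>. \<theta> \<in> \<Theta> \<Longrightarrow> \<exists>t\<in>T. dist \<theta> t < r"
proof -
  define sep where "sep = (\<lambda>T. finite T \<and> T \<subseteq> \<Theta> \<and> (\<forall>s\<in>T. \<forall>t\<in>T. s \<noteq> t \<longrightarrow> r \<le> dist s t))"
  have card: "card T \<le> 1 / m" if T: "sep T" for T
  proof -
    have disj: "disjoint_family_on (\<lambda>t. \<Theta> \<inter> ball t (r / 2)) T"
      unfolding disjoint_family_on_def
    proof (intro ballI impI)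
      fix s t assume st: "s \<in> T" "t \<in> T" "s \<noteq> t"
      then have "r \<le> dist s t" using T by (auto simp: sep_def)
      moreover have "dist s t \<le> dist s x + dist t x" for x by (metis dist_commute dist_triangle)
      ultimately show "(\<Theta> \<inter> ball s (r / 2)) \<inter> (\<Theta> \<inter> ball t (r / 2)) = {}"
        by (smt (verit) disjoint_iff field_sum_of_halves IntD2 mem_ball)
    qed
    have "card T * m = (\<Sum>t\<in>T. m)" by simp
    also have "\<dots> \<le> (\<Sum>t\<in>T. measure \<pi> (\<Theta> \<inter> ball t (r / 2)))"
      using T by (intro sum_mono mass) (auto simp: sep_def)
    also have "\<dots> = measure \<pi> (\<Union>t\<in>T. \<Theta> \<inter> ball t (r / 2))"
      using T disj by (intro finite_measure_finite_Union[symmetric]) (auto simp: sep_def sets_prior sets_restrict_space)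
    also have "\<dots> \<le> 1" by (rule prob_le_1)
    finally show ?thesis using assms(2) by (simp add: field_simps)
  qed
  have "\<forall>T. sep T \<longrightarrow> card T < Suc (nat \<lceil>1 / m\<rceil>)"
    using card by (smt (verit) le_imp_less_Suc nat_mono nat_int ceiling_mono ceiling_of_nat)
  moreover have "sep {}" by (simp add: sep_def)
  ultimately obtain T where T: "sep T" "\<And>T'. sep T' \<Longrightarrow> card T' \<le> card T"
    using ex_has_greatest_nat[of sep "{}" card] by metis
  show thesis
  proof (rule that)
    show "finite T" "T \<subseteq> \<Theta>" using T by (auto simp: sep_def)
    show "card T \<le> 1 / m" using card T by blast
    fix \<theta> assume \<theta>: "\<theta> \<in> \<Theta>"
    show "\<exists>t\<in>T. dist \<theta> t < r"
    proof (rule ccontr)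
      assume *: "\<not> ?thesis"
      then have "\<theta> \<notin> T" using assms(1) by force
      have "sep (insert \<theta> T)" using T(1) \<theta> * unfolding sep_def by (auto simp: not_less dist_commute)
      then have "card (insert \<theta> T) \<le> card T" by (rule T(2))
      then show False using \<open>\<theta> \<notin> T\<close> T(1) by (simp add: sep_def)
    qed
  qed
qed

end

section \<open>Comparison of mixture likelihoods with finite nets\<close>

lemma eventually_Suc_le_exp:
  assumes "0 < (c::real)"
  shows "\<forall>\<^sub>F n in sequentially. real n + 1 \<le> exp (c * real n)"
  using eventually_ge_at_top[of "nat \<lceil>2 / c\<^sup>2\<rceil>"]
proof eventually_elim
  case (elim n)
  then have "2 / c\<^sup>2 \<le> real n" by linarith
  then have "2 \<le> c\<^sup>2 * real n" using assms by (simp add: pos_divide_le_eq mult.commute)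
  then have "2 * real n \<le> c\<^sup>2 * real n * real n" by (intro mult_right_mono) auto
  moreover have "1 + c * n + (c * n)\<^sup>2 / 2 \<le> exp (c * n)"
    using assms by (intro exp_lower_Taylor_quadratic) auto
  moreover have "0 \<le> c * real n" using assms by simp
  ultimately show ?case by (simp add: power2_eq_square mult.assoc mult.left_commute)
qed

context compact_prior
begin

text \<open>Within distance \<open>r n\<close> the likelihood of \<open>n\<close> regular
  observations varies by at most a factor \<open>exp 1\<close>. Averaging over one ball bounds the
  mixture below by the likelihood times the prior mass of the ball; replacing parameters by net
  points bounds it above. Inverse mass and net size are controlled by a power of
  \<open>(n + 1) * L n\<close>, which is subexponential.\<close>

lemma subexponential_sandwich:
  fixes L :: "nat \<Rightarrow> real" and g :: "'a \<Rightarrow> real \<Rightarrow> real" and M :: "real measure"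
  assumes e: "0 < e" and cone: "\<And>p. p \<in> \<Theta> \<Longrightarrow> cone_at \<Theta> e p"
    and L1: "\<And>n. 1 \<le> L n" and L_subexp: "\<And>c::real. 0 < c \<Longrightarrow> \<forall>\<^sub>F n in sequentially. L n \<le> exp (c * n)"
    and meas: "\<And>x. (\<lambda>\<theta>. g \<theta> x) \<in> borel_measurable \<pi>"
    and pos: "\<And>n x \<theta>. x \<in> W n \<Longrightarrow> \<theta> \<in> \<Theta> \<Longrightarrow> 0 < g \<theta> x"
    and lip: "\<And>n x \<theta> \<theta>'. x \<in> W n \<Longrightarrow> \<theta> \<in> \<Theta> \<Longrightarrow> \<theta>' \<in> \<Theta> \<Longrightarrow> 4 * norm (\<theta> - \<theta>') < e \<Longrightarrow>
      \<bar>ln (g \<theta> x) - ln (g \<theta>' x)\<bar> \<le> 9 * L n * norm (\<theta> - \<theta>')"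
  obtains \<kappa> :: "nat \<Rightarrow> real" and T where "\<And>n. 1 \<le> \<kappa> n"
    "\<And>c::real. 0 < c \<Longrightarrow> \<forall>\<^sub>F n in sequentially. \<kappa> n \<le> exp (c * n)"
    "\<forall>\<^sub>F n in sequentially. T n \<subseteq> \<Theta> \<and> finite (T n) \<and> card (T n) \<le> \<kappa> n"
    "\<forall>\<^sub>F n in sequentially. \<forall>X\<in>space (\<Pi>\<^sub>M i\<in>{..<n}. M). (\<forall>i<n. X i \<in> W n) \<longrightarrow>
      (\<forall>\<theta>\<in>\<Theta>. ennreal (\<Prod>i<n. g \<theta> (X i)) \<le> \<kappa> n * mixture_lik \<pi> g n X) \<and>
      (\<exists>\<theta>\<in>T n. mixture_lik \<pi> g n X \<le> \<kappa> n * ennreal (\<Prod>i<n. g \<theta> (X i)))"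
proof -
  let ?d = "DIM('a)"
  obtain c where c: "0 < c" "\<And>\<theta> r. \<theta> \<in> \<Theta> \<Longrightarrow> 0 < r \<Longrightarrow> r \<le> e \<Longrightarrow> c * r ^ ?d \<le> measure \<pi> (\<Theta> \<inter> ball \<theta> r)"
    using prior_ball_mass[OF cone] by blast
  \<comment> \<open>The \<open>n\<close> increments \<open>9 * L n * r n = 1 / (n + 1)\<close> of
    the log-likelihood sum to at most 1; \<open>n + 1\<close> keeps the radius positive at
    \<open>n = 0\<close>.\<close>
  define r where "r n = 1 / (9 * (real n + 1) * L n)" for n
  have L0: "0 < L n" for n using L1[of n] by simp
  have r0: "0 < r n" for n using L0 by (simp add: r_def)
  \<comment> \<open>Half the radius, because the net is counted by disjoint balls of radius
    \<open>r n / 2\<close>; the bound serves for the larger ball of the averaging step as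
    well.\<close>
  define m where "m n = c * (r n / 2) ^ ?d" for n
  have m0: "0 < m n" for n using c r0 by (simp add: m_def)
  \<comment> \<open>Large enough for its three uses: net size \<open>1 / m n\<close>, upper
    comparison \<open>exp 1\<close>, lower comparison \<open>exp 1 / m n\<close>.\<close>
  define \<kappa> where "\<kappa> n = exp 1 * (1 + 1 / m n)" for n
  have \<kappa>1: "1 \<le> \<kappa> n" "exp 1 \<le> \<kappa> n" "1 / m n \<le> \<kappa> n" "exp 1 / m n \<le> \<kappa> n" for n
  proof -
    have *: "1 \<le> exp (1::real)" "0 \<le> 1 / m n" using m0[of n] by auto
    then show "exp 1 \<le> \<kappa> n" "exp 1 / m n \<le> \<kappa> n" by (simp_all add: \<kappa>_def distrib_left)
    then show "1 \<le> \<kappa> n" using * by linarith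
    have "1 * (1 / m n) \<le> exp 1 * (1 + 1 / m n)" using * by (intro mult_mono) auto
    then show "1 / m n \<le> \<kappa> n" by (simp add: \<kappa>_def)
  qed
  have ev: "\<forall>\<^sub>F n in sequentially. 4 * r n < e"
  proof -
    have "r n \<le> 1 / real (Suc n)" for n
    proof -
      have "1 * (real n + 1) * 1 \<le> 9 * (real n + 1) * L n" using L1[of n] by (intro mult_mono) auto
      then show ?thesis unfolding r_def using L0[of n] by (intro divide_left_mono) (auto simp: add.commute)
    qed
    then have r: "4 * r n \<le> 4 * (1 / real (Suc n))" for n by (intro mult_left_mono) auto
    have "(\<lambda>n. 4 * (1 / real (Suc n))) \<longlonglongrightarrow> 4 * 0"
      by (intro tendsto_mult tendsto_const LIMSEQ_inverse_real_of_nat[unfolded inverse_eq_divide])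
    then have "\<forall>\<^sub>F n in sequentially. 4 * (1 / real (Suc n)) < e" using e by (intro order_tendstoD) auto
    then show ?thesis by eventually_elim (rule le_less_trans[OF r])
  qed
  have "\<exists>T. 4 * r n < e \<longrightarrow> finite T \<and> T \<subseteq> \<Theta> \<and> card T \<le> 1 / m n \<and> (\<forall>\<theta>\<in>\<Theta>. \<exists>t\<in>T. dist \<theta> t < r n)" for n
  proof (cases "4 * r n < e")
    case True
    have "m n \<le> measure \<pi> (\<Theta> \<inter> ball \<theta> (r n / 2))" if "\<theta> \<in> \<Theta>" for \<theta>
      unfolding m_def using that True r0[of n] by (intro c(2)) auto
    from finite_net[OF r0 m0 this] show ?thesis by metis
  qed simp
  then obtain T where T: "\<And>n. 4 * r n < e \<Longrightarrow> finite (T n) \<and> T n \<subseteq> \<Theta> \<and> card (T n) \<le> 1 / m n \<and>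
      (\<forall>\<theta>\<in>\<Theta>. \<exists>t\<in>T n. dist \<theta> t < r n)" by metis
  have close: "(\<Prod>i<n. g \<theta> (X i)) \<le> exp 1 * (\<Prod>i<n. g \<theta>' (X i))"
    if n: "4 * r n < e" and X: "\<forall>i<n. X i \<in> W n" and \<theta>: "\<theta> \<in> \<Theta>" "\<theta>' \<in> \<Theta>" "dist \<theta> \<theta>' < r n" for n X \<theta> \<theta>'
  proof -
    have "(\<Sum>i<n. ln (g \<theta> (X i)) - ln (g \<theta>' (X i))) \<le> (\<Sum>i<n. 9 * L n * r n)"
    proof (rule sum_mono)
      fix i assume "i \<in> {..<n}"
      then have "\<bar>ln (g \<theta> (X i)) - ln (g \<theta>' (X i))\<bar> \<le> 9 * L n * norm (\<theta> - \<theta>')"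
        using X \<theta> n by (intro lip) (auto simp: dist_norm)
      also have "\<dots> \<le> 9 * L n * r n" using \<theta>(3) L0[of n] by (intro mult_left_mono) (auto simp: dist_norm)
      finally show "ln (g \<theta> (X i)) - ln (g \<theta>' (X i)) \<le> 9 * L n * r n" by linarith
    qed
    also have "9 * L n * r n = 1 / (real n + 1)" using L0[of n] by (simp add: r_def divide_simps)
    then have "(\<Sum>i<n. 9 * L n * r n) \<le> 1" by simp
    finally have "exp (\<Sum>i<n. ln (g \<theta> (X i)) - ln (g \<theta>' (X i))) \<le> exp 1" by simp
    then have "exp (\<Sum>i<n. ln (g \<theta> (X i)) - ln (g \<theta>' (X i))) * (\<Prod>i<n. g \<theta>' (X i)) \<le> exp 1 * (\<Prod>i<n. g \<theta>' (X i))"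
      using X \<theta> by (intro mult_right_mono prod_nonneg) (auto intro!: less_imp_le pos[of _ n])
    also have "exp (\<Sum>i<n. ln (g \<theta> (X i)) - ln (g \<theta>' (X i))) * (\<Prod>i<n. g \<theta>' (X i)) = (\<Prod>i<n. g \<theta> (X i))"
      unfolding exp_sum[OF finite_lessThan] prod.distrib[symmetric]
    proof (intro prod.cong refl)
      fix i assume "i \<in> {..<n}"
      then show "exp (ln (g \<theta> (X i)) - ln (g \<theta>' (X i))) * g \<theta>' (X i) = g \<theta> (X i)"
        using pos[of "X i" n \<theta>] pos[of "X i" n \<theta>'] X \<theta> by (simp add: exp_diff)
    qed
    finally show ?thesis .
  qed
  show thesis
  proof (rule that[OF \<kappa>1(1)])
    show "\<forall>\<^sub>F n in sequentially. T n \<subseteq> \<Theta> \<and> finite (T n) \<and> card (T n) \<le> \<kappa> n"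
      using ev by eventually_elim (meson T \<kappa>1(3) order_trans)
    fix a :: real assume a: "0 < a"
    \<comment> \<open>The power \<open>?d\<close> of two factors \<open>exp (b * n)\<close> has to
      stay below \<open>exp (a / 2 * n)\<close>; the other half of \<open>a\<close> pays for the
      constants.\<close>
    define b where "b = a / (4 * (real ?d + 1))"
    have b: "0 < b" using a by (simp add: b_def)
    \<comment> \<open>\<open>18 = 2 * 9\<close> combines the halving of the radius with the
      Lipschitz factor 9 in \<open>r n\<close>.\<close>
    define K where "K = 18 ^ ?d / c"
    have K: "0 < K" using c by (simp add: K_def)
    have a2: "0 < a / 2" using a by simp
    show "\<forall>\<^sub>F n in sequentially. \<kappa> n \<le> exp (a * n)"
      using L_subexp[OF b] eventually_Suc_le_exp[OF b] eventually_exp_linear_ge[OF a2, of "exp 1 * (1 + K)"]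
    proof eventually_elim
      case (elim n)
      let ?y = "((real n + 1) * L n) ^ ?d"
      have y1: "1 \<le> ?y" using L1[of n] mult_mono[of 1 "real n + 1" 1 "L n"] by (intro one_le_power) auto
      have "1 / m n = K * ?y"
        by (simp add: m_def r_def K_def power_mult_distrib power_divide power_one_over field_simps flip: power_mult_distrib)
      then have "\<kappa> n = exp 1 * (1 + K * ?y)" by (simp add: \<kappa>_def)
      also have "\<dots> \<le> exp 1 * ((1 + K) * ?y)" using y1 by (intro mult_left_mono) (auto simp: algebra_simps)
      also have "\<dots> = (exp 1 * (1 + K)) * ?y" by (simp add: mult.assoc)
      also have "\<dots> \<le> exp (a / 2 * n) * exp (a / 2 * n)"
      proof (rule mult_mono)
        have "?y \<le> (exp (b * n) * exp (b * n)) ^ ?d"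
          using elim(1,2) L0[of n] by (intro power_mono mult_mono) auto
        also have "\<dots> = exp (real ?d * (2 * b * n))" unfolding exp_of_nat_mult by (simp add: mult.assoc flip: exp_add)
        also have "real ?d * (2 * b) \<le> a / 2" using a by (simp add: b_def field_simps)
        then have "exp (real ?d * (2 * b * n)) \<le> exp (a / 2 * n)"
          using mult_right_mono[of "real ?d * (2 * b)" "a / 2" "real n"] by (simp add: mult.assoc)
        finally show "?y \<le> exp (a / 2 * n)" .
      qed (use elim(3) y1 in auto)
      also have "\<dots> = exp (a * n)" by (simp flip: exp_add)
      finally show ?case .
    qed
  next
    show "\<forall>\<^sub>F n in sequentially. \<forall>X\<in>space (\<Pi>\<^sub>M i\<in>{..<n}. M). (\<forall>i<n. X i \<in> W n) \<longrightarrow>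
      (\<forall>\<theta>\<in>\<Theta>. ennreal (\<Prod>i<n. g \<theta> (X i)) \<le> \<kappa> n * mixture_lik \<pi> g n X) \<and>
      (\<exists>\<theta>\<in>T n. mixture_lik \<pi> g n X \<le> \<kappa> n * ennreal (\<Prod>i<n. g \<theta> (X i)))"
      using ev
    proof (eventually_elim, intro ballI impI conjI)
      fix n X assume n: "4 * r n < e" and X: "\<forall>i<n. X i \<in> W n"
      have nn: "0 \<le> (\<Prod>i<n. g \<theta> (X i))" if "\<theta> \<in> \<Theta>" for \<theta>
        using X that by (intro prod_nonneg) (auto intro!: less_imp_le pos[of _ n])
      {
        fix \<theta> assume \<theta>: "\<theta> \<in> \<Theta>"
        let ?p = "\<Prod>i<n. g \<theta> (X i)" and ?A = "\<Theta> \<inter> ball \<theta> (r n)"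
        have A: "?A \<in> sets \<pi>" by (auto simp: sets_prior sets_restrict_space)
        have "m n \<le> c * r n ^ ?d"
          using c(1) r0[of n] by (auto simp: m_def intro!: power_mono mult_left_mono)
        also have "\<dots> \<le> measure \<pi> ?A" using n r0[of n] \<theta> by (intro c(2)) auto
        finally have mass: "m n \<le> measure \<pi> ?A" .
        have "ennreal (exp (-1) * ?p * m n) \<le> ennreal (exp (-1) * ?p) * emeasure \<pi> ?A"
          using nn[OF \<theta>] mass m0[of n] by (simp add: ennreal_mult emeasure_eq_measure ennreal_leI mult_left_mono)
        also have "\<dots> = (\<integral>\<^sup>+\<theta>'. ennreal (exp (-1) * ?p) * indicator ?A \<theta>' \<partial>\<pi>)"
          using A by (rule nn_integral_cmult_indicator[symmetric])
        also have "\<dots> \<le> mixture_lik \<pi> g n X"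
          unfolding mixture_lik_def
        proof (rule nn_integral_mono)
          fix \<theta>' assume "\<theta>' \<in> space \<pi>"
          then have \<theta>': "\<theta>' \<in> \<Theta>" by simp
          show "ennreal (exp (-1) * ?p) * indicator ?A \<theta>' \<le> ennreal (\<Prod>i<n. g \<theta>' (X i))"
          proof (cases "\<theta>' \<in> ?A")
            case True
            then have "exp (-1) * ?p \<le> exp (-1) * (exp 1 * (\<Prod>i<n. g \<theta>' (X i)))"
              using close[OF n X \<theta> \<theta>'] by (intro mult_left_mono) auto
            also have "\<dots> = exp (-1 + 1) * (\<Prod>i<n. g \<theta>' (X i))" unfolding exp_add by (rule mult.assoc[symmetric])
            finally have "exp (-1) * ?p \<le> (\<Prod>i<n. g \<theta>' (X i))" by simp
            then show ?thesis using True by (auto intro: ennreal_leI)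
          qed simp
        qed
        finally have le: "ennreal (exp (-1) * ?p * m n) \<le> mixture_lik \<pi> g n X" .
        have "?p = exp 1 / m n * (exp (-1) * ?p * m n)" using m0[of n] by (simp add: exp_minus)
        also have "\<dots> \<le> \<kappa> n * (exp (-1) * ?p * m n)"
          using nn[OF \<theta>] m0[of n] \<kappa>1(4)[of n] by (intro mult_right_mono) auto
        finally have "ennreal ?p \<le> ennreal (\<kappa> n * (exp (-1) * ?p * m n))" by (rule ennreal_leI)
        also have "\<dots> = ennreal (\<kappa> n) * ennreal (exp (-1) * ?p * m n)"
          using \<kappa>1(1)[of n] nn[OF \<theta>] m0[of n] by (intro ennreal_mult) auto
        also have "\<dots> \<le> ennreal (\<kappa> n) * mixture_lik \<pi> g n X" using le by (rule mult_left_mono) simp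
        finally show "ennreal ?p \<le> ennreal (\<kappa> n) * mixture_lik \<pi> g n X" .
      }
      have Tn: "finite (T n)" "T n \<subseteq> \<Theta>" "\<And>\<theta>. \<theta> \<in> \<Theta> \<Longrightarrow> \<exists>t\<in>T n. dist \<theta> t < r n" using T[OF n] by auto
      have "T n \<noteq> {}" using Tn(3) nonempty by blast
      \<comment> \<open>A net point of largest likelihood dominates all others and so provides one
        witness for every parameter in the mixture.\<close>
      then have "Max ((\<lambda>t. \<Prod>i<n. g t (X i)) ` T n) \<in> (\<lambda>t. \<Prod>i<n. g t (X i)) ` T n"
        using Tn(1) by (intro Max_in) auto
      then obtain s where s0: "s \<in> T n" "Max ((\<lambda>t. \<Prod>i<n. g t (X i)) ` T n) = (\<Prod>i<n. g s (X i))" by auto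
      have s: "s \<in> T n" "(\<Prod>i<n. g t (X i)) \<le> (\<Prod>i<n. g s (X i))" if "t \<in> T n" for t
        unfolding s0(2)[symmetric] using Tn(1) that s0(1) by auto
      show "\<exists>\<theta>\<in>T n. mixture_lik \<pi> g n X \<le> \<kappa> n * ennreal (\<Prod>i<n. g \<theta> (X i))"
      proof (rule bexI[OF _ s0(1)])
        have "mixture_lik \<pi> g n X \<le> (\<integral>\<^sup>+\<theta>. ennreal (\<kappa> n * (\<Prod>i<n. g s (X i))) \<partial>\<pi>)"
          unfolding mixture_lik_def
        proof (intro nn_integral_mono ennreal_leI)
          fix \<theta> assume "\<theta> \<in> space \<pi>"
          then have \<theta>: "\<theta> \<in> \<Theta>" by simp
          obtain t where t: "t \<in> T n" "dist \<theta> t < r n" using Tn(3)[OF \<theta>] by blast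
          have "(\<Prod>i<n. g \<theta> (X i)) \<le> exp 1 * (\<Prod>i<n. g t (X i))" using t Tn(2) by (intro close[OF n X \<theta>]) auto
          also have "\<dots> \<le> \<kappa> n * (\<Prod>i<n. g s (X i))"
            using s(2)[OF t(1)] \<kappa>1(2)[of n] \<kappa>1(1)[of n] nn[of t] t(1) Tn(2) by (intro mult_mono) auto
          finally show "(\<Prod>i<n. g \<theta> (X i)) \<le> \<kappa> n * (\<Prod>i<n. g s (X i))" .
        qed
        also have "\<dots> = ennreal (\<kappa> n * (\<Prod>i<n. g s (X i)))" by (simp add: emeasure_space_1[unfolded space_prior])
        also have "\<dots> = ennreal (\<kappa> n) * ennreal (\<Prod>i<n. g s (X i))"
          using \<kappa>1(1)[of n] by (intro ennreal_mult') auto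
        finally show "mixture_lik \<pi> g n X \<le> ennreal (\<kappa> n) * ennreal (\<Prod>i<n. g s (X i))" .
      qed
    qed
  qed
qed

end

section \<open>Growth of stretched exponentials\<close>

lemma eventually_powr_le_linear:
  assumes "\<beta> < 1" "0 < c"
  shows "\<forall>\<^sub>F n in sequentially. real n powr \<beta> \<le> c * real n"
proof -
  have "(\<lambda>n. real n powr (\<beta> - 1)) \<longlonglongrightarrow> 0"
    using assms by (intro tendsto_neg_powr filterlim_real_sequentially) simp
  then have "\<forall>\<^sub>F n in sequentially. real n powr (\<beta> - 1) < c" using assms by (intro order_tendstoD)
  then show ?thesis using eventually_gt_at_top[of 0]
  proof eventually_elim
    case (elim n)
    have "real n powr \<beta> = real n powr (\<beta> - 1) * real n" using elim(2) by (simp add: powr_diff)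
    then show ?case using elim by (simp add: mult_right_mono)
  qed
qed

lemma eventually_powr_ge:
  assumes "0 < \<zeta>"
  shows "\<forall>\<^sub>F n in sequentially. C \<le> real n powr \<zeta>"
proof -
  define D where "D = max C 1"
  have D: "0 < D" "C \<le> D" by (auto simp: D_def)
  have "(\<lambda>n. real n powr (- \<zeta>)) \<longlonglongrightarrow> 0"
    using assms by (intro tendsto_neg_powr filterlim_real_sequentially) simp
  then have "\<forall>\<^sub>F n in sequentially. real n powr (- \<zeta>) < 1 / D" using D by (intro order_tendstoD) auto
  then show ?thesis using eventually_gt_at_top[of 0]
  proof eventually_elim
    case (elim n)
    have "0 < real n powr \<zeta>" using elim(2) by simp
    then have "D < real n powr \<zeta>" using elim(1) D by (simp add: powr_minus field_simps)
    then show ?case using D by simp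
  qed
qed

lemma eventually_superexp:
  assumes "1 < \<xi>"
  shows "\<forall>\<^sub>F n in sequentially. real n * (2 * exp (- (real n powr \<xi>))) \<le> exp (- c * real n)"
proof -
  have \<xi>: "0 < \<xi> - 1" using assms by simp
  show ?thesis
    using eventually_powr_ge[OF \<xi>, of "c + 2"] eventually_Suc_le_exp[OF zero_less_one]
      eventually_exp_linear_ge[OF zero_less_one, of 2] eventually_gt_at_top[of 0]
proof eventually_elim
  case (elim n)
  have "real n powr \<xi> = real n powr (\<xi> - 1) * real n" using elim(4) by (simp add: powr_diff)
  also have "\<dots> \<ge> (c + 2) * real n" using elim by (intro mult_right_mono) auto
  finally have "exp (- (real n powr \<xi>)) \<le> exp (- ((c + 2) * real n))" by simp
  then have "real n * (2 * exp (- (real n powr \<xi>))) \<le> (real n * 2) * exp (- ((c + 2) * real n))"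
    by (simp add: mult_left_mono)
  also have "\<dots> \<le> (exp (real n) * exp (real n)) * exp (- ((c + 2) * real n))"
    using elim by (intro mult_right_mono mult_mono) auto
  also have "\<dots> = exp (- c * real n)" by (simp add: algebra_simps flip: exp_add)
  finally show ?case .
qed
qed

section \<open>Marginal likelihoods as integrals over the prior\<close>

context compact_prior
begin

lemma marginal_lik_eq:
  assumes "\<And>x. (\<lambda>\<theta>. g \<theta> x) \<in> borel_measurable \<pi>"
  shows "marginal_lik \<Theta> \<phi> g n X = (LINT \<theta>|\<pi>. (\<Prod>i<n. g \<theta> (X i)))"
  unfolding marginal_lik_def using assms by (intro integral_prior[symmetric] borel_measurable_prod)

text \<open>Finiteness is assumed because the Bochner integral of a non-integrable likelihood would
  be 0; on regular samples it follows from the upper comparison with the net.\<close>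

lemma ennreal_marginal_lik:
  assumes meas: "\<And>x. (\<lambda>\<theta>. g \<theta> x) \<in> borel_measurable \<pi>" and nn: "\<And>\<theta> x. \<theta> \<in> \<Theta> \<Longrightarrow> 0 \<le> g \<theta> x"
    and fin: "mixture_lik \<pi> g n X \<noteq> \<infinity>"
  shows "ennreal (marginal_lik \<Theta> \<phi> g n X) = mixture_lik \<pi> g n X"
proof -
  have "AE \<theta> in \<pi>. 0 \<le> (\<Prod>i<n. g \<theta> (X i))" using nn by (intro AE_I2 prod_nonneg) auto
  moreover have "integrable \<pi> (\<lambda>\<theta>. \<Prod>i<n. g \<theta> (X i))"
    using fin meas calculation unfolding mixture_lik_def by (intro integrableI_nonneg) (auto simp: less_top)
  ultimately show ?thesis
    unfolding marginal_lik_eq[OF meas] mixture_lik_def by (intro nn_integral_eq_integral[symmetric])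
qed

lemma measurable_marginal_lik:
  assumes joint: "(\<lambda>(\<theta>, x). g \<theta> x) \<in> borel_measurable (\<pi> \<Otimes>\<^sub>M M)" and "space M = UNIV"
  shows "marginal_lik \<Theta> \<phi> g n \<in> borel_measurable (\<Pi>\<^sub>M i\<in>{..<n}. M)"
proof -
  have meas: "(\<lambda>\<theta>. g \<theta> x) \<in> borel_measurable \<pi>" for x
    using measurable_Pair1[OF joint, of x] assms(2) by simp
  have "(\<lambda>p. g (snd p) (fst p i)) \<in> borel_measurable ((\<Pi>\<^sub>M i\<in>{..<n}. M) \<Otimes>\<^sub>M \<pi>)" if "i < n" for i
  proof -
    have "(\<lambda>p. (snd p, fst p i)) \<in> measurable ((\<Pi>\<^sub>M i\<in>{..<n}. M) \<Otimes>\<^sub>M \<pi>) (\<pi> \<Otimes>\<^sub>M M)"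
      using that by (intro measurable_Pair measurable_snd measurable_compose[OF measurable_fst] measurable_component_singleton) auto
    from measurable_compose[OF this joint] show ?thesis by simp
  qed
  then have "(\<lambda>(X, \<theta>). \<Prod>i<n. g \<theta> (X i)) \<in> borel_measurable ((\<Pi>\<^sub>M i\<in>{..<n}. M) \<Otimes>\<^sub>M \<pi>)"
    unfolding split_beta' by (intro borel_measurable_prod) auto
  then show ?thesis
    unfolding marginal_lik_eq[OF meas] by (intro borel_measurable_lebesgue_integral)
qed

end

section \<open>Reduction to a sigma-finite base measure and conclusion\<close>

text \<open>Since \<open>1 / 0 = 0\<close>, reweighting by \<open>1 / f0\<close> recovers
  \<open>\<mu>\<close> where \<open>f0\<close> is positive and deletes the rest, on which a law
  absolutely continuous with respect to that of \<open>f0\<close> has no mass.\<close>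

lemma law_eq_law_density:
  assumes [measurable]: "f0 \<in> borel_measurable \<mu>" "f \<in> borel_measurable \<mu>" and f0: "\<And>x. 0 \<le> f0 x"
    and ac: "absolutely_continuous (law \<mu> f0) (law \<mu> f)"
  shows "law (density (law \<mu> f0) (\<lambda>x. ennreal (1 / f0 x))) f = law \<mu> f"
proof -
  let ?Z = "{x \<in> space \<mu>. f0 x = 0}"
  have "?Z \<in> null_sets (law \<mu> f0)"
    by (subst null_sets_density_iff) auto
  then have "?Z \<in> null_sets (law \<mu> f)" using ac by (auto simp: absolutely_continuous_def)
  then have Z: "AE x in \<mu>. x \<in> ?Z \<longrightarrow> ennreal (f x) = 0"
    by (subst (asm) null_sets_density_iff) auto
  have "law (density (law \<mu> f0) (\<lambda>x. ennreal (1 / f0 x))) f =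
      density \<mu> (\<lambda>x. ennreal (f0 x) * ennreal (1 / f0 x) * ennreal (f x))"
    by (simp add: density_density_eq mult.assoc)
  also have "\<dots> = law \<mu> f"
  proof (rule density_cong)
    show "AE x in \<mu>. ennreal (f0 x) * ennreal (1 / f0 x) * ennreal (f x) = ennreal (f x)"
      using Z AE_space
    proof eventually_elim
      case (elim x)
      then show ?case
        using f0[of x] by (cases "f0 x = 0") (auto simp: ennreal_mult'[symmetric])
    qed
  qed auto
  finally show ?thesis .
qed

lemma chernoff_index_cong:
  "law \<mu> g = law M g \<Longrightarrow> law \<mu> h = law M h \<Longrightarrow> chernoff_index \<mu> g h = chernoff_index M g h"
  unfolding chernoff_index_def lr_rate_def lr_mgf_def by simp

text \<open>Tail sets of the score suprema may be non-measurable, so they are enlarged to measurable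
  sets of equal outer measure; the two scores produce the factor 2.\<close>

lemma score_tail_cover:
  assumes "outer_measure_of P {y. ereal x < S1 y} \<le> t" "outer_measure_of P {y. ereal x < S2 y} \<le> t"
    and "space P = UNIV" "N \<in> null_sets P"
  obtains B where "B \<in> sets P" "N \<union> {y. ereal x < S1 y} \<union> {y. ereal x < S2 y} \<subseteq> B" "emeasure P B \<le> 2 * t"
proof -
  obtain B1 where B1: "B1 \<in> sets P" "{y. ereal x < S1 y} \<subseteq> B1" "outer_measure_of P {y. ereal x < S1 y} = emeasure P B1"
    using outer_measure_of_attain[of "{y. ereal x < S1 y}" P] assms(3) by auto
  obtain B2 where B2: "B2 \<in> sets P" "{y. ereal x < S2 y} \<subseteq> B2" "outer_measure_of P {y. ereal x < S2 y} = emeasure P B2"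
    using outer_measure_of_attain[of "{y. ereal x < S2 y}" P] assms(3) by auto
  show thesis
  proof (rule that)
    show "N \<union> B1 \<union> B2 \<in> sets P" using assms(4) B1 B2 by auto
    have "emeasure P (N \<union> B1 \<union> B2) \<le> emeasure P (N \<union> B1) + emeasure P B2"
      using assms(4) B1 B2 by (intro emeasure_subadditive) auto
    also have "emeasure P (N \<union> B1) \<le> emeasure P N + emeasure P B1"
      using assms(4) B1 by (intro emeasure_subadditive) auto
    also have "\<dots> = emeasure P B1" using assms(4) by auto
    also have "\<dots> + emeasure P B2 \<le> t + t" using assms B1 B2 by (intro add_mono) auto
    finally show "emeasure P (N \<union> B1 \<union> B2) \<le> 2 * t" by (simp add: mult_2 add_mono)
  qed (use B1 B2 in auto)
qed

theorem theorem7: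
  fixes \<mu> :: "real measure"
    and \<Theta> :: "'a::euclidean_space set" and \<Gamma> :: "'b::euclidean_space set"
    and g :: "'a \<Rightarrow> real \<Rightarrow> real" and h :: "'b \<Rightarrow> real \<Rightarrow> real"
    and \<phi>\<^sub>g :: "'a \<Rightarrow> real" and \<phi>\<^sub>h :: "'b \<Rightarrow> real"
  assumes "sets \<mu> = sets borel"
    and "\<Theta> \<noteq> {}" and "\<Gamma> \<noteq> {}"
    and "density_family \<mu> \<Theta> g" and "density_family \<mu> \<Gamma> h"
    and "mutually_abs_cont ((\<lambda>\<theta>. law \<mu> (g \<theta>)) ` \<Theta> \<union> (\<lambda>\<gamma>. law \<mu> (h \<gamma>)) ` \<Gamma>)"
    and A1: "complete_separation \<mu> \<Theta> \<Gamma> g h"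
    and A2: "compact \<Theta>" "C1_boundary \<Theta>" "compact \<Gamma>" "C1_boundary \<Gamma>"
    and A3: "llr_differentiable \<mu> \<Theta> \<Gamma> g h" "score_tails \<mu> \<Theta> \<Gamma> g h"
    and "prior_density \<Theta> \<phi>\<^sub>g" and "prior_density \<Gamma> \<phi>\<^sub>h"
  shows "let BF = bayes_factor \<Theta> \<Gamma> \<phi>\<^sub>g \<phi>\<^sub>h g h;
             err\<^sub>g = (\<lambda>n \<theta>. prob_select_h \<mu> (g \<theta>) n (BF n));
             err\<^sub>h = (\<lambda>n \<gamma>. prob_select_g \<mu> (h \<gamma>) n (BF n));
             \<rho> = real_of_ereal (INF (\<theta>, \<gamma>)\<in>\<Theta> \<times> \<Gamma>. chernoff_index \<mu> (g \<theta>) (h \<gamma>))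
         in ((\<lambda>n. ln (LINT \<theta>:\<Theta>|lborel. err\<^sub>g n \<theta> * \<phi>\<^sub>g \<theta>))
               \<sim>[sequentially] (\<lambda>n. SUP \<theta>\<in>\<Theta>. ln (err\<^sub>g n \<theta>))) \<and>
            ((\<lambda>n. SUP \<theta>\<in>\<Theta>. ln (err\<^sub>g n \<theta>))
               \<sim>[sequentially] (\<lambda>n. ln (LINT \<gamma>:\<Gamma>|lborel. err\<^sub>h n \<gamma> * \<phi>\<^sub>h \<gamma>))) \<and>
            ((\<lambda>n. ln (LINT \<gamma>:\<Gamma>|lborel. err\<^sub>h n \<gamma> * \<phi>\<^sub>h \<gamma>))
               \<sim>[sequentially] (\<lambda>n. SUP \<gamma>\<in>\<Gamma>. ln (err\<^sub>h n \<gamma>))) \<and>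
            ((\<lambda>n. SUP \<gamma>\<in>\<Gamma>. ln (err\<^sub>h n \<gamma>))
               \<sim>[sequentially] (\<lambda>n. - (real n * \<rho>)))"
proof -
  obtain \<theta>0 \<gamma>0 where \<theta>0: "\<theta>0 \<in> \<Theta>" and \<gamma>0: "\<gamma>0 \<in> \<Gamma>" using assms(2,3) by blast
  interpret G: compact_prior \<Theta> \<phi>\<^sub>g by unfold_locales fact+
  interpret H: compact_prior \<Gamma> \<phi>\<^sub>h by unfold_locales fact+
  let ?\<pi> = "prior_measure \<Theta> \<phi>\<^sub>g" and ?\<nu> = "prior_measure \<Gamma> \<phi>\<^sub>h"
  note sets_\<mu> = assms(1)
  have space_\<mu>: "space \<mu> = UNIV" using sets_eq_imp_space_eq[OF sets_\<mu>] by simp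
  have gn: "\<And>\<theta> x. \<theta> \<in> \<Theta> \<Longrightarrow> 0 \<le> g \<theta> x" and gp: "\<And>\<theta>. \<theta> \<in> \<Theta> \<Longrightarrow> prob_space (law \<mu> (g \<theta>))"
    and hn: "\<And>\<gamma> x. \<gamma> \<in> \<Gamma> \<Longrightarrow> 0 \<le> h \<gamma> x" and hp: "\<And>\<gamma>. \<gamma> \<in> \<Gamma> \<Longrightarrow> prob_space (law \<mu> (h \<gamma>))"
    using assms(4,5) by (auto simp: density_family_def)

  \<comment> \<open>\<open>\<mu>\<close> need not be \<open>\<sigma>\<close>-finite; its restriction \<open>M\<close> to the common support is, and has the same laws.\<close>
  define M where "M = density (law \<mu> (g \<theta>0)) (\<lambda>x. ennreal (1 / g \<theta>0 x))"
  have sets_M [measurable_cong]: "sets M = sets borel" by (simp add: M_def sets_\<mu>)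
  have space_M: "space M = UNIV" using sets_eq_imp_space_eq[OF sets_M] by simp
  have joint_g: "(\<lambda>(\<theta>, x). g \<theta> x) \<in> borel_measurable (?\<pi> \<Otimes>\<^sub>M M)"
    using assms(4) unfolding density_family_def
    by (subst measurable_cong_sets[OF sets_pair_measure_cong[OF G.sets_prior sets_M] refl]) auto
  have joint_h: "(\<lambda>(\<gamma>, x). h \<gamma> x) \<in> borel_measurable (?\<nu> \<Otimes>\<^sub>M M)"
    using assms(5) unfolding density_family_def
    by (subst measurable_cong_sets[OF sets_pair_measure_cong[OF H.sets_prior sets_M] refl]) auto
  have g_meas: "g \<theta> \<in> borel_measurable \<mu>" if "\<theta> \<in> \<Theta>" for \<theta>
    using measurable_Pair2[OF joint_g, of \<theta>] that sets_M sets_\<mu> by (simp cong: measurable_cong_sets)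
  have h_meas: "h \<gamma> \<in> borel_measurable \<mu>" if "\<gamma> \<in> \<Gamma>" for \<gamma>
    using measurable_Pair2[OF joint_h, of \<gamma>] that sets_M sets_\<mu> by (simp cong: measurable_cong_sets)
  have g_param: "(\<lambda>\<theta>. g \<theta> x) \<in> borel_measurable ?\<pi>" for x
    using measurable_Pair1[OF joint_g, of x] space_M by simp
  have h_param: "(\<lambda>\<gamma>. h \<gamma> x) \<in> borel_measurable ?\<nu>" for x
    using measurable_Pair1[OF joint_h, of x] space_M by simp

  have law_g: "law M (g \<theta>) = law \<mu> (g \<theta>)" if "\<theta> \<in> \<Theta>" for \<theta>
    unfolding M_def using assms(6) \<theta>0 that
    by (intro law_eq_law_density g_meas gn) (auto simp: mutually_abs_cont_def)
  have law_h: "law M (h \<gamma>) = law \<mu> (h \<gamma>)" if "\<gamma> \<in> \<Gamma>" for \<gamma>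
    unfolding M_def using assms(6) \<theta>0 that
    by (intro law_eq_law_density g_meas h_meas gn) (auto simp: mutually_abs_cont_def)
  have "sigma_finite_measure M"
  proof -
    interpret P: prob_space "law \<mu> (g \<theta>0)" by (rule gp[OF \<theta>0])
    show ?thesis unfolding M_def using g_meas[OF \<theta>0]
      by (subst P.sigma_finite_iff_density_finite) auto
  qed
  then interpret M: sigma_finite_measure M .

  \<comment> \<open>Regularity is imposed for all parameter pairs at once, so that one null set
    serves the uncountable families.\<close>
  define R where "R = {x. \<forall>\<theta>\<in>\<Theta>. \<forall>\<gamma>\<in>\<Gamma>. 0 < g \<theta> x \<and> 0 < h \<gamma> x \<and>
        (\<lambda>t. log_lr (g t) (h \<gamma>) x) differentiable (at \<theta> within \<Theta>) \<and>
        (\<lambda>c. log_lr (g \<theta>) (h c) x) differentiable (at \<gamma> within \<Gamma>)}"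
  have AE_R: "AE x in M. x \<in> R"
  proof -
    have "AE x in law \<mu> (g \<theta>0). x \<in> R" using A3(1) \<theta>0 by (auto simp: llr_differentiable_def R_def)
    then show ?thesis unfolding M_def using g_meas[OF \<theta>0]
      by (subst AE_density) (auto elim: eventually_mono)
  qed
  have R_pos: "0 < g \<theta> x" "0 < h \<gamma> x" if "x \<in> R" "\<theta> \<in> \<Theta>" "\<gamma> \<in> \<Gamma>" for x \<theta> \<gamma>
    using that by (auto simp: R_def)
  have R_cont: "continuous_on \<Theta> (\<lambda>\<theta>. g \<theta> x)" "continuous_on \<Gamma> (\<lambda>\<gamma>. h \<gamma> x)" if "x \<in> R" for x
  proof -
    have "continuous_on \<Theta> (\<lambda>t. log_lr (g t) (h \<gamma>0) x)" "continuous_on \<Gamma> (\<lambda>c. log_lr (g \<theta>0) (h c) x)"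
      using that \<theta>0 \<gamma>0 unfolding continuous_on_eq_continuous_within
      by (auto simp: R_def intro!: differentiable_imp_continuous_within)
    \<comment> \<open>With the other parameter fixed, the log-likelihood ratio is the log-density up
      to sign and a constant; exponentiating recovers continuity of the densities.\<close>
    then have "continuous_on \<Theta> (\<lambda>t. exp (ln (h \<gamma>0 x) - log_lr (g t) (h \<gamma>0) x))"
      "continuous_on \<Gamma> (\<lambda>c. exp (ln (g \<theta>0 x) + log_lr (g \<theta>0) (h c) x))"
      by (intro continuous_intros; simp)+
    then show "continuous_on \<Theta> (\<lambda>\<theta>. g \<theta> x)" "continuous_on \<Gamma> (\<lambda>\<gamma>. h \<gamma> x)"
      using R_pos[OF that _ \<gamma>0] R_pos[OF that \<theta>0] by (simp_all add: log_lr_def cong: continuous_on_cong)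
  qed
  have pair: "density_pair M (g \<theta>) (h \<gamma>)" if "\<theta> \<in> \<Theta>" "\<gamma> \<in> \<Gamma>" for \<theta> \<gamma>
  proof -
    have m: "g \<theta> \<in> borel_measurable M" "h \<gamma> \<in> borel_measurable M"
      using g_meas[OF that(1)] h_meas[OF that(2)] sets_M sets_\<mu> by (simp_all cong: measurable_cong_sets)
    have "AE x in M. 0 < g \<theta> x \<and> 0 < h \<gamma> x" using AE_R by eventually_elim (use R_pos that in auto)
    then show ?thesis
      using gp hp gn hn law_g law_h m that by (intro density_pairI M.sigma_finite_measure_axioms) auto
  qed

  obtain \<theta>m \<gamma>m where opt: "\<theta>m \<in> \<Theta>" "\<gamma>m \<in> \<Gamma>"
    "\<And>\<theta> \<gamma>. \<theta> \<in> \<Theta> \<Longrightarrow> \<gamma> \<in> \<Gamma> \<Longrightarrow> min_affinity M (g \<theta>) (h \<gamma>) \<le> min_affinity M (g \<theta>m) (h \<gamma>m)"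
  proof (rule min_affinity_attains_sup[OF A2(1) assms(2) A2(3) assms(3) pair])
    show "AE x in M. continuous_on \<Theta> (\<lambda>\<theta>. g \<theta> x) \<and> continuous_on \<Gamma> (\<lambda>\<gamma>. h \<gamma> x)"
      using AE_R by eventually_elim (use R_cont in auto)
  qed auto
  define \<alpha> where "\<alpha> = min_affinity M (g \<theta>m) (h \<gamma>m)"
  have chernoff: "chernoff_index \<mu> (g \<theta>) (h \<gamma>) = ereal (- ln (min_affinity M (g \<theta>) (h \<gamma>)))"
    "min_affinity M (g \<theta>) (h \<gamma>) < 1" if "\<theta> \<in> \<Theta>" "\<gamma> \<in> \<Gamma>" for \<theta> \<gamma>
  proof -
    interpret P: density_pair M "g \<theta>" "h \<gamma>" by (rule pair[OF that])
    have "0 < ext_mean (law \<mu> (g \<theta>)) (\<lambda>x. ln (g \<theta> x) - ln (h \<gamma> x))"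
      using A1 that unfolding complete_separation_def by (fastforce dest: less_INF_D)
    also have "\<dots> = ext_mean (law M (g \<theta>)) (\<lambda>x. - log_lr (g \<theta>) (h \<gamma>) x)"
      using that by (simp add: law_g log_lr_def)
    also have "\<dots> = - ext_mean (law M (g \<theta>)) (log_lr (g \<theta>) (h \<gamma>))" by (rule P.ext_mean_neg_log_lr)
    finally have "ext_mean (law M (g \<theta>)) (log_lr (g \<theta>) (h \<gamma>)) < 0"
      by (simp add: ereal_less_uminus_reorder)
    from P.chernoff_index_eq[OF this]
    show "chernoff_index \<mu> (g \<theta>) (h \<gamma>) = ereal (- ln (min_affinity M (g \<theta>) (h \<gamma>)))"
      "min_affinity M (g \<theta>) (h \<gamma>) < 1"
      using chernoff_index_cong[OF law_g[OF that(1), symmetric] law_h[OF that(2), symmetric]] by auto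
  qed
  have "(INF (\<theta>, \<gamma>)\<in>\<Theta> \<times> \<Gamma>. chernoff_index \<mu> (g \<theta>) (h \<gamma>)) = ereal (- ln \<alpha>)"
  proof (rule antisym)
    show "(INF (\<theta>, \<gamma>)\<in>\<Theta> \<times> \<Gamma>. chernoff_index \<mu> (g \<theta>) (h \<gamma>)) \<le> ereal (- ln \<alpha>)"
      using opt(1,2) by (intro INF_lower2[of "(\<theta>m, \<gamma>m)"]) (auto simp: chernoff \<alpha>_def)
    show "ereal (- ln \<alpha>) \<le> (INF (\<theta>, \<gamma>)\<in>\<Theta> \<times> \<Gamma>. chernoff_index \<mu> (g \<theta>) (h \<gamma>))"
    proof (rule INF_greatest, clarsimp simp: chernoff)
      fix \<theta> \<gamma> assume *: "\<theta> \<in> \<Theta>" "\<gamma> \<in> \<Gamma>"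
      then show "ln (min_affinity M (g \<theta>) (h \<gamma>)) \<le> ln \<alpha>"
        using opt(3)[OF *] density_pair.min_affinity_pos[OF pair[OF *]] by (simp add: \<alpha>_def)
    qed
  qed
  then have \<rho>: "real_of_ereal (INF (\<theta>, \<gamma>)\<in>\<Theta> \<times> \<Gamma>. chernoff_index \<mu> (g \<theta>) (h \<gamma>)) = - ln \<alpha>" by simp

  obtain \<eta> x0 where \<eta>: "0 < \<eta>" "0 < x0" and tails: "\<And>x S \<theta> \<gamma>. x0 < x \<Longrightarrow>
      S \<in> {score_sup1 \<Theta> \<Gamma> g h, score_sup2 \<Theta> \<Gamma> g h} \<Longrightarrow> \<theta> \<in> \<Theta> \<Longrightarrow> \<gamma> \<in> \<Gamma> \<Longrightarrow>
      max (outer_measure_of (law \<mu> (g \<theta>)) {y. ereal x < S y}) (outer_measure_of (law \<mu> (h \<gamma>)) {y. ereal x < S y})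
        \<le> ennreal (exp (- (ln x powr (1 + \<eta>))))"
  proof -
    obtain \<eta> x0 where e: "0 < \<eta>" "0 < x0" and t: "\<forall>x>x0. \<forall>S\<in>{score_sup1 \<Theta> \<Gamma> g h, score_sup2 \<Theta> \<Gamma> g h}.
        (SUP (\<theta>, \<gamma>)\<in>\<Theta> \<times> \<Gamma>.
           max (outer_measure_of (law \<mu> (g \<theta>)) {y. ereal x < S y})
               (outer_measure_of (law \<mu> (h \<gamma>)) {y. ereal x < S y}))
        \<le> ennreal (exp (- (ln x powr (1 + \<eta>))))"
      using A3(2) unfolding score_tails_def by blast
    show thesis
    proof (rule that[OF e])
      fix x S \<theta> \<gamma> assume *: "x0 < x" "S \<in> {score_sup1 \<Theta> \<Gamma> g h, score_sup2 \<Theta> \<Gamma> g h}" "\<theta> \<in> \<Theta>" "\<gamma> \<in> \<Gamma>"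
      show "max (outer_measure_of (law \<mu> (g \<theta>)) {y. ereal x < S y}) (outer_measure_of (law \<mu> (h \<gamma>)) {y. ereal x < S y})
        \<le> ennreal (exp (- (ln x powr (1 + \<eta>))))"
        using * by (intro order_trans[OF _ t[rule_format, OF *(1,2)]] SUP_upper2[of "(\<theta>, \<gamma>)"]) auto
    qed
  qed
  \<comment> \<open>Strictly between \<open>1 / (1 + \<eta>)\<close> and 1: the truncation level
    \<open>L n\<close> stays subexponential, while \<open>\<xi> > 1\<close> makes the probability of
    exceeding it superexponentially small.\<close>
  define \<beta> where "\<beta> = 1 / (1 + \<eta> / 2)"
  define \<xi> where "\<xi> = \<beta> * (1 + \<eta>)"
  have \<beta>: "0 < \<beta>" "\<beta> < 1" "1 < \<xi>" using \<eta>(1) by (auto simp: \<beta>_def \<xi>_def field_simps)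
  define L where "L n = exp (real n powr \<beta>)" for n :: nat
  define \<tau> where "\<tau> n = 2 * exp (- (real n powr \<xi>))" for n :: nat
  have L1: "1 \<le> L n" for n by (simp add: L_def)
  have L_subexp: "\<forall>\<^sub>F n in sequentially. L n \<le> exp (c * n)" if "0 < c" for c :: real
    unfolding L_def using eventually_powr_le_linear[OF \<beta>(2) that] by simp
  have L_large: "\<forall>\<^sub>F n in sequentially. x0 < L n"
    using eventually_powr_ge[OF \<beta>(1), of "x0"]
  proof eventually_elim
    case (elim n)
    have "x0 < exp x0" using exp_ge_add_one_self[of x0] by linarith
    also have "\<dots> \<le> L n" using elim by (simp add: L_def)
    finally show ?case .
  qed
  have \<tau>_eq: "2 * ennreal (exp (- (ln (L n) powr (1 + \<eta>)))) = ennreal (\<tau> n)" for n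
    by (simp add: L_def \<tau>_def powr_powr \<xi>_def ennreal_mult')
  define W where "W n = {x \<in> R. score_sup1 \<Theta> \<Gamma> g h x \<le> L n \<and> score_sup2 \<Theta> \<Gamma> g h x \<le> L n}" for n
  obtain N where N: "N \<in> null_sets M" "UNIV - R \<subseteq> N"
    using AE_R unfolding eventually_ae_filter by (auto simp: space_M)
  have cover: "\<exists>B\<in>sets M. space M - W n \<subseteq> B \<and> emeasure (law M f) B \<le> ennreal (\<tau> n)"
    if f: "f \<in> borel_measurable M" and "outer_measure_of (law M f) {y. ereal (L n) < score_sup1 \<Theta> \<Gamma> g h y} \<le> ennreal (exp (- (ln (L n) powr (1 + \<eta>))))"
      "outer_measure_of (law M f) {y. ereal (L n) < score_sup2 \<Theta> \<Gamma> g h y} \<le> ennreal (exp (- (ln (L n) powr (1 + \<eta>))))" for f n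
  proof -
    have "absolutely_continuous M (law M f)" using f by (intro absolutely_continuousI_density) auto
    then have "N \<in> null_sets (law M f)" using N(1) by (auto simp: absolutely_continuous_def)
    from score_tail_cover[OF that(2,3) _ this] obtain B where B: "B \<in> sets (law M f)"
      "N \<union> {y. ereal (L n) < score_sup1 \<Theta> \<Gamma> g h y} \<union> {y. ereal (L n) < score_sup2 \<Theta> \<Gamma> g h y} \<subseteq> B"
      "emeasure (law M f) B \<le> ennreal (\<tau> n)"
      unfolding \<tau>_eq by (auto simp: space_M)
    have "space M - W n \<subseteq> B" using B(2) N(2) by (auto simp: W_def space_M not_le)
    then show ?thesis using B by auto
  qed
  have M_meas: "g \<theta> \<in> borel_measurable M" "h \<gamma> \<in> borel_measurable M" if "\<theta> \<in> \<Theta>" "\<gamma> \<in> \<Gamma>" for \<theta> \<gamma>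
    using g_meas h_meas that sets_M sets_\<mu> by (simp_all cong: measurable_cong_sets)
  have exc_g: "\<forall>\<^sub>F n in sequentially. \<forall>\<theta>\<in>space ?\<pi>. \<exists>B\<in>sets M. space M - W n \<subseteq> B \<and>
      emeasure (law M (g \<theta>)) B \<le> ennreal (\<tau> n)"
    using L_large
  proof eventually_elim
    case (elim n)
    show ?case
    proof
      fix \<theta> assume "\<theta> \<in> space ?\<pi>"
      then have \<theta>: "\<theta> \<in> \<Theta>" by simp
      show "\<exists>B\<in>sets M. space M - W n \<subseteq> B \<and> emeasure (law M (g \<theta>)) B \<le> ennreal (\<tau> n)"
        using tails[OF elim _ \<theta> \<gamma>0] by (intro cover M_meas(1)[OF \<theta> \<gamma>0]) (auto simp: law_g[OF \<theta>])
    qed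
  qed
  have exc_h: "\<forall>\<^sub>F n in sequentially. \<forall>\<gamma>\<in>space ?\<nu>. \<exists>B\<in>sets M. space M - W n \<subseteq> B \<and>
      emeasure (law M (h \<gamma>)) B \<le> ennreal (\<tau> n)"
    using L_large
  proof eventually_elim
    case (elim n)
    show ?case
    proof
      fix \<gamma> assume "\<gamma> \<in> space ?\<nu>"
      then have \<gamma>: "\<gamma> \<in> \<Gamma>" by simp
      show "\<exists>B\<in>sets M. space M - W n \<subseteq> B \<and> emeasure (law M (h \<gamma>)) B \<le> ennreal (\<tau> n)"
        using tails[OF elim _ \<theta>0 \<gamma>] by (intro cover M_meas(2)[OF \<theta>0 \<gamma>]) (auto simp: law_h[OF \<gamma>])
    qed
  qed

  obtain eg where eg: "0 < eg" "\<And>p. p \<in> \<Theta> \<Longrightarrow> cone_at \<Theta> eg p"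
    using C1_boundary_uniform_cone[OF A2(1,2)] by blast
  obtain eh where eh: "0 < eh" "\<And>p. p \<in> \<Gamma> \<Longrightarrow> cone_at \<Gamma> eh p"
    using C1_boundary_uniform_cone[OF A2(3,4)] by blast
  have lip_g: "\<bar>ln (g \<theta> x) - ln (g \<theta>' x)\<bar> \<le> 9 * L n * norm (\<theta> - \<theta>')"
    if "x \<in> W n" "\<theta> \<in> \<Theta>" "\<theta>' \<in> \<Theta>" "4 * norm (\<theta> - \<theta>') < eg" for n x \<theta> \<theta>'
  proof -
    \<comment> \<open>The term of \<open>\<gamma>0\<close> cancels in the difference, so the score
      of the log-likelihood ratio controls \<open>ln (g \<theta> x)\<close> itself.\<close>
    have "\<bar>log_lr (g \<theta>) (h \<gamma>0) x - log_lr (g \<theta>') (h \<gamma>0) x\<bar> \<le> 9 * L n * norm (\<theta> - \<theta>')"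
    proof (rule cone_at_lipschitz[OF eg(2)[OF that(2)] that(2-4), where f = "\<lambda>t. log_lr (g t) (h \<gamma>0) x"])
      fix p assume p: "p \<in> \<Theta>"
      show "(\<lambda>t. log_lr (g t) (h \<gamma>0) x) differentiable (at p within \<Theta>)"
        using that(1) p \<gamma>0 by (auto simp: W_def R_def)
      have "ereal (norm (grad (\<lambda>t. log_lr (g t) (h \<gamma>0) x) (at p within \<Theta>))) \<le> score_sup1 \<Theta> \<Gamma> g h x"
        unfolding score_sup1_def using p \<gamma>0 by (intro SUP_upper2[of "(p, \<gamma>0)"]) auto
      also have "\<dots> \<le> ereal (L n)" using that(1) by (simp add: W_def)
      finally show "norm (grad (\<lambda>t. log_lr (g t) (h \<gamma>0) x) (at p within \<Theta>)) \<le> L n" by simp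
    qed
    then show ?thesis by (simp add: log_lr_def abs_minus_commute)
  qed
  have lip_h: "\<bar>ln (h \<gamma> x) - ln (h \<gamma>' x)\<bar> \<le> 9 * L n * norm (\<gamma> - \<gamma>')"
    if "x \<in> W n" "\<gamma> \<in> \<Gamma>" "\<gamma>' \<in> \<Gamma>" "4 * norm (\<gamma> - \<gamma>') < eh" for n x \<gamma> \<gamma>'
  proof -
    have "\<bar>log_lr (g \<theta>0) (h \<gamma>) x - log_lr (g \<theta>0) (h \<gamma>') x\<bar> \<le> 9 * L n * norm (\<gamma> - \<gamma>')"
    proof (rule cone_at_lipschitz[OF eh(2)[OF that(2)] that(2-4), where f = "\<lambda>c. log_lr (g \<theta>0) (h c) x"])
      fix p assume p: "p \<in> \<Gamma>"
      show "(\<lambda>c. log_lr (g \<theta>0) (h c) x) differentiable (at p within \<Gamma>)"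
        using that(1) p \<theta>0 by (auto simp: W_def R_def)
      have "ereal (norm (grad (\<lambda>c. log_lr (g \<theta>0) (h c) x) (at p within \<Gamma>))) \<le> score_sup2 \<Theta> \<Gamma> g h x"
        unfolding score_sup2_def using p \<theta>0 by (intro SUP_upper2[of "(\<theta>0, p)"]) auto
      also have "\<dots> \<le> ereal (L n)" using that(1) by (simp add: W_def)
      finally show "norm (grad (\<lambda>c. log_lr (g \<theta>0) (h c) x) (at p within \<Gamma>)) \<le> L n" by simp
    qed
    then show ?thesis by (simp add: log_lr_def)
  qed
  have W_pos: "0 < g \<theta> x" "0 < h \<gamma> x" if "x \<in> W n" "\<theta> \<in> \<Theta>" "\<gamma> \<in> \<Gamma>" for n x \<theta> \<gamma>
    using R_pos that by (auto simp: W_def)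

  obtain \<kappa>g :: "nat \<Rightarrow> real" and T where \<kappa>g: "\<And>n. 1 \<le> \<kappa>g n" "\<And>c::real. 0 < c \<Longrightarrow> \<forall>\<^sub>F n in sequentially. \<kappa>g n \<le> exp (c * n)"
    and net_g: "\<forall>\<^sub>F n in sequentially. T n \<subseteq> \<Theta> \<and> finite (T n) \<and> card (T n) \<le> \<kappa>g n"
    and sandwich_g: "\<forall>\<^sub>F n in sequentially. \<forall>X\<in>space (\<Pi>\<^sub>M i\<in>{..<n}. M). (\<forall>i<n. X i \<in> W n) \<longrightarrow>
      (\<forall>\<theta>\<in>\<Theta>. ennreal (\<Prod>i<n. g \<theta> (X i)) \<le> \<kappa>g n * mixture_lik ?\<pi> g n X) \<and>
      (\<exists>\<theta>\<in>T n. mixture_lik ?\<pi> g n X \<le> \<kappa>g n * ennreal (\<Prod>i<n. g \<theta> (X i)))"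
  proof (rule G.subexponential_sandwich[where W = W and M = M and g = g and L = L, OF eg(1)])
    show "cone_at \<Theta> eg p" if "p \<in> \<Theta>" for p using that by (rule eg(2))
    show "0 < g \<theta> x" if "x \<in> W n" "\<theta> \<in> \<Theta>" for n x \<theta> using that \<gamma>0 by (rule W_pos(1))
  qed (rule L1 L_subexp g_param lip_g that; assumption)+
  obtain \<kappa>h :: "nat \<Rightarrow> real" and U where \<kappa>h: "\<And>n. 1 \<le> \<kappa>h n" "\<And>c::real. 0 < c \<Longrightarrow> \<forall>\<^sub>F n in sequentially. \<kappa>h n \<le> exp (c * n)"
    and net_h: "\<forall>\<^sub>F n in sequentially. U n \<subseteq> \<Gamma> \<and> finite (U n) \<and> card (U n) \<le> \<kappa>h n"
    and sandwich_h: "\<forall>\<^sub>F n in sequentially. \<forall>X\<in>space (\<Pi>\<^sub>M i\<in>{..<n}. M). (\<forall>i<n. X i \<in> W n) \<longrightarrow>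
      (\<forall>\<gamma>\<in>\<Gamma>. ennreal (\<Prod>i<n. h \<gamma> (X i)) \<le> \<kappa>h n * mixture_lik ?\<nu> h n X) \<and>
      (\<exists>\<gamma>\<in>U n. mixture_lik ?\<nu> h n X \<le> \<kappa>h n * ennreal (\<Prod>i<n. h \<gamma> (X i)))"
  proof (rule H.subexponential_sandwich[where W = W and M = M and g = h and L = L, OF eh(1)])
    show "cone_at \<Gamma> eh p" if "p \<in> \<Gamma>" for p using that by (rule eh(2))
    show "0 < h \<gamma> x" if "x \<in> W n" "\<gamma> \<in> \<Gamma>" for n x \<gamma> using that(1) \<theta>0 that(2) by (rule W_pos(2))
  qed (rule L1 L_subexp h_param lip_h that; assumption)+
  \<comment> \<open>Both factors are at least 1, so the product dominates each; a common \<kappa> is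
    what permits exchanging the families.\<close>
  define \<kappa> where "\<kappa> n = \<kappa>g n * \<kappa>h n" for n
  have \<kappa>: "\<kappa>g n \<le> \<kappa> n" "\<kappa>h n \<le> \<kappa> n" "1 \<le> \<kappa> n" for n
  proof -
    show "\<kappa>g n \<le> \<kappa> n" "\<kappa>h n \<le> \<kappa> n"
      using mult_mono[of "\<kappa>g n" "\<kappa>g n" 1 "\<kappa>h n"] mult_mono[of 1 "\<kappa>g n" "\<kappa>h n" "\<kappa>h n"] \<kappa>g(1)[of n] \<kappa>h(1)[of n]
      by (auto simp: \<kappa>_def)
    then show "1 \<le> \<kappa> n" using \<kappa>g(1)[of n] by linarith
  qed
  have \<kappa>_subexp: "\<forall>\<^sub>F n in sequentially. \<kappa> n \<le> exp (c * n)" if c: "0 < c" for c :: real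
    using \<kappa>g(2)[OF half_gt_zero[OF c]] \<kappa>h(2)[OF half_gt_zero[OF c]]
  proof eventually_elim
    case (elim n)
    then have "\<kappa> n \<le> exp (c / 2 * n) * exp (c / 2 * n)"
      unfolding \<kappa>_def using \<kappa>g(1)[of n] \<kappa>h(1)[of n] by (intro mult_mono) auto
    then show ?case by (simp flip: exp_add)
  qed
  have \<kappa>_mono: "ennreal (\<kappa>g n) * a \<le> ennreal (\<kappa> n) * a" "ennreal (\<kappa>h n) * a \<le> ennreal (\<kappa> n) * a" for n a
    using \<kappa>[of n] by (auto intro!: mult_right_mono ennreal_leI)
  have \<tau>_nonneg: "0 \<le> \<tau> n" for n by (simp add: \<tau>_def)
  have \<tau>_superexp: "\<forall>\<^sub>F n in sequentially. n * \<tau> n \<le> exp (- c * n)" for c :: real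
    unfolding \<tau>_def by (rule eventually_superexp[OF \<beta>(3)])

  interpret LG: likelihood_family M ?\<pi> g W T \<kappa> \<tau>
  proof (intro likelihood_family.intro likelihood_family_axioms.intro M.sigma_finite_measure_axioms G.prob_space_prior)
    show "\<forall>\<^sub>F n in sequentially. T n \<subseteq> space ?\<pi> \<and> finite (T n) \<and> card (T n) \<le> \<kappa> n"
      using net_g unfolding G.space_prior by eventually_elim (meson \<kappa>(1) order_trans)
    show "\<forall>\<^sub>F n in sequentially. \<forall>X\<in>space (\<Pi>\<^sub>M i\<in>{..<n}. M). (\<forall>i<n. X i \<in> W n) \<longrightarrow>
      (\<forall>\<theta>\<in>space ?\<pi>. ennreal (\<Prod>i<n. g \<theta> (X i)) \<le> \<kappa> n * mixture_lik ?\<pi> g n X) \<and>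
      (\<exists>\<theta>\<in>T n. mixture_lik ?\<pi> g n X \<le> \<kappa> n * ennreal (\<Prod>i<n. g \<theta> (X i)))"
      using sandwich_g unfolding G.space_prior by eventually_elim (blast intro: order_trans[OF _ \<kappa>_mono(1)])
    show "AE x in M. 0 < g \<theta> x" if "\<theta> \<in> space ?\<pi>" for \<theta>
      using AE_R by eventually_elim (use R_pos(1)[OF _ _ \<gamma>0] that in auto)
    show "0 \<le> g \<theta> x" if "\<theta> \<in> space ?\<pi>" for \<theta> x using gn that by simp
    show "prob_space (law M (g \<theta>))" if "\<theta> \<in> space ?\<pi>" for \<theta> using gp law_g that by simp
  qed (rule joint_g \<kappa>(3) \<kappa>_subexp \<tau>_nonneg \<tau>_superexp exc_g; assumption?)+
  interpret LH: likelihood_family M ?\<nu> h W U \<kappa> \<tau>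
  proof (intro likelihood_family.intro likelihood_family_axioms.intro M.sigma_finite_measure_axioms H.prob_space_prior)
    show "\<forall>\<^sub>F n in sequentially. U n \<subseteq> space ?\<nu> \<and> finite (U n) \<and> card (U n) \<le> \<kappa> n"
      using net_h unfolding H.space_prior by eventually_elim (meson \<kappa>(2) order_trans)
    show "\<forall>\<^sub>F n in sequentially. \<forall>X\<in>space (\<Pi>\<^sub>M i\<in>{..<n}. M). (\<forall>i<n. X i \<in> W n) \<longrightarrow>
      (\<forall>\<gamma>\<in>space ?\<nu>. ennreal (\<Prod>i<n. h \<gamma> (X i)) \<le> \<kappa> n * mixture_lik ?\<nu> h n X) \<and>
      (\<exists>\<gamma>\<in>U n. mixture_lik ?\<nu> h n X \<le> \<kappa> n * ennreal (\<Prod>i<n. h \<gamma> (X i)))"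
      using sandwich_h unfolding H.space_prior by eventually_elim (blast intro: order_trans[OF _ \<kappa>_mono(2)])
    show "AE x in M. 0 < h \<gamma> x" if "\<gamma> \<in> space ?\<nu>" for \<gamma>
      using AE_R by eventually_elim (use R_pos(2)[OF _ \<theta>0] that in auto)
    show "0 \<le> h \<gamma> x" if "\<gamma> \<in> space ?\<nu>" for \<gamma> x using hn that by simp
    show "prob_space (law M (h \<gamma>))" if "\<gamma> \<in> space ?\<nu>" for \<gamma> using hp law_h that by simp
  qed (rule joint_h \<kappa>(3) \<kappa>_subexp \<tau>_nonneg \<tau>_superexp exc_h; assumption?)+

  define BF where "BF = bayes_factor \<Theta> \<Gamma> \<phi>\<^sub>g \<phi>\<^sub>h g h"
  define E where "E n = {X \<in> space (\<Pi>\<^sub>M i\<in>{..<n}. M). BF n X > 1}" for n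
  have BF_meas: "BF n \<in> borel_measurable (\<Pi>\<^sub>M i\<in>{..<n}. M)" for n
  proof -
    note [measurable] = G.measurable_marginal_lik[OF joint_g space_M, of n]
      H.measurable_marginal_lik[OF joint_h space_M, of n]
    show ?thesis unfolding BF_def bayes_factor_def[abs_def] by measurable
  qed
  interpret T: bayes_test M ?\<pi> ?\<nu> g h W T U \<kappa> \<tau> E \<alpha>
  proof unfold_locales
    show "E n \<in> sets (\<Pi>\<^sub>M i\<in>{..<n}. M)" for n
      unfolding E_def using BF_meas by measurable
    show "\<exists>\<theta>\<in>space ?\<pi>. \<exists>\<gamma>\<in>space ?\<nu>. min_affinity M (g \<theta>) (h \<gamma>) = \<alpha>"
      using opt(1,2) by (auto simp: \<alpha>_def)
    show "\<alpha> < 1" using chernoff(2) opt(1,2) by (simp add: \<alpha>_def)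
    show "min_affinity M (g \<theta>) (h \<gamma>) \<le> \<alpha>" if "\<theta> \<in> space ?\<pi>" "\<gamma> \<in> space ?\<nu>" for \<theta> \<gamma>
      using opt(3) that by (simp add: \<alpha>_def)
    show "\<forall>\<^sub>F n in sequentially. \<forall>X\<in>space (\<Pi>\<^sub>M i\<in>{..<n}. M). (\<forall>i<n. X i \<in> W n) \<longrightarrow>
      (X \<in> E n \<longrightarrow> mixture_lik ?\<pi> g n X \<le> mixture_lik ?\<nu> h n X) \<and>
      (X \<notin> E n \<longrightarrow> mixture_lik ?\<nu> h n X \<le> mixture_lik ?\<pi> g n X)"
      using LG.sandwich LH.sandwich
    proof (eventually_elim, intro ballI impI)
      case (elim n)
      fix X assume X: "X \<in> space (\<Pi>\<^sub>M i\<in>{..<n}. M)" "\<forall>i<n. X i \<in> W n"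
      let ?a = "marginal_lik \<Theta> \<phi>\<^sub>g g n X" and ?b = "marginal_lik \<Gamma> \<phi>\<^sub>h h n X"
      \<comment> \<open>The upper comparison bounds each mixture by a finite multiple of one finite
        likelihood.\<close>
      have fin: "mixture_lik ?\<pi> g n X \<noteq> \<infinity>" "mixture_lik ?\<nu> h n X \<noteq> \<infinity>"
        using elim X by (fastforce simp: ennreal_mult_eq_top_iff top_unique)+
      have a: "ennreal ?a = mixture_lik ?\<pi> g n X"
        using fin(1) gn by (intro G.ennreal_marginal_lik g_param)
      have b: "ennreal ?b = mixture_lik ?\<nu> h n X"
        using fin(2) hn by (intro H.ennreal_marginal_lik h_param)
      \<comment> \<open>Through the lower comparison a positive likelihood forces a positive
        denominator, so the quotient is not the default \<open>x / 0 = 0\<close> and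
        \<open>BF > 1\<close> compares the two marginals.\<close>
      have "0 < (\<Prod>i<n. g \<theta>0 (X i))"
        using X(2) W_pos(1)[OF _ \<theta>0 \<gamma>0] by (intro prod_pos) auto
      then have "0 < ennreal (\<Prod>i<n. g \<theta>0 (X i))" by simp
      also have "\<dots> \<le> ennreal (\<kappa> n) * mixture_lik ?\<pi> g n X" using elim(1) X \<theta>0 by simp
      finally have "mixture_lik ?\<pi> g n X \<noteq> 0" by auto
      then have a0: "0 < ?a" unfolding a[symmetric] by (simp add: ennreal_eq_0_iff)
      have "X \<in> E n \<longleftrightarrow> ?a < ?b" using X(1) a0 by (simp add: E_def BF_def bayes_factor_def)
      then show "(X \<in> E n \<longrightarrow> mixture_lik ?\<pi> g n X \<le> mixture_lik ?\<nu> h n X) \<and>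
        (X \<notin> E n \<longrightarrow> mixture_lik ?\<nu> h n X \<le> mixture_lik ?\<pi> g n X)"
        unfolding a[symmetric] b[symmetric] by (auto intro: ennreal_leI)
    qed
  qed
  interpret S: bayes_test M ?\<nu> ?\<pi> h g W U T \<kappa> \<tau> "\<lambda>n. space (\<Pi>\<^sub>M i\<in>{..<n}. M) - E n" \<alpha>
    by (rule T.swap_bayes_test)

  have sample: "sample_law n \<mu> f = sample_law n M f" if "law M f = law \<mu> f" for n f
    using that by (simp add: sample_law_def)
  have space_sample: "space (sample_law n M f) = space (\<Pi>\<^sub>M i\<in>{..<n}. M)" for n f
    by (simp add: sample_law_def space_PiM)
  have err_g: "prob_select_h \<mu> (g \<theta>) n (BF n) = T.err n \<theta>" if "\<theta> \<in> \<Theta>" for n \<theta>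
    unfolding prob_select_h_def T.err_def sample[OF law_g[OF that]] space_sample E_def ..
  have err_h: "prob_select_g \<mu> (h \<gamma>) n (BF n) = S.err n \<gamma>" if "\<gamma> \<in> \<Gamma>" for n \<gamma>
    unfolding prob_select_g_def S.err_def sample[OF law_h[OF that]] space_sample unfolding E_def
    by (rule arg_cong[where f = "measure _"]) auto
  have int_g: "(LINT \<theta>:\<Theta>|lborel. prob_select_h \<mu> (g \<theta>) n (BF n) * \<phi>\<^sub>g \<theta>) = (LINT \<theta>|?\<pi>. T.err n \<theta>)" for n
    unfolding G.integral_prior[OF T.measurable_err]
    by (intro set_lebesgue_integral_cong) (auto simp: err_g mult.commute)
  have int_h: "(LINT \<gamma>:\<Gamma>|lborel. prob_select_g \<mu> (h \<gamma>) n (BF n) * \<phi>\<^sub>h \<gamma>) = (LINT \<gamma>|?\<nu>. S.err n \<gamma>)" for n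
    unfolding H.integral_prior[OF S.measurable_err]
    by (intro set_lebesgue_integral_cong) (auto simp: err_h mult.commute)
  have sup_g: "(SUP \<theta>\<in>\<Theta>. ln (prob_select_h \<mu> (g \<theta>) n (BF n))) = (SUP \<theta>\<in>space ?\<pi>. ln (T.err n \<theta>))" for n
    by (simp add: err_g cong: SUP_cong)
  have sup_h: "(SUP \<gamma>\<in>\<Gamma>. ln (prob_select_g \<mu> (h \<gamma>) n (BF n))) = (SUP \<gamma>\<in>space ?\<nu>. ln (S.err n \<gamma>))" for n
    by (simp add: err_h cong: SUP_cong)
  \<comment> \<open>All four sequences are compared with the same line
    \<open>- (n * \<rho>)\<close>; the chain of equivalences follows by symmetry and
    transitivity.\<close>
  note rates = T.ln_integral_err_rate T.SUP_ln_err_rate S.ln_integral_err_rate S.SUP_ln_err_rate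
  show ?thesis
    unfolding Let_def BF_def[symmetric] int_g int_h sup_g sup_h \<rho> T.\<rho>_def[symmetric]
    using rates asymp_equiv_trans asymp_equiv_sym by blast
qed

end
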